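(* Let $(\mathscr{A},\delta)$ be a discrete quantum group and denote its coinverse by $\kappa$. Then the set of almost periodic elements $$\mathscr{AP}=\{x\in M(\mathscr{A}):\ \delta(x)\in M(\mathscr{A})\otimes M(\mathscr{A})\}$$ is a unital $*$-subalgebra of $M(\mathscr{A})$. Moreover we have 1. $\delta(\mathscr{AP})\subset\mathscr{AP}\otimes\mathscr{AP}$, 2. $\kappa(\mathscr{AP})=\mathscr{AP}$.
   Context: All algebras are over $\mathbb{C}$; $\otimes$ is the algebraic tensor product. For an algebra $\mathscr{A}$ with non degenerate product, $M(\mathscr{A})$ is its multiplier algebra (pairs of linear maps $a\mapsto ma$, $a\mapsto am$ on $\mathscr{A}$ with $(bm)a=b(ma)$). A homomorphism $\Phi:\mathscr{A}\to M(\mathscr{B})$ is non degenerate if $\Phi(\mathscr{A})\mathscr{B}=\mathscr{B}\Phi(\mathscr{A})=\mathscr{B}$ (linear spans of products); it then extends uniquely to a unital homomorphism $M(\mathscr{A})\to M(\mathscr{B})$, denoted by the same symbol. A multiplier Hopf algebra is a pair $(\mathscr{A},\delta)$ of an algebra $\mathscr{A}$ with non degenerate product and a homomorphism $\delta:\mathscr{A}\to M(\mathscr{A}\otimes\mathscr{A})$ such that the maps $T_1(a\otimes b)=\delta(a)(I\otimes b)$ and $T_2(a\otimes b)=(a\otimes I)\delta(b)$ are bijections of $\mathscr{A}\otimes\mathscr{A}$ onto $\mathscr{A}\otimes\mathscr{A}$, and $T_2\otimes\mathrm{id}$ and $\mathrm{id}\otimes T_1$ commute on $\mathscr{A}\otimes\mathscr{A}\otimes\mathscr{A}$.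 Then $\delta$ is non degenerate. There is a multiplicative functional $\varepsilon$ on $\mathscr{A}$ (counit) with $(\mathrm{id}\otimes\varepsilon)((a\otimes I)\delta(b))=ab=(\varepsilon\otimes\mathrm{id})(\delta(a)(I\otimes b))$, and an antihomomorphism $\kappa:\mathscr{A}\to M(\mathscr{A})$ (coinverse, antipode) with $\mu[(\mathrm{id}\otimes\kappa)((a\otimes I)\delta(b))(I\otimes c)]=a\varepsilon(b)c$ and $\mu[(a\otimes I)(\kappa\otimes\mathrm{id})(\delta(b)(I\otimes c))]=a\varepsilon(b)c$ for all $a,b,c\in\mathscr{A}$, where $\mu$ is multiplication. It is a multiplier Hopf $*$-algebra if $\mathscr{A}$ is a $*$-algebra and $\delta$ is a $*$-homomorphism; in that case $\kappa$ is an antiisomorphism $\mathscr{A}\to\mathscr{A}$ and extends to an antiisomorphism $M(\mathscr{A})\to M(\mathscr{A})$. A discrete quantum group is a multiplier Hopf $*$-algebra $(\mathscr{A},\delta)$ such that $\mathscr{A}$ is a direct sum of full matrix algebras. In the claim, $\delta:M(\mathscr{A})\to M(\mathscr{A}\otimes\mathscr{A})$ and $\kappa:M(\mathscr{A})\to M(\mathscr{A})$ denote the extensions, and $M(\mathscr{A})\otimes M(\mathscr{A})$ is regarded as a subalgebra of $M(\mathscr{A}\otimes\mathscr{A})$. *)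

theory Defs
  imports Complex_Main "HOL-Library.Poly_Mapping" "Jordan_Normal_Form.Matrix"
begin

section \<open>Complex algebras and *-algebras (not necessarily unital)\<close>

class scaleC =
  fixes scaleC :: "complex \<Rightarrow> 'a \<Rightarrow> 'a"  (infixr \<open>*\<^sub>C\<close> 75)

class complex_vector = scaleC + ab_group_add +
  assumes scaleC_add_right: "c *\<^sub>C (x + y) = c *\<^sub>C x + c *\<^sub>C y"
    and scaleC_add_left: "(c + d) *\<^sub>C x = c *\<^sub>C x + d *\<^sub>C x"
    and scaleC_scaleC: "c *\<^sub>C d *\<^sub>C x = (c * d) *\<^sub>C x"
    and scaleC_one: "1 *\<^sub>C x = x"

class complex_algebra = complex_vector + ring +
  assumes mult_scaleC_left: "(c *\<^sub>C x) * y = c *\<^sub>C (x * y)"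
    and mult_scaleC_right: "x * (c *\<^sub>C y) = c *\<^sub>C (x * y)"

class complex_star_algebra = complex_algebra +
  fixes star :: "'a \<Rightarrow> 'a"
  assumes star_add: "star (x + y) = star x + star y"
    and star_scaleC: "star (c *\<^sub>C x) = cnj c *\<^sub>C star x"
    and star_mult: "star (x * y) = star y * star x"
    and star_star: "star (star x) = x"

global_interpretation cvec: vector_space "scaleC :: complex \<Rightarrow> 'a \<Rightarrow> 'a::complex_vector"
  by unfold_locales (simp_all add: scaleC_add_right scaleC_add_left scaleC_scaleC scaleC_one)

abbreviation clinear :: "('a::complex_vector \<Rightarrow> 'b::complex_vector) \<Rightarrow> bool"
  where "clinear \<equiv> Vector_Spaces.linear scaleC scaleC"

definition cbilinear :: "('a::complex_vector \<Rightarrow> 'b::complex_vector \<Rightarrow> 'c::complex_vector) \<Rightarrow> bool"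
  where "cbilinear \<beta> \<longleftrightarrow> (\<forall>a. clinear (\<beta> a)) \<and> (\<forall>b. clinear (\<lambda>a. \<beta> a b))"

instantiation complex :: complex_algebra
begin
definition scaleC_complex :: "complex \<Rightarrow> complex \<Rightarrow> complex"
  where "scaleC_complex c x = c * x"
instance by standard (simp_all add: scaleC_complex_def algebra_simps)
end

instantiation poly_mapping :: (type, complex_vector) complex_vector
begin
lift_definition scaleC_poly_mapping :: "complex \<Rightarrow> ('a \<Rightarrow>\<^sub>0 'b) \<Rightarrow> ('a \<Rightarrow>\<^sub>0 'b)"
  is "\<lambda>c f k. c *\<^sub>C f k"
  by (metis (mono_tags, lifting) cvec.scale_eq_0_iff finite_subset mem_Collect_eq subsetI)
instance
  by standard (transfer; simp add: scaleC_add_right scaleC_add_left scaleC_scaleC scaleC_one)+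
end

lemma clinearI:
  assumes "\<And>x y. f (x + y) = f x + f y" "\<And>c x. f (c *\<^sub>C x) = c *\<^sub>C f x"
  shows "clinear f"
  by unfold_locales (use assms in auto)

lemma clinear_add: "clinear f \<Longrightarrow> f (x + y) = f x + f y"
  unfolding Vector_Spaces.linear_def module_hom_def module_hom_axioms_def by blast

lemma clinear_scaleC: "clinear f \<Longrightarrow> f (c *\<^sub>C x) = c *\<^sub>C f x"
  unfolding Vector_Spaces.linear_def module_hom_def module_hom_axioms_def by blast

lemma cbilinearI:
  assumes "\<And>a b b'. \<beta> a (b + b') = \<beta> a b + \<beta> a b'" "\<And>a c b. \<beta> a (c *\<^sub>C b) = c *\<^sub>C \<beta> a b"
    "\<And>a a' b. \<beta> (a + a') b = \<beta> a b + \<beta> a' b" "\<And>a c b. \<beta> (c *\<^sub>C a) b = c *\<^sub>C \<beta> a b"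
  shows "cbilinear \<beta>"
  unfolding cbilinear_def using assms by (auto intro!: clinearI)

lemma star_zero [simp]: "star 0 = (0::'a::complex_star_algebra)"
  by (metis add_cancel_right_left star_add)

section \<open>The algebraic tensor product\<close>

text \<open>The tensor product is the free complex vector space on pairs modulo the subspace spanned
  by the bilinearity relations.\<close>

definition tensor_relations :: "(('a::complex_vector \<times> 'b::complex_vector) \<Rightarrow>\<^sub>0 complex) set"
  where "tensor_relations =
    {Poly_Mapping.single (a + a', b) 1 - Poly_Mapping.single (a, b) 1 - Poly_Mapping.single (a', b) 1
      | a a' b. True} \<union>
    {Poly_Mapping.single (a, b + b') 1 - Poly_Mapping.single (a, b) 1 - Poly_Mapping.single (a, b') 1
      | a b b'. True} \<union>
    {Poly_Mapping.single (c *\<^sub>C a, b) 1 - c *\<^sub>C Poly_Mapping.single (a, b) 1 | c a b. True} \<union>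
    {Poly_Mapping.single (a, c *\<^sub>C b) 1 - c *\<^sub>C Poly_Mapping.single (a, b) 1 | c a b. True}"

definition tensor_rel ::
  "(('a::complex_vector \<times> 'b::complex_vector) \<Rightarrow>\<^sub>0 complex) \<Rightarrow> (('a \<times> 'b) \<Rightarrow>\<^sub>0 complex) \<Rightarrow> bool"
  where "tensor_rel f g \<longleftrightarrow> f - g \<in> cvec.span tensor_relations"

lemma equivp_tensor_rel:
  "equivp (tensor_rel :: (('a::complex_vector \<times> 'b::complex_vector) \<Rightarrow>\<^sub>0 complex) \<Rightarrow> _)"
  (is "equivp ?R")
proof (rule equivpI)
  show "reflp ?R"
    by (rule reflpI) (simp add: tensor_rel_def cvec.span_zero)
  show "symp ?R"
  proof (rule sympI)
    fix f g :: "('a \<times> 'b) \<Rightarrow>\<^sub>0 complex"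
    assume "tensor_rel f g"
    then show "tensor_rel g f"
      using cvec.span_neg[of "f - g" tensor_relations] by (simp add: tensor_rel_def)
  qed
  show "transp ?R"
  proof (rule transpI)
    fix f g h :: "('a \<times> 'b) \<Rightarrow>\<^sub>0 complex"
    assume "tensor_rel f g" "tensor_rel g h"
    then show "tensor_rel f h"
      using cvec.span_add[of "f - g" tensor_relations "g - h"] by (simp add: tensor_rel_def)
  qed
qed

quotient_type (overloaded) ('a, 'b) tensor =
  "(('a::complex_vector) \<times> ('b::complex_vector)) \<Rightarrow>\<^sub>0 complex" / tensor_rel
  by (rule equivp_tensor_rel)

lemma abs_tensor_cases:
  obtains f where "z = abs_tensor f"
  by (induction z rule: tensor.abs_induct) blast

type_notation tensor (infixr \<open>\<otimes>\<^sub>t\<close> 70)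

instantiation tensor :: (complex_vector, complex_vector) complex_vector
begin
lift_definition zero_tensor :: "('a, 'b) tensor" is 0 .
lift_definition plus_tensor :: "('a, 'b) tensor \<Rightarrow> ('a, 'b) tensor \<Rightarrow> ('a, 'b) tensor" is "(+)"
  unfolding tensor_rel_def add_diff_add by (rule cvec.span_add)
lift_definition minus_tensor :: "('a, 'b) tensor \<Rightarrow> ('a, 'b) tensor \<Rightarrow> ('a, 'b) tensor" is "(-)"
proof -
  fix f f' g g' :: "('a \<times> 'b) \<Rightarrow>\<^sub>0 complex"
  assume "tensor_rel f f'" "tensor_rel g g'"
  then have "(f - f') - (g - g') \<in> cvec.span tensor_relations"
    unfolding tensor_rel_def by (rule cvec.span_diff)
  moreover have "(f - f') - (g - g') = (f - g) - (f' - g')"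
    by (simp only: diff_conv_add_uminus minus_add_distrib minus_minus add_ac)
  ultimately show "tensor_rel (f - g) (f' - g')"
    unfolding tensor_rel_def by simp
qed
lift_definition uminus_tensor :: "('a, 'b) tensor \<Rightarrow> ('a, 'b) tensor" is "uminus"
proof -
  fix f f' :: "('a \<times> 'b) \<Rightarrow>\<^sub>0 complex"
  assume "tensor_rel f f'"
  then have "- (f - f') \<in> cvec.span tensor_relations"
    unfolding tensor_rel_def by (rule cvec.span_neg)
  then show "tensor_rel (- f) (- f')"
    unfolding tensor_rel_def minus_diff_minus .
qed
lift_definition scaleC_tensor :: "complex \<Rightarrow> ('a, 'b) tensor \<Rightarrow> ('a, 'b) tensor" is "scaleC"
  unfolding tensor_rel_def cvec.scale_right_diff_distrib[symmetric] by (rule cvec.span_scale)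
instance
proof
  fix x y z :: "('a, 'b) tensor" and c d :: complex
  note abs_eqs = plus_tensor.abs_eq minus_tensor.abs_eq uminus_tensor.abs_eq zero_tensor.abs_eq
    scaleC_tensor.abs_eq
  obtain f where f: "x = abs_tensor f" by (rule abs_tensor_cases)
  obtain g where g: "y = abs_tensor g" by (rule abs_tensor_cases)
  obtain h where h: "z = abs_tensor h" by (rule abs_tensor_cases)
  show "x + y + z = x + (y + z)"
    unfolding f g h abs_eqs by (simp only: add.assoc)
  show "x + y = y + x"
    unfolding f g abs_eqs by (simp only: add.commute)
  show "0 + x = x" "- x + x = 0" "x - y = x + - y"
    unfolding f g abs_eqs by simp_all
  show "c *\<^sub>C (x + y) = c *\<^sub>C x + c *\<^sub>C y"
    unfolding f g abs_eqs by (simp only: scaleC_add_right)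
  show "(c + d) *\<^sub>C x = c *\<^sub>C x + d *\<^sub>C x"
    unfolding f abs_eqs by (simp only: scaleC_add_left)
  show "c *\<^sub>C d *\<^sub>C x = (c * d) *\<^sub>C x"
    unfolding f abs_eqs by (simp only: scaleC_scaleC)
  show "1 *\<^sub>C x = x"
    unfolding f abs_eqs by (simp only: scaleC_one)
qed
end

lift_definition tens :: "'a::complex_vector \<Rightarrow> 'b::complex_vector \<Rightarrow> 'a \<otimes>\<^sub>t 'b"  (infixr \<open>\<otimes>\<^sub>t\<close> 75)
  is "\<lambda>a b. Poly_Mapping.single (a, b) 1" .

lemma tens_add_left: "(a + a') \<otimes>\<^sub>t b = a \<otimes>\<^sub>t b + a' \<otimes>\<^sub>t b"
  by transfer (unfold tensor_rel_def diff_diff_eq[symmetric], rule cvec.span_base,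
      unfold tensor_relations_def, blast)

lemma tens_add_right: "a \<otimes>\<^sub>t (b + b') = a \<otimes>\<^sub>t b + a \<otimes>\<^sub>t b'"
  by transfer (unfold tensor_rel_def diff_diff_eq[symmetric], rule cvec.span_base,
      unfold tensor_relations_def, blast)

lemma tens_scaleC_left: "(c *\<^sub>C a) \<otimes>\<^sub>t b = c *\<^sub>C (a \<otimes>\<^sub>t b)"
  by transfer (unfold tensor_rel_def, rule cvec.span_base, unfold tensor_relations_def, blast)

lemma tens_scaleC_right: "a \<otimes>\<^sub>t (c *\<^sub>C b) = c *\<^sub>C (a \<otimes>\<^sub>t b)"
  by transfer (unfold tensor_rel_def, rule cvec.span_base, unfold tensor_relations_def, blast)

lemmas tens_simps = tens_add_left tens_add_right tens_scaleC_left tens_scaleC_right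

lemma tens_induct [case_names tens add]:
  assumes tens: "\<And>a b. P (a \<otimes>\<^sub>t b)" and add: "\<And>x y. P x \<Longrightarrow> P y \<Longrightarrow> P (x + y)"
  shows "P z"
proof -
  obtain f where z: "z = abs_tensor f" by (rule abs_tensor_cases)
  have single: "P (abs_tensor (Poly_Mapping.single k v))" for k v
  proof -
    have "Poly_Mapping.single k v = v *\<^sub>C Poly_Mapping.single k (1::complex)"
      by (rule poly_mapping_eqI)
        (simp add: scaleC_poly_mapping.rep_eq lookup_single scaleC_complex_def when_def)
    then have "abs_tensor (Poly_Mapping.single k v) = v *\<^sub>C (fst k \<otimes>\<^sub>t snd k)"
      by (simp add: scaleC_tensor.abs_eq tens.abs_eq)
    also have "\<dots> = (v *\<^sub>C fst k) \<otimes>\<^sub>t snd k"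
      by (rule tens_scaleC_left[symmetric])
    finally show ?thesis using tens by simp
  qed
  have "P (abs_tensor f)"
  proof (induction f rule: update_induct)
    case const
    show ?case using single[of undefined 0] by simp
  next
    case (update f k v)
    have "Poly_Mapping.update k v f = Poly_Mapping.single k v + f"
      using update(1) by (intro poly_mapping_eqI)
        (auto simp: lookup_update lookup_add lookup_single in_keys_iff when_def)
    then show ?case
      using add[OF single update(3)] by (simp add: plus_tensor.abs_eq)
  qed
  with z show ?thesis by simp
qed

text \<open>The linear map on the tensor product which the universal property attaches to a bilinear map.
  The scaling \<open>s\<close> of the target is a parameter so that conjugate-linear maps are covered too.\<close>

definition tensor_ext :: "(complex \<Rightarrow> 'c \<Rightarrow> 'c::ab_group_add) \<Rightarrow>
    ('a::complex_vector \<Rightarrow> 'b::complex_vector \<Rightarrow> 'c) \<Rightarrow> 'a \<otimes>\<^sub>t 'b \<Rightarrow> 'c"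
  where "tensor_ext s \<beta> =
    (THE h. Vector_Spaces.linear scaleC s h \<and> (\<forall>a b. h (a \<otimes>\<^sub>t b) = \<beta> a b))"

abbreviation tensor_lift :: "('a::complex_vector \<Rightarrow> 'b::complex_vector \<Rightarrow> 'c::complex_vector) \<Rightarrow>
    'a \<otimes>\<^sub>t 'b \<Rightarrow> 'c"
  where "tensor_lift \<equiv> tensor_ext scaleC"

lemma tensor_ext_exists:
  fixes \<beta> :: "'a::complex_vector \<Rightarrow> 'b::complex_vector \<Rightarrow> 'c::ab_group_add"
  assumes s: "vector_space s"
    and \<beta>: "\<And>a. Vector_Spaces.linear scaleC s (\<beta> a)" "\<And>b. Vector_Spaces.linear scaleC s (\<lambda>a. \<beta> a b)"
  shows "\<exists>h. Vector_Spaces.linear scaleC s h \<and> (\<forall>a b. h (a \<otimes>\<^sub>t b) = \<beta> a b)"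
proof -
  interpret s: vector_space s by (rule s)
  define F where "F f = (\<Sum>p\<in>Poly_Mapping.keys f. s (Poly_Mapping.lookup f p) (\<beta> (fst p) (snd p)))"
    for f :: "('a \<times> 'b) \<Rightarrow>\<^sub>0 complex"
  have F_sup: "F f = (\<Sum>p\<in>S. s (Poly_Mapping.lookup f p) (\<beta> (fst p) (snd p)))"
    if "finite S" "Poly_Mapping.keys f \<subseteq> S" for S f
    unfolding F_def using that by (intro sum.mono_neutral_left) (auto simp: in_keys_iff)
  have F_add: "F (f + g) = F f + F g" for f g
  proof -
    let ?S = "Poly_Mapping.keys f \<union> Poly_Mapping.keys g"
    have "Poly_Mapping.keys (f + g) \<subseteq> ?S" by (rule keys_add)
    then show ?thesis
      by (simp add: F_sup[of ?S] lookup_add s.scale_left_distrib sum.distrib)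
  qed
  have F_scale: "F (c *\<^sub>C f) = s c (F f)" for c f
  proof -
    have "Poly_Mapping.keys (c *\<^sub>C f) \<subseteq> Poly_Mapping.keys f"
      by (auto simp: in_keys_iff scaleC_poly_mapping.rep_eq)
    then show ?thesis
      by (simp add: F_sup[of "Poly_Mapping.keys f"] scaleC_poly_mapping.rep_eq scaleC_complex_def
          s.scale_sum_right)
  qed
  have F_single: "F (Poly_Mapping.single (a, b) 1) = \<beta> a b" for a b
    by (simp add: F_def)
  interpret F: Vector_Spaces.linear scaleC s F
    by unfold_locales (simp_all add: F_add F_scale)
  note lin = module_hom.add[OF Vector_Spaces.linear.axioms(3)] module_hom.scale[OF Vector_Spaces.linear.axioms(3)]
  have F_rel: "F r = 0" if "r \<in> tensor_relations" for r
    using that lin[OF \<beta>(1)] lin[OF \<beta>(2)]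
    by (auto simp: tensor_relations_def F.diff F_single F.scale)
  have F_span: "F r = 0" if "r \<in> cvec.span tensor_relations" for r
    using F.eq_0_on_span[OF F_rel that] .
  have resp: "F f = F g" if "tensor_rel f g" for f g
    using F_span[of "f - g"] that by (simp add: tensor_rel_def F.diff)
  define h where "h z = F (rep_tensor z)" for z
  have h_abs: "h (abs_tensor f) = F f" for f
    unfolding h_def
    by (rule resp) (rule Quotient3_rep_abs[OF Quotient3_tensor], simp add: tensor_rel_def cvec.span_zero)
  have h_add: "h (x + y) = h x + h y" for x y
  proof -
    obtain f where "x = abs_tensor f" by (rule abs_tensor_cases)
    moreover obtain g where "y = abs_tensor g" by (rule abs_tensor_cases)
    ultimately show ?thesis by (simp add: plus_tensor.abs_eq h_abs F_add)
  qed
  have h_scale: "h (c *\<^sub>C x) = s c (h x)" for c x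
  proof -
    obtain f where "x = abs_tensor f" by (rule abs_tensor_cases)
    then show ?thesis by (simp add: scaleC_tensor.abs_eq h_abs F_scale)
  qed
  have "Vector_Spaces.linear scaleC s h"
    by unfold_locales (simp_all add: h_add h_scale)
  moreover have "h (a \<otimes>\<^sub>t b) = \<beta> a b" for a b
    by (simp add: tens.abs_eq h_abs F_single)
  ultimately show ?thesis by blast
qed

lemma tensor_ext:
  fixes \<beta> :: "'a::complex_vector \<Rightarrow> 'b::complex_vector \<Rightarrow> 'c::ab_group_add"
  assumes s: "vector_space s"
    and \<beta>: "\<And>a. Vector_Spaces.linear scaleC s (\<beta> a)" "\<And>b. Vector_Spaces.linear scaleC s (\<lambda>a. \<beta> a b)"
  shows "Vector_Spaces.linear scaleC s (tensor_ext s \<beta>)" "tensor_ext s \<beta> (a \<otimes>\<^sub>t b) = \<beta> a b"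
proof -
  obtain h where h: "Vector_Spaces.linear scaleC s h" "\<forall>a b. h (a \<otimes>\<^sub>t b) = \<beta> a b"
    using tensor_ext_exists[OF assms] by blast
  have uniq: "g = h" if "Vector_Spaces.linear scaleC s g" "\<forall>a b. g (a \<otimes>\<^sub>t b) = \<beta> a b" for g
  proof
    fix z
    show "g z = h z"
      using that h module_hom.add[OF Vector_Spaces.linear.axioms(3)[OF h(1)]]
        module_hom.add[OF Vector_Spaces.linear.axioms(3)[OF that(1)]]
      by (induction z rule: tens_induct) auto
  qed
  have "Vector_Spaces.linear scaleC s (tensor_ext s \<beta>) \<and> (\<forall>a b. tensor_ext s \<beta> (a \<otimes>\<^sub>t b) = \<beta> a b)"
    unfolding tensor_ext_def by (rule theI[of _ h]) (use h uniq in blast)+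
  then show "Vector_Spaces.linear scaleC s (tensor_ext s \<beta>)" "tensor_ext s \<beta> (a \<otimes>\<^sub>t b) = \<beta> a b"
    by auto
qed

lemma clinear_tensor_lift: "cbilinear \<beta> \<Longrightarrow> clinear (tensor_lift \<beta>)"
  and tensor_lift_tens [simp]: "cbilinear \<beta> \<Longrightarrow> tensor_lift \<beta> (a \<otimes>\<^sub>t b) = \<beta> a b"
  by (simp_all add: tensor_ext cvec.vector_space_axioms cbilinear_def)

lemma tensor_lift_add [simp]: "cbilinear \<beta> \<Longrightarrow> tensor_lift \<beta> (x + y) = tensor_lift \<beta> x + tensor_lift \<beta> y"
  and tensor_lift_scaleC [simp]: "cbilinear \<beta> \<Longrightarrow> tensor_lift \<beta> (c *\<^sub>C x) = c *\<^sub>C tensor_lift \<beta> x"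
  by (simp_all add: clinear_tensor_lift clinear_add clinear_scaleC)

definition tensor_map :: "('a::complex_vector \<Rightarrow> 'c::complex_vector) \<Rightarrow>
    ('b::complex_vector \<Rightarrow> 'd::complex_vector) \<Rightarrow> 'a \<otimes>\<^sub>t 'b \<Rightarrow> 'c \<otimes>\<^sub>t 'd"
  where "tensor_map f g = tensor_lift (\<lambda>a b. f a \<otimes>\<^sub>t g b)"

lemma cbilinear_tensor_map: "clinear f \<Longrightarrow> clinear g \<Longrightarrow> cbilinear (\<lambda>a b. f a \<otimes>\<^sub>t g b)"
  by (intro cbilinearI) (simp_all add: clinear_add clinear_scaleC tens_simps)

lemma tensor_map_simps [simp]:
  assumes "clinear f" "clinear g"
  shows "tensor_map f g (a \<otimes>\<^sub>t b) = f a \<otimes>\<^sub>t g b"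
    "tensor_map f g (x + y) = tensor_map f g x + tensor_map f g y"
    "tensor_map f g (c *\<^sub>C x) = c *\<^sub>C tensor_map f g x"
  unfolding tensor_map_def by (simp_all add: cbilinear_tensor_map[OF assms])

lemma clinear_tensor_map: "clinear f \<Longrightarrow> clinear g \<Longrightarrow> clinear (tensor_map f g)"
  by (intro clinearI) simp_all

definition tensor_assoc :: "('a::complex_vector \<otimes>\<^sub>t 'b::complex_vector) \<otimes>\<^sub>t 'c::complex_vector \<Rightarrow>
    'a \<otimes>\<^sub>t ('b \<otimes>\<^sub>t 'c)"
  where "tensor_assoc = tensor_lift (\<lambda>z c. tensor_map id (\<lambda>b. b \<otimes>\<^sub>t c) z)"

lemma tensor_assoc_tens: "tensor_assoc ((a \<otimes>\<^sub>t b) \<otimes>\<^sub>t c) = a \<otimes>\<^sub>t (b \<otimes>\<^sub>t c)"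
proof -
  have id: "clinear (id :: 'a \<Rightarrow> 'a)" and t: "clinear (\<lambda>b :: 'b. b \<otimes>\<^sub>t c)" for c :: 'c
    by (auto intro!: clinearI simp: tens_simps)
  note map_simps = tensor_map_simps[OF id t]
  have "cbilinear (\<lambda>(z :: 'a \<otimes>\<^sub>t 'b) (c :: 'c). tensor_map id (\<lambda>b. b \<otimes>\<^sub>t c) z)"
  proof (rule cbilinearI)
    fix z :: "'a \<otimes>\<^sub>t 'b" and c c' :: 'c and k :: complex
    show "tensor_map id (\<lambda>b. b \<otimes>\<^sub>t (c + c')) z
        = tensor_map id (\<lambda>b. b \<otimes>\<^sub>t c) z + tensor_map id (\<lambda>b. b \<otimes>\<^sub>t c') z"
      by (induction z rule: tens_induct)
        (simp_all only: map_simps, simp_all only: tens_simps add_ac)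
    show "tensor_map id (\<lambda>b. b \<otimes>\<^sub>t (k *\<^sub>C c)) z = k *\<^sub>C tensor_map id (\<lambda>b. b \<otimes>\<^sub>t c) z"
      by (induction z rule: tens_induct)
        (simp_all only: map_simps, simp_all only: tens_simps scaleC_add_right)
  qed (simp_all only: map_simps)
  then show ?thesis
    by (simp add: tensor_assoc_def map_simps)
qed

definition tensor_set :: "'a::complex_vector set \<Rightarrow> 'b::complex_vector set \<Rightarrow> ('a \<otimes>\<^sub>t 'b) set"
  where "tensor_set S T = cvec.span {s \<otimes>\<^sub>t t | s t. s \<in> S \<and> t \<in> T}"

lemma clinear_mult_left: "clinear (\<lambda>x::'a::complex_algebra. a * x)"
  and clinear_mult_right: "clinear (\<lambda>x::'a::complex_algebra. x * a)"
  by (auto intro!: clinearI simp: algebra_simps mult_scaleC_left mult_scaleC_right)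

instantiation tensor :: (complex_algebra, complex_algebra) complex_algebra
begin
definition times_tensor :: "'a \<otimes>\<^sub>t 'b \<Rightarrow> 'a \<otimes>\<^sub>t 'b \<Rightarrow> 'a \<otimes>\<^sub>t 'b"
  where "times_tensor z w = tensor_lift (\<lambda>a b. tensor_map (\<lambda>x. a * x) (\<lambda>x. b * x) w) z"

lemma cbilinear_times_tensor:
  "cbilinear (\<lambda>a b. tensor_map (\<lambda>x. a * x) (\<lambda>x. b * x) (w :: 'a \<otimes>\<^sub>t 'b))"
proof (rule cbilinearI)
  fix a a' :: 'a and b b' :: 'b and c
  show "tensor_map ((*) a) ((*) (b + b')) w = tensor_map ((*) a) ((*) b) w + tensor_map ((*) a) ((*) b') w"
    by (induction w rule: tens_induct)
      (simp_all only: tensor_map_simps[OF clinear_mult_left clinear_mult_left],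
        simp_all only: distrib_right tens_simps add_ac)
  show "tensor_map ((*) (a + a')) ((*) b) w = tensor_map ((*) a) ((*) b) w + tensor_map ((*) a') ((*) b) w"
    by (induction w rule: tens_induct)
      (simp_all only: tensor_map_simps[OF clinear_mult_left clinear_mult_left],
        simp_all only: distrib_right tens_simps add_ac)
  show "tensor_map ((*) a) ((*) (c *\<^sub>C b)) w = c *\<^sub>C tensor_map ((*) a) ((*) b) w"
    by (induction w rule: tens_induct)
      (simp_all only: tensor_map_simps[OF clinear_mult_left clinear_mult_left],
        simp_all only: mult_scaleC_left tens_simps scaleC_add_right)
  show "tensor_map ((*) (c *\<^sub>C a)) ((*) b) w = c *\<^sub>C tensor_map ((*) a) ((*) b) w"
    by (induction w rule: tens_induct)
      (simp_all only: tensor_map_simps[OF clinear_mult_left clinear_mult_left],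
        simp_all only: mult_scaleC_left tens_simps scaleC_add_right)
qed

lemma tens_times: "(a \<otimes>\<^sub>t b) * w = tensor_map ((*) a) ((*) b) w" for a :: 'a and b :: 'b
  unfolding times_tensor_def by (rule tensor_lift_tens[OF cbilinear_times_tensor])

lemma tens_times_tens: "(a \<otimes>\<^sub>t b) * (c \<otimes>\<^sub>t d) = (a * c) \<otimes>\<^sub>t (b * d)" for a c :: 'a and b d :: 'b
  by (simp add: tens_times clinear_mult_left)

lemma tensor_mult_aux:
  fixes x y z :: "'a \<otimes>\<^sub>t 'b"
  shows "(x + y) * z = x * z + y * z" "x * (y + z) = x * y + x * z"
    "(c *\<^sub>C x) * y = c *\<^sub>C (x * y)" "x * (c *\<^sub>C y) = c *\<^sub>C (x * y)"
proof -
  show l: "(x + y) * z = x * z + y * z" for x y z :: "'a \<otimes>\<^sub>t 'b"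
    by (simp add: times_tensor_def cbilinear_times_tensor)
  show "(c *\<^sub>C x) * y = c *\<^sub>C (x * y)"
    by (simp add: times_tensor_def cbilinear_times_tensor)
  show "x * (y + z) = x * y + x * z"
  proof (induction x rule: tens_induct)
    case (tens a b)
    then show ?case by (simp add: tens_times clinear_mult_left)
  qed (simp add: l algebra_simps)
  show "x * (c *\<^sub>C y) = c *\<^sub>C (x * y)"
  proof (induction x rule: tens_induct)
    case (tens a b)
    then show ?case by (simp add: tens_times clinear_mult_left)
  qed (simp add: l scaleC_add_right)
qed

instance
proof
  fix x y z :: "'a \<otimes>\<^sub>t 'b" and c
  show "(x + y) * z = x * z + y * z" "x * (y + z) = x * y + x * z"
    "(c *\<^sub>C x) * y = c *\<^sub>C (x * y)" "x * (c *\<^sub>C y) = c *\<^sub>C (x * y)"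
    by (rule tensor_mult_aux)+
  show "x * y * z = x * (y * z)"
  proof (induction x rule: tens_induct)
    case x: (tens a b)
    show ?case
    proof (induction y rule: tens_induct)
      case y: (tens c d)
      show ?case
        by (induction z rule: tens_induct) (simp_all add: tens_times_tens mult.assoc tensor_mult_aux)
    qed (simp add: tensor_mult_aux)
  qed (simp add: tensor_mult_aux)
qed
end

lemma vector_space_conj: "vector_space (\<lambda>c x. cnj c *\<^sub>C (x::'a::complex_vector))"
  by unfold_locales (simp_all add: scaleC_add_right scaleC_add_left scaleC_scaleC scaleC_one)

instantiation tensor :: (complex_star_algebra, complex_star_algebra) complex_star_algebra
begin
definition star_tensor :: "'a \<otimes>\<^sub>t 'b \<Rightarrow> 'a \<otimes>\<^sub>t 'b"
  where "star_tensor = tensor_ext (\<lambda>c x. cnj c *\<^sub>C x) (\<lambda>a b. star a \<otimes>\<^sub>t star b)"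

lemma star_tensor_aux:
  "Vector_Spaces.linear scaleC (\<lambda>c x. cnj c *\<^sub>C x) (star :: 'a \<otimes>\<^sub>t 'b \<Rightarrow> 'a \<otimes>\<^sub>t 'b)"
  "star (a \<otimes>\<^sub>t b) = star a \<otimes>\<^sub>t (star b :: 'b)" for a :: 'a
proof -
  interpret conj: vector_space "\<lambda>c (x :: 'a \<otimes>\<^sub>t 'b). cnj c *\<^sub>C x" by (rule vector_space_conj)
  have 1: "Vector_Spaces.linear scaleC (\<lambda>c x. cnj c *\<^sub>C x) (\<lambda>b. star a \<otimes>\<^sub>t star b :: 'a \<otimes>\<^sub>t 'b)" for a
    by unfold_locales (simp_all add: star_add star_scaleC tens_simps)
  have 2: "Vector_Spaces.linear scaleC (\<lambda>c x. cnj c *\<^sub>C x) (\<lambda>a. star a \<otimes>\<^sub>t star b :: 'a \<otimes>\<^sub>t 'b)" for b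
    by unfold_locales (simp_all add: star_add star_scaleC tens_simps)
  show "Vector_Spaces.linear scaleC (\<lambda>c x. cnj c *\<^sub>C x) (star :: 'a \<otimes>\<^sub>t 'b \<Rightarrow> 'a \<otimes>\<^sub>t 'b)"
    "star (a \<otimes>\<^sub>t b) = star a \<otimes>\<^sub>t (star b :: 'b)" for a :: 'a
    unfolding star_tensor_def by (rule tensor_ext[OF vector_space_conj 1 2])+
qed

instance
proof
  fix x y :: "'a \<otimes>\<^sub>t 'b" and c
  show add: "star (x + y) = star x + star y" for x y :: "'a \<otimes>\<^sub>t 'b"
    using module_hom.add[OF Vector_Spaces.linear.axioms(3)[OF star_tensor_aux(1)]] .
  show "star (c *\<^sub>C x) = cnj c *\<^sub>C star x"
    using module_hom.scale[OF Vector_Spaces.linear.axioms(3)[OF star_tensor_aux(1)]] .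
  show "star (star x) = x"
    by (induction x rule: tens_induct) (simp_all add: add star_tensor_aux(2) star_star)
  show "star (x * y) = star y * star x"
  proof (induction x rule: tens_induct)
    case x: (tens a b)
    show ?case
      by (induction y rule: tens_induct)
        (simp_all add: tens_times_tens star_mult star_tensor_aux(2) add algebra_simps)
  qed (simp add: add algebra_simps)
qed
end

section \<open>The multiplier algebra\<close>

text \<open>A multiplier \<open>m\<close> is the pair of the maps \<open>a \<mapsto> m a\<close> and \<open>a \<mapsto> a m\<close>.\<close>

definition nondegenerate_product :: "'a::complex_algebra itself \<Rightarrow> bool"
  where "nondegenerate_product _ \<longleftrightarrow>
    (\<forall>a::'a. (\<forall>b. a * b = 0) \<longrightarrow> a = 0) \<and> (\<forall>a::'a. (\<forall>b. b * a = 0) \<longrightarrow> a = 0)"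

typedef (overloaded) ('a::complex_algebra) multiplier =
  "{(L, R). clinear L \<and> clinear R \<and> (\<forall>a b::'a. R b * a = b * L a)}"
  by (rule exI[of _ "(id, id)"]) (auto intro: clinearI)

setup_lifting type_definition_multiplier

lift_definition lmul :: "'a::complex_algebra multiplier \<Rightarrow> 'a \<Rightarrow> 'a" is fst .
lift_definition rmul :: "'a::complex_algebra \<Rightarrow> 'a multiplier \<Rightarrow> 'a" is "\<lambda>a m. snd m a" .

lemma lmul_linear: "clinear (lmul m)" and rmul_linear: "clinear (\<lambda>a. rmul a m)"
  and rmul_lmul: "rmul b m * a = b * lmul m a"
  by (transfer; force)+

lemma multiplier_eqI: "(\<And>a. lmul x a = lmul y a) \<Longrightarrow> (\<And>a. rmul a x = rmul a y) \<Longrightarrow> x = y"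
  by transfer (auto simp: prod_eq_iff fun_eq_iff)

lift_definition mult_of :: "'a::complex_algebra \<Rightarrow> 'a multiplier" is "\<lambda>a. (\<lambda>x. a * x, \<lambda>x. x * a)"
  by (auto simp: clinear_mult_left clinear_mult_right mult.assoc)

instantiation multiplier :: (complex_algebra) complex_algebra
begin
lift_definition zero_multiplier :: "'a multiplier" is "(\<lambda>_. 0, \<lambda>_. 0)"
  by (auto intro!: clinearI)
lift_definition plus_multiplier :: "'a multiplier \<Rightarrow> 'a multiplier \<Rightarrow> 'a multiplier"
  is "\<lambda>x y. (\<lambda>a. fst x a + fst y a, \<lambda>a. snd x a + snd y a)"
  by (auto intro!: clinearI simp: clinear_add clinear_scaleC algebra_simps scaleC_add_right)
lift_definition uminus_multiplier :: "'a multiplier \<Rightarrow> 'a multiplier"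
  is "\<lambda>x. (\<lambda>a. - fst x a, \<lambda>a. - snd x a)"
  by (auto intro!: clinearI simp: clinear_add clinear_scaleC algebra_simps)
lift_definition minus_multiplier :: "'a multiplier \<Rightarrow> 'a multiplier \<Rightarrow> 'a multiplier"
  is "\<lambda>x y. (\<lambda>a. fst x a - fst y a, \<lambda>a. snd x a - snd y a)"
  by (auto intro!: clinearI simp: clinear_add clinear_scaleC algebra_simps cvec.scale_right_diff_distrib)
lift_definition scaleC_multiplier :: "complex \<Rightarrow> 'a multiplier \<Rightarrow> 'a multiplier"
  is "\<lambda>c x. (\<lambda>a. c *\<^sub>C fst x a, \<lambda>a. c *\<^sub>C snd x a)"
  by (auto intro!: clinearI simp: clinear_add clinear_scaleC scaleC_add_right scaleC_scaleC
      mult.commute mult_scaleC_left mult_scaleC_right)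
lift_definition times_multiplier :: "'a multiplier \<Rightarrow> 'a multiplier \<Rightarrow> 'a multiplier"
  is "\<lambda>x y. (\<lambda>a. fst x (fst y a), \<lambda>a. snd y (snd x a))"
  by (auto intro!: clinearI simp: clinear_add clinear_scaleC)
instance
proof
  fix x y z :: "'a multiplier" and c d :: complex
  show "x + y + z = x + (y + z)" "x + y = y + x" "0 + x = x" "- x + x = 0" "x - y = x + - y"
    by (transfer, auto)+
  show "c *\<^sub>C (x + y) = c *\<^sub>C x + c *\<^sub>C y" "(c + d) *\<^sub>C x = c *\<^sub>C x + d *\<^sub>C x"
    "c *\<^sub>C d *\<^sub>C x = (c * d) *\<^sub>C x" "1 *\<^sub>C x = x"
    by (transfer, auto simp: scaleC_add_right scaleC_add_left scaleC_scaleC scaleC_one)+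
  show "x * y * z = x * (y * z)" "(x + y) * z = x * z + y * z" "x * (y + z) = x * y + x * z"
    "(c *\<^sub>C x) * y = c *\<^sub>C (x * y)" "x * (c *\<^sub>C y) = c *\<^sub>C (x * y)"
    by (transfer, auto simp: clinear_add clinear_scaleC)+
qed
end

instantiation multiplier :: (complex_algebra) monoid_mult
begin
lift_definition one_multiplier :: "'a multiplier" is "(\<lambda>a. a, \<lambda>a. a)"
  by (auto intro!: clinearI)
instance by standard (transfer, auto)+
end

instantiation multiplier :: (complex_star_algebra) complex_star_algebra
begin
lift_definition star_multiplier :: "'a multiplier \<Rightarrow> 'a multiplier"
  is "\<lambda>x. (\<lambda>a. star (snd x (star a)), \<lambda>a. star (fst x (star a)))"
proof (auto intro!: clinearI simp: clinear_add clinear_scaleC star_add star_scaleC)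
  fix L R :: "'a \<Rightarrow> 'a" and a b :: 'a
  assume "\<forall>a b. R b * a = b * L a"
  then have "star (R (star a) * star b) = star (star a * L (star b))" by simp
  then show "star (L (star b)) * a = b * star (R (star a))"
    by (simp add: star_mult star_star)
qed
instance
  by standard (transfer, auto simp: star_add star_scaleC star_mult star_star)+
end

lemma lmul_simps [simp]:
  "lmul (x + y) a = lmul x a + lmul y a" "lmul (c *\<^sub>C x) a = c *\<^sub>C lmul x a"
  "lmul (x * y) a = lmul x (lmul y a)" "lmul 1 a = a" "lmul 0 a = 0" "lmul (mult_of b) a = b * a"
  by (transfer; simp)+

lemma rmul_simps [simp]:
  "rmul a (x + y) = rmul a x + rmul a y" "rmul a (c *\<^sub>C x) = c *\<^sub>C rmul a x"
  "rmul a (x * y) = rmul (rmul a x) y" "rmul a 1 = a" "rmul a 0 = 0" "rmul a (mult_of b) = a * b"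
  by (transfer; simp)+

lemma star_simps:
  "lmul (star x) a = star (rmul (star a) x)" "rmul a (star x) = star (lmul x (star a))"
  for a :: "'a::complex_star_algebra"
  by (transfer; simp)+

text \<open>For \<open>m \<in> M(A)\<close> and \<open>n \<in> M(B)\<close>, the multiplier \<open>m \<otimes> n\<close> of \<open>A \<otimes> B\<close>; the linear map
  \<open>mult_tensor\<close> is the canonical \<open>M(A) \<otimes> M(B) \<rightarrow> M(A \<otimes> B)\<close>.\<close>

lift_definition mtens :: "'a::complex_algebra multiplier \<Rightarrow> 'b::complex_algebra multiplier \<Rightarrow>
    ('a \<otimes>\<^sub>t 'b) multiplier"
  is "\<lambda>m n. (tensor_map (fst m) (fst n), tensor_map (snd m) (snd n))"
proof (clarsimp simp: clinear_tensor_map)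
  fix L R :: "'a \<Rightarrow> 'a" and L' R' :: "'b \<Rightarrow> 'b" and x y :: "'a \<otimes>\<^sub>t 'b"
  assume lin: "clinear L" "clinear R" "clinear L'" "clinear R'"
    and R: "\<forall>a b. R b * a = b * L a" and R': "\<forall>a b. R' b * a = b * L' a"
  show "tensor_map R R' y * x = y * tensor_map L L' x"
  proof (induction y rule: tens_induct)
    case y: (tens a b)
    show ?case
      by (induction x rule: tens_induct)
        (simp_all add: lin tens_times_tens R R' distrib_left)
  qed (simp add: lin distrib_right)
qed

definition mult_tensor :: "'a::complex_algebra multiplier \<otimes>\<^sub>t 'b::complex_algebra multiplier \<Rightarrow>
    ('a \<otimes>\<^sub>t 'b) multiplier"
  where "mult_tensor = tensor_lift mtens"

lemma mult_tensor_tens: "mult_tensor (m \<otimes>\<^sub>t n) = mtens m n"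
  for m :: "'a::complex_algebra multiplier" and n :: "'b::complex_algebra multiplier"
proof -
  have l: "lmul (mtens m n) (a \<otimes>\<^sub>t b) = lmul m a \<otimes>\<^sub>t lmul n b"
    and r: "rmul (a \<otimes>\<^sub>t b) (mtens m n) = rmul a m \<otimes>\<^sub>t rmul b n"
    for m :: "'a multiplier" and n :: "'b multiplier" and a b
    using tensor_map_simps(1)[OF lmul_linear[of m] lmul_linear[of n], of a b]
      tensor_map_simps(1)[OF rmul_linear[of m] rmul_linear[of n], of a b]
    by (simp_all only: lmul.rep_eq rmul.rep_eq mtens.rep_eq fst_conv snd_conv)
  have eqI: "x = y" if "\<And>a b. lmul x (a \<otimes>\<^sub>t b) = lmul y (a \<otimes>\<^sub>t b)"
    "\<And>a b. rmul (a \<otimes>\<^sub>t b) x = rmul (a \<otimes>\<^sub>t b) y" for x y :: "('a \<otimes>\<^sub>t 'b) multiplier"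
  proof (rule multiplier_eqI)
    show "lmul x z = lmul y z" for z
      by (induction z rule: tens_induct) (simp_all add: that clinear_add[OF lmul_linear])
    show "rmul z x = rmul z y" for z
      by (induction z rule: tens_induct) (simp_all add: that clinear_add[OF rmul_linear])
  qed
  have "cbilinear (mtens :: 'a multiplier \<Rightarrow> 'b multiplier \<Rightarrow> _)"
    by (rule cbilinearI; rule eqI) (simp_all add: l r tens_simps)
  then show ?thesis
    by (simp add: mult_tensor_def)
qed

section \<open>Homomorphisms and their extensions to multipliers\<close>

definition alg_hom :: "('a::complex_algebra \<Rightarrow> 'b::complex_algebra) \<Rightarrow> bool"
  where "alg_hom f \<longleftrightarrow> clinear f \<and> (\<forall>a b. f (a * b) = f a * f b)"

definition alg_antihom :: "('a::complex_algebra \<Rightarrow> 'b::complex_algebra) \<Rightarrow> bool"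
  where "alg_antihom f \<longleftrightarrow> clinear f \<and> (\<forall>a b. f (a * b) = f b * f a)"

text \<open>For nondegenerate \<open>\<Phi>\<close> there is exactly one such \<open>\<Psi>\<close>.\<close>

definition hom_extension :: "('a::complex_algebra \<Rightarrow> 'b::complex_algebra multiplier) \<Rightarrow>
    ('a multiplier \<Rightarrow> 'b multiplier) \<Rightarrow> bool"
  where "hom_extension \<Phi> \<Psi> \<longleftrightarrow> alg_hom \<Psi> \<and> \<Psi> 1 = 1 \<and> (\<forall>a. \<Psi> (mult_of a) = \<Phi> a)"

definition antihom_extension :: "('a::complex_algebra \<Rightarrow> 'b::complex_algebra multiplier) \<Rightarrow>
    ('a multiplier \<Rightarrow> 'b multiplier) \<Rightarrow> bool"
  where "antihom_extension \<Phi> \<Psi> \<longleftrightarrow> alg_antihom \<Psi> \<and> \<Psi> 1 = 1 \<and> (\<forall>a. \<Psi> (mult_of a) = \<Phi> a)"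

section \<open>Multiplier Hopf *-algebras and discrete quantum groups\<close>

definition T1_mult :: "('a::complex_algebra \<Rightarrow> ('a \<otimes>\<^sub>t 'a) multiplier) \<Rightarrow>
    'a \<otimes>\<^sub>t 'a \<Rightarrow> ('a \<otimes>\<^sub>t 'a) multiplier"
  where "T1_mult \<delta> = tensor_lift (\<lambda>a b. \<delta> a * mtens 1 (mult_of b))"

definition T2_mult :: "('a::complex_algebra \<Rightarrow> ('a \<otimes>\<^sub>t 'a) multiplier) \<Rightarrow>
    'a \<otimes>\<^sub>t 'a \<Rightarrow> ('a \<otimes>\<^sub>t 'a) multiplier"
  where "T2_mult \<delta> = tensor_lift (\<lambda>a b. mtens (mult_of a) 1 * \<delta> b)"

text \<open>\<open>T1_mult\<close> and \<open>T2_mult\<close> take values in \<open>M(A \<otimes> A)\<close>. When these values lie in the copy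
  \<open>range mult_of\<close> of \<open>A \<otimes> A\<close>, the maps below are the corresponding maps into \<open>A \<otimes> A\<close>.\<close>

definition T1 :: "('a::complex_algebra \<Rightarrow> ('a \<otimes>\<^sub>t 'a) multiplier) \<Rightarrow> 'a \<otimes>\<^sub>t 'a \<Rightarrow> 'a \<otimes>\<^sub>t 'a"
  where "T1 \<delta> z = (THE w. mult_of w = T1_mult \<delta> z)"

definition T2 :: "('a::complex_algebra \<Rightarrow> ('a \<otimes>\<^sub>t 'a) multiplier) \<Rightarrow> 'a \<otimes>\<^sub>t 'a \<Rightarrow> 'a \<otimes>\<^sub>t 'a"
  where "T2 \<delta> z = (THE w. mult_of w = T2_mult \<delta> z)"

text \<open>The last clause is the commutation of \<open>T\<^sub>2 \<otimes> id\<close> and \<open>id \<otimes> T\<^sub>1\<close>, with the identification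
  of \<open>(A \<otimes> A) \<otimes> A\<close> and \<open>A \<otimes> (A \<otimes> A)\<close> made explicit.\<close>

definition multiplier_Hopf_algebra :: "('a::complex_algebra \<Rightarrow> ('a \<otimes>\<^sub>t 'a) multiplier) \<Rightarrow> bool"
  where "multiplier_Hopf_algebra \<delta> \<longleftrightarrow>
    nondegenerate_product TYPE('a) \<and> alg_hom \<delta> \<and>
    bij_betw (T1_mult \<delta>) UNIV (range mult_of) \<and>
    bij_betw (T2_mult \<delta>) UNIV (range mult_of) \<and>
    (let T2_id = tensor_map (T2 \<delta>) id;
         id_T1 = inv_into UNIV tensor_assoc \<circ> tensor_map id (T1 \<delta>) \<circ> tensor_assoc
     in T2_id \<circ> id_T1 = id_T1 \<circ> T2_id)"

definition multiplier_Hopf_star_algebra ::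
    "('a::complex_star_algebra \<Rightarrow> ('a \<otimes>\<^sub>t 'a) multiplier) \<Rightarrow> bool"
  where "multiplier_Hopf_star_algebra \<delta> \<longleftrightarrow>
    multiplier_Hopf_algebra \<delta> \<and> (\<forall>a. \<delta> (star a) = star (\<delta> a))"

definition counit :: "('a::complex_algebra \<Rightarrow> ('a \<otimes>\<^sub>t 'a) multiplier) \<Rightarrow> ('a \<Rightarrow> complex) \<Rightarrow> bool"
  where "counit \<delta> \<epsilon> \<longleftrightarrow> alg_hom \<epsilon> \<and>
    (\<forall>a b. tensor_lift (\<lambda>x y. \<epsilon> y *\<^sub>C x) (T2 \<delta> (a \<otimes>\<^sub>t b)) = a * b) \<and>
    (\<forall>a b. tensor_lift (\<lambda>x y. \<epsilon> x *\<^sub>C y) (T1 \<delta> (a \<otimes>\<^sub>t b)) = a * b)"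

text \<open>The two identities are read in \<open>M(A)\<close>: \<open>tensor_lift (*)\<close> is the multiplication
  \<open>M(A) \<otimes> M(A) \<rightarrow> M(A)\<close>.\<close>

definition coinverse :: "('a::complex_algebra \<Rightarrow> ('a \<otimes>\<^sub>t 'a) multiplier) \<Rightarrow> ('a \<Rightarrow> complex) \<Rightarrow>
    ('a \<Rightarrow> 'a multiplier) \<Rightarrow> bool"
  where "coinverse \<delta> \<epsilon> \<kappa> \<longleftrightarrow> alg_antihom \<kappa> \<and>
    (\<forall>a b c. tensor_lift (*) (tensor_map mult_of \<kappa> (T2 \<delta> (a \<otimes>\<^sub>t b)) * (1 \<otimes>\<^sub>t mult_of c))
      = mult_of (\<epsilon> b *\<^sub>C (a * c))) \<and>
    (\<forall>a b c. tensor_lift (*) ((mult_of a \<otimes>\<^sub>t 1) * tensor_map \<kappa> mult_of (T1 \<delta> (b \<otimes>\<^sub>t c)))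
      = mult_of (\<epsilon> b *\<^sub>C (a * c)))"

definition full_matrix_algebra :: "'a::complex_algebra set \<Rightarrow> bool"
  where "full_matrix_algebra B \<longleftrightarrow>
    cvec.subspace B \<and> (\<forall>x\<in>B. \<forall>y\<in>B. x * y \<in> B) \<and>
    (\<exists>n>0. \<exists>\<phi> :: 'a \<Rightarrow> complex mat. bij_betw \<phi> B (carrier_mat n n) \<and>
      (\<forall>x\<in>B. \<forall>y\<in>B. \<phi> (x + y) = \<phi> x + \<phi> y \<and> \<phi> (x * y) = \<phi> x * \<phi> y) \<and>
      (\<forall>c. \<forall>x\<in>B. \<phi> (c *\<^sub>C x) = c \<cdot>\<^sub>m \<phi> x))"

text \<open>The whole type is the algebra; the direct sum is the internal (algebraic) one, over an
  arbitrary set of blocks. Only the algebra structure is constrained, not the involution.\<close>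

definition direct_sum_of_full_matrix_algebras :: "'a::complex_algebra itself \<Rightarrow> bool"
  where "direct_sum_of_full_matrix_algebras _ \<longleftrightarrow>
    (\<exists>\<B> :: 'a set set. (\<forall>B\<in>\<B>. full_matrix_algebra B) \<and>
      (\<forall>B\<in>\<B>. \<forall>C\<in>\<B>. B \<noteq> C \<longrightarrow> (\<forall>x\<in>B. \<forall>y\<in>C. x * y = 0)) \<and>
      cvec.span (\<Union>\<B>) = UNIV \<and>
      (\<forall>F x. finite F \<and> F \<subseteq> \<B> \<and> (\<forall>B\<in>F. x B \<in> B) \<and> (\<Sum>B\<in>F. x B) = 0 \<longrightarrow> (\<forall>B\<in>F. x B = 0)))"

definition discrete_quantum_group ::
    "('a::complex_star_algebra \<Rightarrow> ('a \<otimes>\<^sub>t 'a) multiplier) \<Rightarrow> bool"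
  where "discrete_quantum_group \<delta> \<longleftrightarrow>
    multiplier_Hopf_star_algebra \<delta> \<and> direct_sum_of_full_matrix_algebras TYPE('a)"

section \<open>Almost periodic elements\<close>

text \<open>The argument is the extension of the comultiplication to \<open>M(A)\<close>; \<open>range mult_tensor\<close> is
  \<open>M(A) \<otimes> M(A)\<close> viewed inside \<open>M(A \<otimes> A)\<close>.\<close>

definition almost_periodic :: "('a::complex_algebra multiplier \<Rightarrow> ('a \<otimes>\<^sub>t 'a) multiplier) \<Rightarrow>
    'a multiplier set"
  where "almost_periodic \<Delta> = {x. \<Delta> x \<in> range mult_tensor}"

definition unital_star_subalgebra :: "'a::{complex_star_algebra, monoid_mult} set \<Rightarrow> bool"
  where "unital_star_subalgebra S \<longleftrightarrow>
    cvec.subspace S \<and> 1 \<in> S \<and> (\<forall>x\<in>S. \<forall>y\<in>S. x * y \<in> S) \<and> (\<forall>x\<in>S. star x \<in> S)"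

end

theory Submission
  imports Defs
begin

text \<open>Slicing \<open>(\<delta> \<otimes> id)(\<delta> x) = (id \<otimes> \<delta>)(\<delta> x)\<close> in one outer leg by functionals
  \<open>m \<mapsto> f (r m q)\<close> shows that the slices of \<open>\<delta> x\<close> are almost periodic whenever \<open>x\<close> is. As these
  functionals separate the points of \<open>M(A)\<close>, both legs of \<open>\<delta> x\<close> can be chosen almost periodic.
  Hence \<open>\<delta>\<close> restricts to a coassociative comultiplication on the almost periodic elements, for
  which counit and coinverse satisfy the Hopf algebra identities. Uniqueness of convolution
  inverses then gives \<open>\<delta> (\<kappa> x) = flip ((\<kappa> \<otimes> \<kappa>) (\<delta> x))\<close>, so that \<open>\<kappa>\<close> preserves almost
  periodicity, and \<open>\<kappa> (star (\<kappa> (star x))) = x\<close>, so that it is onto.\<close>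

section \<open>Linear algebra of tensor products\<close>

text \<open>Two obstacles shape the development. The axioms speak of T1 and T2 on A \<otimes> A
  only, so identities between multipliers are tested on elements of A, and the test elements are
  removed afterwards by nondegeneracy and by surjectivity of T1 and T2. Moreover AP is a set, not a
  type, and \<delta> x lives in M(A \<otimes> A) rather than in a tensor square. The remedy is
  injectivity of M(A) \<otimes> M(A) \<rightarrow> M(A \<otimes> A) together with a linear map on
  all of M(A) whose coalgebra laws are claimed on AP alone. The functionals have the form m
  \<mapsto> f (r m q) because these can slice any X in M(A \<otimes> A): X (a \<otimes> q) lies in A
  \<otimes> A, where every linear f applies to a leg, and r serves the action from the other side.
  Uniqueness of convolution inverses is used with values in M(A \<otimes> A) for \<delta> \<circ>
  \<kappa>, and with values in M(A) for the star identity. In the latter the two units are e and x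
  \<mapsto> cnj (e (star x)), which are never compared: a left counit law for one and a right counit
  law for the other suffice.\<close>

lemma cbilinear_iff_clinear:
  "cbilinear \<beta> \<longleftrightarrow> (\<forall>a. clinear (\<lambda>b. \<beta> a b)) \<and> (\<forall>b. clinear (\<lambda>a. \<beta> a b))"
  by (simp add: cbilinear_def)

lemma clinear_zero: "clinear f \<Longrightarrow> f 0 = 0"
  by (metis clinear_scaleC cvec.scale_zero_left)

lemma clinear_sum: "clinear f \<Longrightarrow> f (sum g I) = (\<Sum>i\<in>I. f (g i))"
  by (induction I rule: infinite_finite_induct) (simp_all add: clinear_zero clinear_add)

lemma clinear_diff: "clinear f \<Longrightarrow> f (x - y) = f x - f y"
  by (metis clinear_add diff_add_cancel eq_diff_eq)

lemma clinear_ident: "clinear (\<lambda>x. x)"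
  by (rule clinearI) auto

lemma clinear_const_zero: "clinear (\<lambda>_. 0)"
  by (rule clinearI) simp_all

lemma clinear_compose: "clinear f \<Longrightarrow> clinear g \<Longrightarrow> clinear (\<lambda>x. g (f x))"
  by (rule clinearI) (simp_all add: clinear_add clinear_scaleC)

lemma clinear_plus: "clinear f \<Longrightarrow> clinear g \<Longrightarrow> clinear (\<lambda>x. f x + g x)"
  by (rule clinearI) (simp_all add: clinear_add clinear_scaleC scaleC_add_right)

lemma clinear_setsum: "(\<And>i. clinear (f i)) \<Longrightarrow> clinear (\<lambda>x. \<Sum>i\<in>I. f i x)"
  by (rule clinearI) (simp_all add: clinear_add clinear_scaleC sum.distrib cvec.scale_sum_right)

lemma clinear_scale: "clinear f \<Longrightarrow> clinear (\<lambda>x. c *\<^sub>C f x)"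
  by (rule clinearI) (simp_all add: clinear_add clinear_scaleC scaleC_add_right scaleC_scaleC mult.commute)

lemma clinear_scale_vec: "clinear \<phi> \<Longrightarrow> clinear (\<lambda>x. \<phi> x *\<^sub>C v)"
  by (rule clinearI)
    (simp_all add: clinear_add clinear_scaleC scaleC_add_left scaleC_scaleC scaleC_complex_def)

lemma clinear_times_left: "clinear f \<Longrightarrow> clinear (\<lambda>x. a * f x)"
  for a :: "'a::complex_algebra"
  by (rule clinear_compose[OF _ clinear_mult_left])

lemma clinear_times_right: "clinear f \<Longrightarrow> clinear (\<lambda>x. f x * a)"
  for a :: "'a::complex_algebra"
  by (rule clinear_compose[OF _ clinear_mult_right])

lemma clinear_tens_left: "clinear f \<Longrightarrow> clinear (\<lambda>x. a \<otimes>\<^sub>t f x)"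
  by (rule clinearI) (simp_all add: clinear_add clinear_scaleC tens_simps)

lemma clinear_tens_right: "clinear f \<Longrightarrow> clinear (\<lambda>x. f x \<otimes>\<^sub>t a)"
  by (rule clinearI) (simp_all add: clinear_add clinear_scaleC tens_simps)

lemma clinear_tensor_lift_arg: "cbilinear \<beta> \<Longrightarrow> clinear f \<Longrightarrow> clinear (\<lambda>x. tensor_lift \<beta> (f x))"
  by (rule clinear_compose[OF _ clinear_tensor_lift])

lemma clinear_tensor_map_arg:
  "clinear F \<Longrightarrow> clinear G \<Longrightarrow> clinear f \<Longrightarrow> clinear (\<lambda>x. tensor_map F G (f x))"
  by (rule clinear_compose[OF _ clinear_tensor_map])

text \<open>Meant for nested lifts: an inner lift that is linear in the outer variable makes the
  outer map bilinear, so that it can be lifted in turn.\<close>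

lemma clinear_tensor_lift_param:
  assumes "\<And>a. cbilinear (\<lambda>b c. t a b c)" "\<And>b c. clinear (\<lambda>a. t a b c)"
  shows "clinear (\<lambda>a. tensor_lift (\<lambda>b c. t a b c) v)"
proof (induction v rule: tens_induct)
  case (add x y)
  then show ?case by (simp add: assms clinear_plus)
qed (simp add: assms)

lemma clinear_eq_tensI:
  assumes "clinear f" "clinear g" "\<And>a b. f (a \<otimes>\<^sub>t b) = g (a \<otimes>\<^sub>t b)"
  shows "f z = g z"
  by (induction z rule: tens_induct) (simp_all add: assms clinear_add)

lemma id_clinear: "clinear id"
  by (rule clinearI) auto

lemma cbilinear_tensor_assoc:
  "cbilinear (\<lambda>(z :: 'a::complex_vector \<otimes>\<^sub>t 'b::complex_vector) (c :: 'c::complex_vector).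
    tensor_map id (\<lambda>b. b \<otimes>\<^sub>t c) z)"
  unfolding cbilinear_iff_clinear tensor_map_def
  by (intro conjI allI clinear_tensor_lift clinear_tensor_lift_param)
    (simp_all add: cbilinear_iff_clinear clinear_tens_left clinear_tens_right clinear_ident id_clinear)

lemma clinear_assoc: "clinear tensor_assoc"
  unfolding tensor_assoc_def by (rule clinear_tensor_lift[OF cbilinear_tensor_assoc])

lemma clinear_assoc_arg: "clinear f \<Longrightarrow> clinear (\<lambda>x. tensor_assoc (f x))"
  by (rule clinear_compose[OF _ clinear_assoc])

lemmas clinear_intros = clinear_ident id_clinear clinear_plus clinear_setsum clinear_scale clinear_scale_vec
  clinear_times_left clinear_times_right clinear_tens_left clinear_tens_right
  clinear_tensor_lift_arg clinear_tensor_map_arg clinear_assoc_arg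

text \<open>The inverse comes from lifting (a, (b, c)) \<mapsto> (a \<otimes> b) \<otimes> c twice;
  both compositions are the identity on elementary tensors.\<close>

lemma tensor_assoc_inverse:
  obtains \<alpha> :: "'a::complex_vector \<otimes>\<^sub>t ('b::complex_vector \<otimes>\<^sub>t 'c::complex_vector) \<Rightarrow> ('a \<otimes>\<^sub>t 'b) \<otimes>\<^sub>t 'c"
  where "clinear \<alpha>" "\<And>z. \<alpha> (tensor_assoc z) = z" "\<And>z. tensor_assoc (\<alpha> z) = z"
proof -
  define \<alpha> where "\<alpha> = tensor_lift (\<lambda>(a::'a) w. tensor_lift (\<lambda>(b::'b) (c::'c). (a \<otimes>\<^sub>t b) \<otimes>\<^sub>t c) w)"
  have b1: "cbilinear (\<lambda>(b::'b) (c::'c). (a \<otimes>\<^sub>t b) \<otimes>\<^sub>t c)" for a :: 'a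
    unfolding cbilinear_iff_clinear by (intro conjI allI clinear_intros)
  have b2: "cbilinear (\<lambda>(a::'a) w. tensor_lift (\<lambda>(b::'b) (c::'c). (a \<otimes>\<^sub>t b) \<otimes>\<^sub>t c) w)"
    by (subst cbilinear_iff_clinear)
      (intro conjI allI b1 clinear_tensor_lift_param clinear_intros)
  have lin: "clinear \<alpha>" unfolding \<alpha>_def by (rule clinear_tensor_lift[OF b2])
  have \<alpha>: "\<alpha> (a \<otimes>\<^sub>t (b \<otimes>\<^sub>t c)) = (a \<otimes>\<^sub>t b) \<otimes>\<^sub>t c" for a b c
    by (simp add: \<alpha>_def b1 b2)
  have 1: "\<alpha> (tensor_assoc z) = z" for z
  proof (rule clinear_eq_tensI[of "\<lambda>z. \<alpha> (tensor_assoc z)" "\<lambda>z. z"])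
    show "\<alpha> (tensor_assoc (u \<otimes>\<^sub>t c)) = u \<otimes>\<^sub>t c" for u c
      by (rule clinear_eq_tensI[of "\<lambda>u. \<alpha> (tensor_assoc (u \<otimes>\<^sub>t c))" "\<lambda>u. u \<otimes>\<^sub>t c"])
        ((intro clinear_intros clinear_compose[OF _ lin])+, simp add: tensor_assoc_tens \<alpha>)
  qed (intro clinear_intros clinear_compose[OF _ lin])+
  have 2: "tensor_assoc (\<alpha> z) = z" for z
  proof (rule clinear_eq_tensI[of "\<lambda>z. tensor_assoc (\<alpha> z)" "\<lambda>z. z"])
    show "tensor_assoc (\<alpha> (a \<otimes>\<^sub>t w)) = a \<otimes>\<^sub>t w" for a w
      by (rule clinear_eq_tensI[of "\<lambda>w. tensor_assoc (\<alpha> (a \<otimes>\<^sub>t w))" "\<lambda>w. a \<otimes>\<^sub>t w"])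
        ((intro clinear_intros clinear_compose[OF _ lin])+, simp add: tensor_assoc_tens \<alpha>)
  qed (intro clinear_intros clinear_compose[OF _ lin])+
  show ?thesis by (rule that[OF lin 1 2])
qed

text \<open>The commutation axiom is phrased with \<open>inv_into UNIV tensor_assoc\<close>, which
  can be computed with only after \<open>tensor_assoc\<close> is known to be bijective.\<close>

lemma inv_tensor_assoc:
  fixes z :: "('a::complex_vector \<otimes>\<^sub>t 'b::complex_vector) \<otimes>\<^sub>t 'c::complex_vector"
  shows "inv_into UNIV tensor_assoc (tensor_assoc z) = z" "tensor_assoc (inv_into UNIV tensor_assoc y) = (y :: 'a \<otimes>\<^sub>t ('b \<otimes>\<^sub>t 'c))"
proof -
  obtain \<alpha> where \<alpha>: "\<And>z :: ('a \<otimes>\<^sub>t 'b) \<otimes>\<^sub>t 'c. \<alpha> (tensor_assoc z) = z"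
    "\<And>y :: 'a \<otimes>\<^sub>t ('b \<otimes>\<^sub>t 'c). tensor_assoc (\<alpha> y) = y"
    using tensor_assoc_inverse by metis
  have "inj (tensor_assoc :: ('a \<otimes>\<^sub>t 'b) \<otimes>\<^sub>t 'c \<Rightarrow> _)" by (rule inj_on_inverseI[of _ \<alpha>]) (rule \<alpha>)
  then show "inv_into UNIV tensor_assoc (tensor_assoc z) = z" by simp
  show "tensor_assoc (inv_into UNIV tensor_assoc y) = y" for y :: "'a \<otimes>\<^sub>t ('b \<otimes>\<^sub>t 'c)"
    by (rule f_inv_into_f) (metis \<alpha>(2) rangeI)
qed

lemma clinear_inv_assoc:
  "clinear (inv_into UNIV tensor_assoc ::
    'a::complex_vector \<otimes>\<^sub>t 'b::complex_vector \<otimes>\<^sub>t 'c::complex_vector \<Rightarrow> _)"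
proof (rule clinearI)
  fix x y :: "'a \<otimes>\<^sub>t ('b \<otimes>\<^sub>t 'c)" and c
  show "inv_into UNIV tensor_assoc (x + y) = inv_into UNIV tensor_assoc x + inv_into UNIV tensor_assoc y"
    by (metis inv_tensor_assoc clinear_add[OF clinear_assoc])
  show "inv_into UNIV tensor_assoc (c *\<^sub>C x) = c *\<^sub>C inv_into UNIV tensor_assoc x"
    by (metis inv_tensor_assoc clinear_scaleC[OF clinear_assoc])
qed

lemma inv_assoc_tens: "inv_into UNIV tensor_assoc (a \<otimes>\<^sub>t (b \<otimes>\<^sub>t c)) = (a \<otimes>\<^sub>t b) \<otimes>\<^sub>t c"
  by (simp add: tensor_assoc_tens[symmetric] inv_tensor_assoc)

section \<open>Flip and slice maps\<close>

definition tensor_flip :: "'a::complex_vector \<otimes>\<^sub>t 'b::complex_vector \<Rightarrow> 'b \<otimes>\<^sub>t 'a"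
  where "tensor_flip = tensor_lift (\<lambda>a b. b \<otimes>\<^sub>t a)"

text \<open>These are id \<otimes> \<phi> and, below, \<phi> \<otimes> id: the suffix names the leg
  that is consumed by \<phi>, not the one that remains.\<close>

definition slice_r :: "('b::complex_vector \<Rightarrow> complex) \<Rightarrow> 'a::complex_vector \<otimes>\<^sub>t 'b \<Rightarrow> 'a"
  where "slice_r \<phi> = tensor_lift (\<lambda>a b. \<phi> b *\<^sub>C a)"

definition slice_l :: "('a::complex_vector \<Rightarrow> complex) \<Rightarrow> 'a \<otimes>\<^sub>t 'b::complex_vector \<Rightarrow> 'b"
  where "slice_l \<phi> = tensor_lift (\<lambda>a b. \<phi> a *\<^sub>C b)"

lemma tensor_flip_bilinear: "cbilinear (\<lambda>(a::'a::complex_vector) (b::'b::complex_vector). b \<otimes>\<^sub>t a)"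
  unfolding cbilinear_iff_clinear by (intro conjI allI clinear_intros)

lemma slice_bilinear:
  assumes "clinear \<phi>"
  shows "cbilinear (\<lambda>a b. \<phi> b *\<^sub>C a)" "cbilinear (\<lambda>a b. \<phi> a *\<^sub>C b)"
  unfolding cbilinear_iff_clinear by (intro conjI allI clinear_intros assms)+

lemma clinear_flip: "clinear tensor_flip"
  and flip_tens [simp]: "tensor_flip (a \<otimes>\<^sub>t b) = b \<otimes>\<^sub>t a"
  by (simp_all add: tensor_flip_def tensor_flip_bilinear clinear_tensor_lift)

lemma clinear_slice_r: "clinear \<phi> \<Longrightarrow> clinear (slice_r \<phi>)"
  and slice_r_tens [simp]: "clinear \<phi> \<Longrightarrow> slice_r \<phi> (a \<otimes>\<^sub>t b) = \<phi> b *\<^sub>C a"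
  by (simp_all add: slice_r_def slice_bilinear clinear_tensor_lift)

lemma clinear_slice_l: "clinear \<phi> \<Longrightarrow> clinear (slice_l \<phi>)"
  and slice_l_tens [simp]: "clinear \<phi> \<Longrightarrow> slice_l \<phi> (a \<otimes>\<^sub>t b) = \<phi> a *\<^sub>C b"
  by (simp_all add: slice_l_def slice_bilinear clinear_tensor_lift)

lemma flip_flip [simp]: "tensor_flip (tensor_flip z) = z"
  by (rule clinear_eq_tensI[of "\<lambda>z. tensor_flip (tensor_flip z)" "\<lambda>z. z"])
    (intro clinear_compose[OF clinear_flip clinear_flip] clinear_ident | simp)+

lemma slice_r_flip: "clinear \<phi> \<Longrightarrow> slice_r \<phi> (tensor_flip z) = slice_l \<phi> z"
  by (rule clinear_eq_tensI[of "\<lambda>z. slice_r \<phi> (tensor_flip z)" "slice_l \<phi>"])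
    (intro clinear_compose[OF clinear_flip clinear_slice_r] clinear_slice_l | simp)+

lemma flip_tensor_set: "z \<in> tensor_set S T \<Longrightarrow> tensor_flip z \<in> tensor_set T S"
  unfolding tensor_set_def
proof (induction rule: cvec.span_induct_alt)
  case base
  then show ?case by (simp add: clinear_zero[OF clinear_flip] cvec.span_zero)
next
  case (step c x y)
  then obtain a b where "x = a \<otimes>\<^sub>t b" "a \<in> S" "b \<in> T" by blast
  then have "tensor_flip x \<in> {s \<otimes>\<^sub>t t | s t. s \<in> T \<and> t \<in> S}" by auto
  then show ?case
    unfolding clinear_add[OF clinear_flip] clinear_scaleC[OF clinear_flip]
    by (intro cvec.span_add cvec.span_scale step(2) cvec.span_base)
qed

section \<open>Finite expansions of tensors with legs in given subspaces\<close>

lemma tensor_set_tens: "s \<in> S \<Longrightarrow> t \<in> T \<Longrightarrow> s \<otimes>\<^sub>t t \<in> tensor_set S T"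
  unfolding tensor_set_def by (blast intro: cvec.span_base)

lemma tensor_set_sum: "(\<And>i. i \<in> I \<Longrightarrow> z i \<in> tensor_set S T) \<Longrightarrow> sum z I \<in> tensor_set S T"
  unfolding tensor_set_def by (rule cvec.span_sum)

lemma tensor_set_UNIV [simp]: "z \<in> tensor_set UNIV UNIV"
  by (induction z rule: tens_induct) (auto simp: tensor_set_def intro: cvec.span_base cvec.span_add)

text \<open>The scalars of the linear combination are absorbed into the left legs, which is possible
  because S is a subspace.\<close>

lemma tensor_set_sumE:
  assumes "z \<in> tensor_set S T" and S: "cvec.subspace S"
  obtains n :: nat and s t where "\<And>i. i < n \<Longrightarrow> s i \<in> S" "\<And>i. i < n \<Longrightarrow> t i \<in> T"
    "z = (\<Sum>i<n. s i \<otimes>\<^sub>t t i)"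
proof -
  have "\<exists>(n::nat) s t. (\<forall>i<n. s i \<in> S \<and> t i \<in> T) \<and> z = (\<Sum>i<n. s i \<otimes>\<^sub>t t i)"
    using assms(1) unfolding tensor_set_def
  proof (induction rule: cvec.span_induct_alt)
    case base
    show ?case by (rule exI[of _ 0]) auto
  next
    case (step c x y)
    then obtain n s t where n: "\<forall>i<n. s i \<in> S \<and> t i \<in> T" "y = (\<Sum>i<n::nat. s i \<otimes>\<^sub>t t i)"
      by blast
    obtain a b where ab: "x = a \<otimes>\<^sub>t b" "a \<in> S" "b \<in> T" using step(1) by blast
    show ?case
      by (rule exI[of _ "Suc n"], rule exI[of _ "s(n := c *\<^sub>C a)"], rule exI[of _ "t(n := b)"])
        (use n ab in \<open>auto simp: less_Suc_eq tens_scaleC_left cvec.subspace_scale[OF S]\<close>)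
  qed
  then show ?thesis using that by blast
qed

text \<open>The right legs are expanded in a basis of T and the coefficients are collected on the
  left. With independent right legs, a linear condition on the tensor splits into conditions on the
  single left legs.\<close>

lemma tensor_set_independentE:
  assumes "z \<in> tensor_set S T" and S: "cvec.subspace S" and T: "cvec.subspace T"
  obtains F s where "finite F" "F \<subseteq> T" "\<not> cvec.dependent F" "\<And>t. s t \<in> S" "z = (\<Sum>t\<in>F. s t \<otimes>\<^sub>t t)"
proof -
  obtain B where B: "B \<subseteq> T" "cvec.independent B" "T \<subseteq> cvec.span B"
    by (rule cvec.maximal_independent_subset)
  obtain n u v where u: "\<And>i. i < n \<Longrightarrow> u i \<in> S" and v: "\<And>i. i < n \<Longrightarrow> v i \<in> T"
    and z: "z = (\<Sum>i<n::nat. u i \<otimes>\<^sub>t v i)"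
    by (rule tensor_set_sumE[OF assms(1) S]) metis
  define r where "r i = cvec.representation B (v i)" for i
  \<comment> \<open>Each right leg involves finitely many basis vectors; F collects them
    all.\<close>
  define F where "F = (\<Union>i<n. {b. r i b \<noteq> 0})"
  have fin: "finite {b. r i b \<noteq> 0}" for i
    unfolding r_def by (rule cvec.finite_representation)
  have F: "finite F" unfolding F_def by (simp add: fin)
  have FB: "F \<subseteq> B" unfolding F_def r_def using cvec.representation_ne_zero by blast
  have v': "v i = (\<Sum>b\<in>F. r i b *\<^sub>C b)" if "i < n" for i
  proof -
    have "v i = (\<Sum>b | r i b \<noteq> 0. r i b *\<^sub>C b)"
      unfolding r_def using cvec.sum_nonzero_representation_eq[OF B(2)] v[OF that] B(3) by auto
    also have "\<dots> = (\<Sum>b\<in>F. r i b *\<^sub>C b)"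
      by (rule sum.mono_neutral_left) (use F that in \<open>auto simp: F_def\<close>)
    finally show ?thesis .
  qed
  define s where "s b = (\<Sum>i<n. r i b *\<^sub>C u i)" for b
  have "z = (\<Sum>i<n. \<Sum>b\<in>F. (r i b *\<^sub>C u i) \<otimes>\<^sub>t b)"
    unfolding z
    by (rule sum.cong)
      (simp_all add: v' tens_simps clinear_sum[OF clinear_tens_left[OF clinear_ident]])
  also have "\<dots> = (\<Sum>b\<in>F. s b \<otimes>\<^sub>t b)"
    by (subst sum.swap) (simp add: s_def clinear_sum[OF clinear_tens_right[OF clinear_ident]])
  finally have z': "z = (\<Sum>b\<in>F. s b \<otimes>\<^sub>t b)" .
  have "s t \<in> S" for t
    unfolding s_def by (intro cvec.subspace_sum S cvec.subspace_scale u) auto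
  moreover have "\<not> cvec.dependent F" using cvec.dependent_mono[of F B] FB B(2) by blast
  ultimately show ?thesis by (intro that[of F s] F z') (use FB B(1) in auto)
qed

section \<open>Linear functionals and separating families\<close>

lemma vector_space_pair_scaleC:
  "vector_space_pair (scaleC :: complex \<Rightarrow> 'a \<Rightarrow> 'a::complex_vector)
    (scaleC :: complex \<Rightarrow> 'b \<Rightarrow> 'b::complex_vector)" ..

lemmas clinear_independent_extend = vector_space_pair.linear_independent_extend[OF vector_space_pair_scaleC]

text \<open>A basis B of P stays independent when v is inserted, so the values 0 on B and 1 at v
  extend to a linear functional on the whole space.\<close>

lemma functional_annihilating_subspace:
  assumes P: "cvec.subspace P" and v: "v \<notin> P"
  obtains f :: "'a::complex_vector \<Rightarrow> complex" where "clinear f" "\<And>p. p \<in> P \<Longrightarrow> f p = 0" "f v = 1"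
proof -
  obtain B where B: "B \<subseteq> P" "cvec.independent B" "P \<subseteq> cvec.span B"
    by (rule cvec.maximal_independent_subset)
  have span: "cvec.span B = P" using B cvec.span_minimal[OF B(1) P] by blast
  then have "cvec.independent (insert v B)"
    using B(2) v by (intro cvec.independent_insertI) auto
  then obtain f :: "'a \<Rightarrow> complex" where f: "clinear f" "\<forall>x\<in>insert v B. f x = (if x = v then 1 else 0)"
    using clinear_independent_extend[of "insert v B" "\<lambda>x. if x = v then 1 else 0"] by blast
  have "f b = 0" if "b \<in> B" for b using f(2) that v B(1) by auto
  then have "f p = 0" if "p \<in> P" for p
    using module_hom.eq_0_on_span[OF Vector_Spaces.linear.axioms(3)[OF f(1)], of B p] that span by auto
  moreover have "f v = 1" using f(2) by simp
  ultimately show ?thesis using that f(1) by blast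
qed

lemma functionals_separate:
  assumes "\<And>f :: 'a::complex_vector \<Rightarrow> complex. clinear f \<Longrightarrow> f v = 0"
  shows "v = 0"
proof (rule ccontr)
  assume "v \<noteq> 0"
  then have "v \<notin> {0}" by simp
  then obtain f :: "'a \<Rightarrow> complex" where "clinear f" "f v = 1"
    by (rule functional_annihilating_subspace[OF cvec.subspace_single_0])
  with assms[of f] show False by simp
qed

lemma independent_sum_zeroD:
  assumes "finite F" "\<not> cvec.dependent F" "(\<Sum>t\<in>F. c t *\<^sub>C t) = 0" "t \<in> F"
  shows "c t = (0::complex)"
  using cvec.independentD[OF assms(2,1) subset_refl assms(3,4)] .

text \<open>A functional vanishing on \<open>P\<close> turns \<open>z\<close> into a vector that is killed by every \<open>\<phi> \<in> \<Phi>\<close>.\<close>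

lemma tensor_set_if_slices:
  assumes z: "z \<in> tensor_set UNIV Q" and P: "cvec.subspace P" and Q: "cvec.subspace Q"
    and \<Phi>: "\<And>\<phi>. \<phi> \<in> \<Phi> \<Longrightarrow> clinear \<phi>" "\<And>w. (\<And>\<phi>. \<phi> \<in> \<Phi> \<Longrightarrow> \<phi> w = 0) \<Longrightarrow> w = 0"
    and slices: "\<And>\<phi>. \<phi> \<in> \<Phi> \<Longrightarrow> slice_r \<phi> z \<in> P"
  shows "z \<in> tensor_set P Q"
proof -
  obtain F s where F: "finite F" "F \<subseteq> Q" "\<not> cvec.dependent F" and z: "z = (\<Sum>t\<in>F. s t \<otimes>\<^sub>t t)"
    by (rule tensor_set_independentE[OF z cvec.subspace_UNIV Q])
  have "s t \<in> P" if t: "t \<in> F" for t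
  proof (rule ccontr)
    assume "s t \<notin> P"
    then obtain f :: "_ \<Rightarrow> complex" where f: "clinear f" "\<And>p. p \<in> P \<Longrightarrow> f p = 0" "f (s t) = 1"
      using functional_annihilating_subspace[OF P, of "s t"] by blast
    have "(\<Sum>t\<in>F. f (s t) *\<^sub>C t) = 0"
    proof (rule \<Phi>(2))
      fix \<phi> assume \<phi>: "\<phi> \<in> \<Phi>"
      have "f (slice_r \<phi> z) = 0" by (rule f(2)[OF slices[OF \<phi>]])
      then show "\<phi> (\<Sum>t\<in>F. f (s t) *\<^sub>C t) = 0"
        by (simp add: z clinear_sum[OF clinear_slice_r] clinear_sum[OF f(1)] clinear_sum \<Phi>(1)[OF \<phi>]
            clinear_scaleC[OF f(1)] clinear_scaleC scaleC_complex_def mult.commute)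
    qed
    from independent_sum_zeroD[OF F(1,3) this t] f(3) show False by simp
  qed
  then show ?thesis
    unfolding z using F(2) by (intro tensor_set_sum tensor_set_tens) auto
qed

text \<open>Tensor products of separating families separate. With independent right legs t, every f
  and every functional h give a vector with coefficients h (f (s t)) that all g kill; it is 0, hence
  so are its coefficients. Nondegeneracy of A \<otimes> A, injectivity of \<open>mult_tensor\<close>
  and coassociativity on AP all rest on this.\<close>

lemma tensor_map_separating:
  fixes \<F> :: "('a::complex_vector \<Rightarrow> 'b::complex_vector) set"
    and \<G> :: "('c::complex_vector \<Rightarrow> 'd::complex_vector) set"
  assumes F: "\<And>f. f \<in> \<F> \<Longrightarrow> clinear f" "\<And>v. (\<And>f. f \<in> \<F> \<Longrightarrow> f v = 0) \<Longrightarrow> v = 0"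
    and G: "\<And>g. g \<in> \<G> \<Longrightarrow> clinear g" "\<And>v. (\<And>g. g \<in> \<G> \<Longrightarrow> g v = 0) \<Longrightarrow> v = 0"
    and z: "\<And>f g. f \<in> \<F> \<Longrightarrow> g \<in> \<G> \<Longrightarrow> tensor_map f g z = 0"
  shows "z = 0"
proof -
  obtain I s where I: "finite I" "\<not> cvec.dependent I" and z': "z = (\<Sum>t\<in>I. s t \<otimes>\<^sub>t t)"
    by (rule tensor_set_independentE[OF tensor_set_UNIV cvec.subspace_UNIV cvec.subspace_UNIV])
  have "s t = 0" if t: "t \<in> I" for t
  proof (rule F(2), rule functionals_separate)
    fix f and h :: "'b \<Rightarrow> complex" assume f: "f \<in> \<F>" and h: "clinear h"
    have "(\<Sum>t\<in>I. h (f (s t)) *\<^sub>C t) = 0"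
    proof (rule G(2))
      fix g assume g: "g \<in> \<G>"
      have "slice_l h (tensor_map f g z) = 0"
        by (simp add: z[OF f g] clinear_zero[OF clinear_slice_l[OF h]])
      then show "g (\<Sum>t\<in>I. h (f (s t)) *\<^sub>C t) = 0"
        by (simp add: z' clinear_sum[OF clinear_tensor_map] clinear_sum[OF clinear_slice_l] F(1)[OF f]
            G(1)[OF g] h clinear_sum[OF G(1)[OF g]] clinear_scaleC[OF G(1)[OF g]])
    qed
    from independent_sum_zeroD[OF I this t] show "h (f (s t)) = 0" .
  qed
  then show ?thesis
    by (simp add: z' clinear_zero[OF clinear_tens_right[OF clinear_ident]])
qed

section \<open>Multipliers of tensor products\<close>

lemma clinear_lmul: "clinear f \<Longrightarrow> clinear (\<lambda>x. lmul m (f x))"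
  by (rule clinear_compose[OF _ lmul_linear])

lemma clinear_lmul_arg: "clinear f \<Longrightarrow> clinear (\<lambda>x. lmul (f x) a)"
  by (rule clinearI) (simp_all add: clinear_add clinear_scaleC)

lemma clinear_rmul: "clinear f \<Longrightarrow> clinear (\<lambda>x. rmul (f x) m)"
  by (rule clinear_compose[OF _ rmul_linear])

lemma clinear_rmul_arg: "clinear f \<Longrightarrow> clinear (\<lambda>x. rmul a (f x))"
  by (rule clinearI) (simp_all add: clinear_add clinear_scaleC)

lemma mult_of_add [simp]: "mult_of (a + b) = mult_of a + mult_of b"
  by (rule multiplier_eqI) (simp_all add: algebra_simps)

lemma mult_of_scaleC [simp]: "mult_of (c *\<^sub>C a) = c *\<^sub>C mult_of a"
  by (rule multiplier_eqI) (simp_all add: mult_scaleC_left mult_scaleC_right)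

lemma clinear_mult_of: "clinear mult_of"
  by (rule clinearI) simp_all

lemma clinear_mult_of_arg: "clinear f \<Longrightarrow> clinear (\<lambda>x. mult_of (f x))"
  by (rule clinear_compose[OF _ clinear_mult_of])

lemma mult_of_times: "mult_of (a * b) = mult_of a * mult_of b"
  by (rule multiplier_eqI) (simp_all add: mult.assoc)

lemma star_one: "star 1 = (1 :: 'a::complex_star_algebra multiplier)"
  by (rule multiplier_eqI) (simp_all add: star_simps star_star)

section \<open>Consequences of nondegeneracy for multipliers\<close>

lemma nondegenerate_eqI:
  fixes x y :: "'a::complex_algebra"
  assumes "nondegenerate_product TYPE('a)"
  shows "(\<And>b. x * b = y * b) \<Longrightarrow> x = y" "(\<And>b. b * x = b * y) \<Longrightarrow> x = y"
proof -
  have nd: "(\<And>b. a * b = 0) \<Longrightarrow> a = 0" "(\<And>b. b * a = 0) \<Longrightarrow> a = 0" for a :: 'a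
    using assms unfolding nondegenerate_product_def by blast+
  show "(\<And>b. x * b = y * b) \<Longrightarrow> x = y"
    using nd(1)[of "x - y"] by (simp add: left_diff_distrib)
  show "(\<And>b. b * x = b * y) \<Longrightarrow> x = y"
    using nd(2)[of "x - y"] by (simp add: right_diff_distrib)
qed

text \<open>A multiplier is only required to satisfy the mixed law \<open>rmul_lmul\<close>. That
  its two maps are module maps over A follows by cancelling a test factor.\<close>

lemma rmul_times: "rmul (b * c) x = b * rmul c x"
  if "nondegenerate_product TYPE('a)" for x :: "'a::complex_algebra multiplier"
  by (rule nondegenerate_eqI(1)[OF that]) (simp add: rmul_lmul mult.assoc)

lemma lmul_times: "lmul x (b * c) = lmul x b * c"
  if "nondegenerate_product TYPE('a)" for x :: "'a::complex_algebra multiplier"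
  by (rule nondegenerate_eqI(2)[OF that]) (simp add: rmul_lmul[symmetric] mult.assoc[symmetric])

text \<open>A is a two-sided ideal in M(A). Together with injectivity of \<open>mult_of\<close> this
  moves computations between the actions on A and the associative product of M(A).\<close>

lemma multiplier_mult_of:
  fixes x :: "'a::complex_algebra multiplier"
  assumes "nondegenerate_product TYPE('a)"
  shows "x * mult_of a = mult_of (lmul x a)" "mult_of a * x = mult_of (rmul a x)"
  by (rule multiplier_eqI; simp add: rmul_lmul rmul_times[OF assms] lmul_times[OF assms])+

lemma mult_of_inject:
  fixes a b :: "'a::complex_algebra"
  assumes "nondegenerate_product TYPE('a)"
  shows "mult_of a = mult_of b \<longleftrightarrow> a = b"
proof
  assume eq: "mult_of a = mult_of b"
  show "a = b"
    by (rule nondegenerate_eqI(1)[OF assms]) (use arg_cong[OF eq, of "\<lambda>m. lmul m _"] in simp)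
qed simp

lemma multiplier_eq_lmulI:
  fixes x y :: "'a::complex_algebra multiplier"
  assumes "nondegenerate_product TYPE('a)" "\<And>a. lmul x a = lmul y a"
  shows "x = y"
  by (rule multiplier_eqI[OF assms(2)], rule nondegenerate_eqI(1)[OF assms(1)])
    (simp add: rmul_lmul assms(2))

text \<open>Associativity (x a) y = x (a y) in M(A), pulled back along the injective
  \<open>mult_of\<close>.\<close>

lemma rmul_lmul_commute:
  fixes x y :: "'a::complex_algebra multiplier"
  assumes nd: "nondegenerate_product TYPE('a)"
  shows "rmul (lmul x a) y = lmul x (rmul a y)"
  unfolding mult_of_inject[OF nd, symmetric] multiplier_mult_of[OF nd, symmetric] by (simp add: mult.assoc)

lemma multiplier_cancel_right:
  fixes x y :: "'a::complex_algebra multiplier"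
  assumes nd: "nondegenerate_product TYPE('a)" and "\<And>a. x * mult_of a = y * mult_of a"
  shows "x = y"
  by (rule multiplier_eq_lmulI[OF nd])
    (use assms(2) in \<open>simp add: multiplier_mult_of[OF nd] mult_of_inject[OF nd]\<close>)

lemma multiplier_cancel_left:
  fixes x y :: "'a::complex_algebra multiplier"
  assumes nd: "nondegenerate_product TYPE('a)" and eq: "\<And>a. mult_of a * x = mult_of a * y"
  shows "x = y"
proof (rule multiplier_eq_lmulI[OF nd], rule nondegenerate_eqI(2)[OF nd])
  show "b * lmul x a = b * lmul y a" for a b
    using arg_cong[OF eq[of b], of "\<lambda>m. lmul m a"] by simp
qed

section \<open>The multipliers m \<otimes> n and the map M(A) \<otimes> M(A) \<rightarrow> M(A
  \<otimes> A)\<close>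

lemma lmul_mtens: "lmul (mtens m n) = tensor_map (lmul m) (lmul n)"
  by (rule ext) (simp add: lmul.rep_eq mtens.rep_eq)

lemma rmul_mtens: "rmul z (mtens m n) = tensor_map (\<lambda>a. rmul a m) (\<lambda>b. rmul b n) z"
  by (simp add: rmul.rep_eq mtens.rep_eq)

lemma lmul_mtens_tens [simp]: "lmul (mtens m n) (a \<otimes>\<^sub>t b) = lmul m a \<otimes>\<^sub>t lmul n b"
  by (simp add: lmul_mtens lmul_linear)

lemma rmul_mtens_tens [simp]: "rmul (a \<otimes>\<^sub>t b) (mtens m n) = rmul a m \<otimes>\<^sub>t rmul b n"
  by (simp add: rmul_mtens rmul_linear)

lemma multiplier_tens_eqI:
  fixes x y :: "('a::complex_algebra \<otimes>\<^sub>t 'b::complex_algebra) multiplier"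
  assumes "\<And>a b. lmul x (a \<otimes>\<^sub>t b) = lmul y (a \<otimes>\<^sub>t b)" "\<And>a b. rmul (a \<otimes>\<^sub>t b) x = rmul (a \<otimes>\<^sub>t b) y"
  shows "x = y"
  by (rule multiplier_eqI)
    (rule clinear_eq_tensI[OF lmul_linear lmul_linear] clinear_eq_tensI[OF rmul_linear rmul_linear],
      rule assms)+

lemma cbilinear_mtens: "cbilinear mtens"
  by (rule cbilinearI; rule multiplier_tens_eqI) (simp_all add: tens_simps)

lemma clinear_mtens_left: "clinear f \<Longrightarrow> clinear (\<lambda>x. mtens (f x) n)"
  and clinear_mtens_right: "clinear f \<Longrightarrow> clinear (\<lambda>x. mtens m (f x))"
  by (erule clinear_compose, rule cbilinear_mtens[unfolded cbilinear_def, THEN conjunct2, THEN spec])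
    (erule clinear_compose, rule cbilinear_mtens[unfolded cbilinear_def, THEN conjunct1, THEN spec])

lemma clinear_mult_tensor: "clinear mult_tensor"
  unfolding mult_tensor_def by (rule clinear_tensor_lift[OF cbilinear_mtens])

lemma clinear_mult_tensor_arg: "clinear f \<Longrightarrow> clinear (\<lambda>x. mult_tensor (f x))"
  by (rule clinear_compose[OF _ clinear_mult_tensor])

lemmas mult_clinear_intros = clinear_intros clinear_lmul clinear_lmul_arg clinear_rmul clinear_rmul_arg
  clinear_mult_of_arg clinear_mtens_left clinear_mtens_right clinear_mult_tensor_arg

lemma lmul_mult_tensor:
  "lmul (mult_tensor w) (a \<otimes>\<^sub>t b) = tensor_map (\<lambda>m. lmul m a) (\<lambda>n. lmul n b) w"
proof (rule clinear_eq_tensI[of "\<lambda>w. lmul (mult_tensor w) (a \<otimes>\<^sub>t b)"])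
  show "clinear (\<lambda>w. lmul (mult_tensor w) (a \<otimes>\<^sub>t b))" by (intro mult_clinear_intros)
  show "clinear (tensor_map (\<lambda>m. lmul m a) (\<lambda>n. lmul n b))"
    by (intro clinear_tensor_map mult_clinear_intros)
  show "lmul (mult_tensor (m \<otimes>\<^sub>t n)) (a \<otimes>\<^sub>t b) = tensor_map (\<lambda>m. lmul m a) (\<lambda>n. lmul n b) (m \<otimes>\<^sub>t n)"
    for m n
    by (simp add: mult_tensor_tens clinear_lmul_arg clinear_ident)
qed

lemma mtens_times: "mtens m n * mtens m' n' = mtens (m * m') (n * n')"
  by (rule multiplier_tens_eqI) simp_all

lemma mtens_one [simp]: "mtens 1 1 = 1"
  by (rule multiplier_tens_eqI) simp_all

lemma star_mtens: "star (mtens m n) = mtens (star m) (star n)"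
  by (rule multiplier_tens_eqI) (simp_all add: star_simps star_tensor_aux(2))

lemma mult_tensor_times: "mult_tensor (v * w) = mult_tensor v * mult_tensor w"
proof (rule clinear_eq_tensI[of "\<lambda>v. mult_tensor (v * w)" "\<lambda>v. mult_tensor v * mult_tensor w"])
  show "mult_tensor ((m \<otimes>\<^sub>t n) * w) = mult_tensor (m \<otimes>\<^sub>t n) * mult_tensor w" for m n
    by (rule clinear_eq_tensI[of "\<lambda>w. mult_tensor ((m \<otimes>\<^sub>t n) * w)" "\<lambda>w. mult_tensor (m \<otimes>\<^sub>t n) * mult_tensor w"])
      ((intro mult_clinear_intros)+, simp add: tens_times_tens mult_tensor_tens mtens_times)
qed (intro mult_clinear_intros)+

lemma star_mult_tensor: "star (mult_tensor w) = mult_tensor (star w)"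
  by (induction w rule: tens_induct)
    (simp_all add: mult_tensor_tens star_mtens star_tensor_aux(2) star_add
      clinear_add[OF clinear_mult_tensor])

lemma one_in_range_mult_tensor: "1 \<in> range mult_tensor"
  by (rule range_eqI[of _ _ "1 \<otimes>\<^sub>t 1"]) (simp add: mult_tensor_tens)

text \<open>Multiplication by c \<otimes> d is the tensor product of the multiplications by c and d.
  These separate the points of each factor, so their tensor products separate the points of the
  tensor product.\<close>

lemma nondegenerate_product_tensor:
  assumes "nondegenerate_product TYPE('a::complex_algebra)" "nondegenerate_product TYPE('b::complex_algebra)"
  shows "nondegenerate_product TYPE('a \<otimes>\<^sub>t 'b)"
proof -
  have r: "z * (c \<otimes>\<^sub>t d) = tensor_map (\<lambda>x. x * c) (\<lambda>x. x * d) z"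
    and l: "(c \<otimes>\<^sub>t d) * z = tensor_map (\<lambda>x. c * x) (\<lambda>x. d * x) z" for z and c :: 'a and d :: 'b
    by (rule clinear_eq_tensI[OF clinear_mult_right clinear_tensor_map[OF clinear_mult_right clinear_mult_right]],
        simp add: tens_times_tens clinear_mult_right,
        rule clinear_eq_tensI[OF clinear_mult_left clinear_tensor_map[OF clinear_mult_left clinear_mult_left]],
        simp add: tens_times_tens clinear_mult_left)
  have 1: "z = 0" if zero: "\<forall>w. z * w = 0" for z :: "'a \<otimes>\<^sub>t 'b"
  proof (rule tensor_map_separating[of "range (\<lambda>c x. x * c)" "range (\<lambda>c x. x * c)"])
    show "tensor_map f g z = 0" if "f \<in> range (\<lambda>c x. x * c)" "g \<in> range (\<lambda>c x. x * c)" for f g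
      using that zero by (auto simp: r[symmetric])
    show "x = 0" if "\<And>f. f \<in> range (\<lambda>c x. x * c) \<Longrightarrow> f x = 0" for x :: 'a
      using that assms(1) unfolding nondegenerate_product_def by blast
    show "x = 0" if "\<And>f. f \<in> range (\<lambda>c x. x * c) \<Longrightarrow> f x = 0" for x :: 'b
      using that assms(2) unfolding nondegenerate_product_def by blast
  qed (auto intro!: clinear_intros)
  have 2: "z = 0" if zero: "\<forall>w. w * z = 0" for z :: "'a \<otimes>\<^sub>t 'b"
  proof (rule tensor_map_separating[of "range (\<lambda>c x. c * x)" "range (\<lambda>c x. c * x)"])
    show "tensor_map f g z = 0" if "f \<in> range (\<lambda>c x. c * x)" "g \<in> range (\<lambda>c x. c * x)" for f g
      using that zero by (auto simp: l[symmetric])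
    show "x = 0" if "\<And>f. f \<in> range (\<lambda>c x. c * x) \<Longrightarrow> f x = 0" for x :: 'a
      using that assms(1) unfolding nondegenerate_product_def by blast
    show "x = 0" if "\<And>f. f \<in> range (\<lambda>c x. c * x) \<Longrightarrow> f x = 0" for x :: 'b
      using that assms(2) unfolding nondegenerate_product_def by blast
  qed (auto intro!: clinear_intros)
  show ?thesis unfolding nondegenerate_product_def by (intro conjI allI impI) (erule 1, erule 2)
qed

lemma multiplier_lmul_zeroD:
  "nondegenerate_product TYPE('a) \<Longrightarrow> (\<And>a. lmul m a = 0) \<Longrightarrow> m = 0"
  for m :: "'a::complex_algebra multiplier"
  by (rule multiplier_eq_lmulI) simp_all

text \<open>Applying the multiplier to a \<otimes> b is the tensor product of the evaluations m
  \<mapsto> m a and n \<mapsto> n b, and evaluations separate multipliers. This is what allows M(A)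
  \<otimes> M(A) to be regarded as a subalgebra of M(A \<otimes> A).\<close>

lemma mult_tensor_eq_0D:
  fixes w :: "'a::complex_algebra multiplier \<otimes>\<^sub>t 'b::complex_algebra multiplier"
  assumes nd: "nondegenerate_product TYPE('a)" "nondegenerate_product TYPE('b)"
    and w: "mult_tensor w = 0"
  shows "w = 0"
proof (rule tensor_map_separating[of "range (\<lambda>a m. lmul m a)" "range (\<lambda>b n. lmul n b)"])
  show "tensor_map f g w = 0" if "f \<in> range (\<lambda>a m. lmul m a)" "g \<in> range (\<lambda>b n. lmul n b)" for f g
    using that w by (auto simp: lmul_mult_tensor[symmetric])
  show "m = 0" if "\<And>f. f \<in> range (\<lambda>a m. lmul m a) \<Longrightarrow> f m = 0" for m :: "'a multiplier"
    using that by (intro multiplier_lmul_zeroD[OF nd(1)]) blast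
  show "n = 0" if "\<And>f. f \<in> range (\<lambda>a m. lmul m a) \<Longrightarrow> f n = 0" for n :: "'b multiplier"
    using that by (intro multiplier_lmul_zeroD[OF nd(2)]) blast
qed (auto intro: clinear_lmul_arg[OF clinear_ident])

lemma mult_tensor_inject:
  fixes v w :: "'a::complex_algebra multiplier \<otimes>\<^sub>t 'b::complex_algebra multiplier"
  assumes "nondegenerate_product TYPE('a)" "nondegenerate_product TYPE('b)"
  shows "mult_tensor v = mult_tensor w \<longleftrightarrow> v = w"
  using mult_tensor_eq_0D[OF assms, of "v - w"] by (auto simp: clinear_diff[OF clinear_mult_tensor])

text \<open>Removes the factor a \<otimes> 1 that the multiplier form of coassociativity carries.
  The second leg is tested with the identity alone, written \<open>lmul 1\<close>.\<close>

lemma tensor_cancel_first_leg: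
  fixes y z :: "'a::complex_algebra \<otimes>\<^sub>t 'b::complex_algebra"
  assumes nd: "nondegenerate_product TYPE('a)"
    and eq: "\<And>a. lmul (mtens (mult_of a) 1) y = lmul (mtens (mult_of a) 1) z"
  shows "y = z"
proof -
  have "y - z = 0"
  proof (rule tensor_map_separating[of "range (\<lambda>a. lmul (mult_of a))" "{lmul 1}"])
    show "tensor_map f g (y - z) = 0" if "f \<in> range (\<lambda>a. lmul (mult_of a))" "g \<in> {lmul 1}" for f g
      using that eq by (auto simp: lmul_mtens[symmetric] clinear_diff[OF lmul_linear])
    show "x = 0" if "\<And>f. f \<in> range (\<lambda>a. lmul (mult_of a)) \<Longrightarrow> f x = 0" for x :: 'a
    proof -
      have "lmul (mult_of a) x = 0" for a by (rule that) blast
      then show ?thesis using nd unfolding nondegenerate_product_def lmul_simps by blast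
    qed
  qed (auto simp: lmul_linear)
  then show ?thesis by simp
qed

lemma lmul_Abs_multiplier:
  "clinear L \<Longrightarrow> clinear R \<Longrightarrow> (\<And>a b. R b * a = b * L a) \<Longrightarrow> lmul (Abs_multiplier (L, R)) a = L a"
  by (simp add: lmul.rep_eq Abs_multiplier_inverse)

text \<open>The prescribed left action needs a matching right action to be a multiplier. Both b (S
  a) and (b S) a equal the slice by f of (b \<otimes> r) X (a \<otimes> q), which explains why a
  factor is needed on each side.\<close>

lemma slice_multiplier_exists_r:
  fixes X :: "('a::complex_algebra \<otimes>\<^sub>t 'b::complex_algebra) multiplier"
  assumes f: "clinear f"
  obtains S where "\<And>a. lmul S a = slice_r (\<lambda>y. f (r * y)) (lmul X (a \<otimes>\<^sub>t q))"
proof -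
  let ?L = "\<lambda>a. slice_r (\<lambda>y. f (r * y)) (lmul X (a \<otimes>\<^sub>t q))"
  \<comment> \<open>The roles of r and q are exchanged: r now enters through the tensor on which X
    acts from the right, and q enters through the functional.\<close>
  let ?R = "\<lambda>a. slice_r (\<lambda>y. f (y * q)) (rmul (a \<otimes>\<^sub>t r) X)"
  have fr: "clinear (\<lambda>y. f (r * y))" "clinear (\<lambda>y. f (y * q))"
    by (intro clinear_compose[OF _ f] clinear_intros)+
  have L: "clinear ?L" and R: "clinear ?R"
    by (intro clinear_compose[OF _ clinear_slice_r] fr mult_clinear_intros)+
  have 1: "slice_r (\<lambda>y. f (y * q)) z * a = slice_r f (z * (a \<otimes>\<^sub>t q))" for z a
    by (rule clinear_eq_tensI[of "\<lambda>z. slice_r (\<lambda>y. f (y * q)) z * a" "\<lambda>z. slice_r f (z * (a \<otimes>\<^sub>t q))"])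
      ((intro clinear_compose[OF _ clinear_slice_r] clinear_times_right clinear_slice_r f fr clinear_intros)+,
        simp add: fr f tens_times_tens mult_scaleC_left)
  have 2: "b * slice_r (\<lambda>y. f (r * y)) z = slice_r f ((b \<otimes>\<^sub>t r) * z)" for z b
    by (rule clinear_eq_tensI[of "\<lambda>z. b * slice_r (\<lambda>y. f (r * y)) z" "\<lambda>z. slice_r f ((b \<otimes>\<^sub>t r) * z)"])
      ((intro clinear_compose[OF _ clinear_slice_r] clinear_times_left clinear_slice_r f fr clinear_intros)+,
        simp add: fr f tens_times_tens mult_scaleC_right)
  have "?R b * a = b * ?L a" for a b
    by (simp add: 1 2 rmul_lmul)
  then have "lmul (Abs_multiplier (?L, ?R)) a = ?L a" for a
    by (rule lmul_Abs_multiplier[OF L R])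
  then show ?thesis by (rule that)
qed

lemma slice_multiplier_exists_l:
  fixes X :: "('a::complex_algebra \<otimes>\<^sub>t 'b::complex_algebra) multiplier"
  assumes f: "clinear f"
  obtains S where "\<And>b. lmul S b = slice_l (\<lambda>y. f (r * y)) (lmul X (q \<otimes>\<^sub>t b))"
proof -
  let ?L = "\<lambda>b. slice_l (\<lambda>y. f (r * y)) (lmul X (q \<otimes>\<^sub>t b))"
  let ?R = "\<lambda>b. slice_l (\<lambda>y. f (y * q)) (rmul (r \<otimes>\<^sub>t b) X)"
  have fr: "clinear (\<lambda>y. f (r * y))" "clinear (\<lambda>y. f (y * q))"
    by (intro clinear_compose[OF _ f] clinear_intros)+
  have L: "clinear ?L" and R: "clinear ?R"
    by (intro clinear_compose[OF _ clinear_slice_l] fr mult_clinear_intros)+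
  have 1: "slice_l (\<lambda>y. f (y * q)) z * a = slice_l f (z * (q \<otimes>\<^sub>t a))" for z a
    by (rule clinear_eq_tensI[of "\<lambda>z. slice_l (\<lambda>y. f (y * q)) z * a" "\<lambda>z. slice_l f (z * (q \<otimes>\<^sub>t a))"])
      ((intro clinear_compose[OF _ clinear_slice_l] clinear_times_right clinear_slice_l f fr clinear_intros)+,
        simp add: fr f tens_times_tens mult_scaleC_left)
  have 2: "b * slice_l (\<lambda>y. f (r * y)) z = slice_l f ((r \<otimes>\<^sub>t b) * z)" for z b
    by (rule clinear_eq_tensI[of "\<lambda>z. b * slice_l (\<lambda>y. f (r * y)) z" "\<lambda>z. slice_l f ((r \<otimes>\<^sub>t b) * z)"])
      ((intro clinear_compose[OF _ clinear_slice_l] clinear_times_left clinear_slice_l f fr clinear_intros)+,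
        simp add: fr f tens_times_tens mult_scaleC_right)
  have "?R b * a = b * ?L a" for a b
    by (simp add: 1 2 rmul_lmul)
  then have "lmul (Abs_multiplier (?L, ?R)) a = ?L a" for a
    by (rule lmul_Abs_multiplier[OF L R])
  then show ?thesis by (rule that)
qed

section \<open>Almost periodic elements of a multiplier Hopf algebra\<close>

locale multiplier_Hopf_extension =
  fixes \<delta> :: "'a::complex_algebra \<Rightarrow> ('a \<otimes>\<^sub>t 'a) multiplier"
    and \<delta>M :: "'a multiplier \<Rightarrow> ('a \<otimes>\<^sub>t 'a) multiplier"
  assumes Hopf: "multiplier_Hopf_algebra \<delta>" and ext: "hom_extension \<delta> \<delta>M"
begin

abbreviation AP :: "'a multiplier set" where "AP \<equiv> almost_periodic \<delta>M"

lemma nd: "nondegenerate_product TYPE('a)"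
  using Hopf by (simp add: multiplier_Hopf_algebra_def)

lemmas nd2 = nondegenerate_product_tensor[OF nd nd]
lemmas nd3 = nondegenerate_product_tensor[OF nd nd2]

section \<open>The extended comultiplication and the maps T1 and T2\<close>

lemma \<delta>_linear: "clinear \<delta>"
  using Hopf by (auto simp: multiplier_Hopf_algebra_def alg_hom_def)

lemma \<delta>M_linear: "clinear \<delta>M" and \<delta>M_times: "\<delta>M (x * y) = \<delta>M x * \<delta>M y"
  and \<delta>M_one: "\<delta>M 1 = 1" and \<delta>M_mult_of: "\<delta>M (mult_of a) = \<delta> a"
  using ext by (auto simp: hom_extension_def alg_hom_def)

lemma \<delta>_lmul: "\<delta> (lmul x a) = \<delta>M x * \<delta> a" and \<delta>_rmul: "\<delta> (rmul a x) = \<delta> a * \<delta>M x"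
  by (simp_all add: \<delta>M_mult_of[symmetric] multiplier_mult_of[OF nd, symmetric] \<delta>M_times)

lemma T1_mult_bilinear: "cbilinear (\<lambda>a b. \<delta> a * mtens 1 (mult_of b))"
  and T2_mult_bilinear: "cbilinear (\<lambda>a b. mtens (mult_of a) 1 * \<delta> b)"
  unfolding cbilinear_iff_clinear by (intro conjI allI mult_clinear_intros \<delta>_linear)+

text \<open>The definite descriptions behind \<open>T1\<close> and \<open>T2\<close> denote:
  existence comes from the bijectivity axioms, uniqueness from nondegeneracy of A \<otimes>
  A.\<close>

lemma mult_of_T1: "mult_of (T1 \<delta> z) = T1_mult \<delta> z"
  and mult_of_T2: "mult_of (T2 \<delta> z) = T2_mult \<delta> z"
proof -
  have the: "mult_of (THE w. mult_of w = X) = X" if X: "X \<in> range mult_of" for X :: "('a \<otimes>\<^sub>t 'a) multiplier"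
  proof -
    obtain v where v: "X = mult_of v" using X by blast
    then show ?thesis by (simp add: mult_of_inject[OF nd2])
  qed
  have "T1_mult \<delta> z \<in> range mult_of" "T2_mult \<delta> z \<in> range mult_of"
    using Hopf bij_betw_imp_surj_on[of "T1_mult \<delta>" UNIV "range mult_of"]
      bij_betw_imp_surj_on[of "T2_mult \<delta>" UNIV "range mult_of"]
    unfolding multiplier_Hopf_algebra_def by blast+
  then show "mult_of (T1 \<delta> z) = T1_mult \<delta> z" "mult_of (T2 \<delta> z) = T2_mult \<delta> z"
    unfolding T1_def T2_def using the by blast+
qed

lemma mult_of_T1_tens: "mult_of (T1 \<delta> (a \<otimes>\<^sub>t b)) = \<delta> a * mtens 1 (mult_of b)"
  by (simp add: mult_of_T1 T1_mult_def T1_mult_bilinear)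

lemma mult_of_T2_tens: "mult_of (T2 \<delta> (a \<otimes>\<^sub>t b)) = mtens (mult_of a) 1 * \<delta> b"
  by (simp add: mult_of_T2 T2_mult_def T2_mult_bilinear)

lemma T1_linear: "clinear (T1 \<delta>)"
  by (rule clinearI; rule iffD1[OF mult_of_inject[OF nd2]])
    (simp_all add: mult_of_T1 T1_mult_def T1_mult_bilinear)

lemma T2_linear: "clinear (T2 \<delta>)"
  by (rule clinearI; rule iffD1[OF mult_of_inject[OF nd2]])
    (simp_all add: mult_of_T2 T2_mult_def T2_mult_bilinear)

text \<open>By surjectivity of T1 the elements \<delta>(b) (1 \<otimes> c) span A \<otimes> A and
  can replace elementary tensors as test vectors. They are the convenient ones, since
  \<open>\<delta>M x\<close> acts on them by replacing b with x b.\<close>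

lemma T1_eqI:
  assumes f: "clinear f" and g: "clinear g" and eq: "\<And>b c. f (T1 \<delta> (b \<otimes>\<^sub>t c)) = g (T1 \<delta> (b \<otimes>\<^sub>t c))"
  shows "f u = g u"
proof -
  have "mult_of u \<in> range (T1_mult \<delta>)"
    using Hopf by (simp add: multiplier_Hopf_algebra_def bij_betw_def)
  then obtain z where "T1 \<delta> z = u"
    by (auto simp: mult_of_T1[symmetric] mult_of_inject[OF nd2])
  moreover have "f (T1 \<delta> z) = g (T1 \<delta> z)"
    by (rule clinear_eq_tensI[OF clinear_compose[OF T1_linear f] clinear_compose[OF T1_linear g] eq])
  ultimately show ?thesis by simp
qed

lemma T2_eqI:
  assumes f: "clinear f" and g: "clinear g" and eq: "\<And>b c. f (T2 \<delta> (b \<otimes>\<^sub>t c)) = g (T2 \<delta> (b \<otimes>\<^sub>t c))"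
  shows "f u = g u"
proof -
  have "mult_of u \<in> range (T2_mult \<delta>)"
    using Hopf by (simp add: multiplier_Hopf_algebra_def bij_betw_def)
  then obtain z where "T2 \<delta> z = u"
    by (auto simp: mult_of_T2[symmetric] mult_of_inject[OF nd2])
  moreover have "f (T2 \<delta> z) = g (T2 \<delta> z)"
    by (rule clinear_eq_tensI[OF clinear_compose[OF T2_linear f] clinear_compose[OF T2_linear g] eq])
  ultimately show ?thesis by simp
qed

lemma T1_lmul: "T1 \<delta> (lmul x b \<otimes>\<^sub>t c) = lmul (\<delta>M x) (T1 \<delta> (b \<otimes>\<^sub>t c))"
  by (rule iffD1[OF mult_of_inject[OF nd2]])
    (simp add: mult_of_T1_tens multiplier_mult_of(1)[OF nd2, symmetric] \<delta>_lmul mult.assoc)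

lemma T2_rmul: "T2 \<delta> (a \<otimes>\<^sub>t rmul b x) = rmul (T2 \<delta> (a \<otimes>\<^sub>t b)) (\<delta>M x)"
  by (rule iffD1[OF mult_of_inject[OF nd2]])
    (simp add: mult_of_T2_tens multiplier_mult_of(2)[OF nd2, symmetric] \<delta>_rmul mult.assoc)

text \<open>In (a \<otimes> 1) \<delta>(x) \<delta>(b) the factor a absorbs the left legs of
  \<delta>(x), while the right legs act from the left on the second leg of the result.\<close>

lemma T2_lmul:
  assumes "\<delta>M x = (\<Sum>i\<in>I. mtens (m i) (n i))"
  shows "T2 \<delta> (a \<otimes>\<^sub>t lmul x b) = (\<Sum>i\<in>I. lmul (mtens 1 (n i)) (T2 \<delta> (rmul a (m i) \<otimes>\<^sub>t b)))"
  by (rule iffD1[OF mult_of_inject[OF nd2]])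
    (simp add: clinear_sum[OF clinear_mult_of] mult_of_T2_tens multiplier_mult_of(1)[OF nd2, symmetric]
      multiplier_mult_of(2)[OF nd, symmetric] \<delta>_lmul assms sum_distrib_left sum_distrib_right
      mult.assoc[symmetric] mtens_times)

text \<open>Both sides are (a \<otimes> 1) \<delta>(p) (1 \<otimes> c).\<close>

lemma T1_T2: "lmul (mtens (mult_of a) 1) (T1 \<delta> (p \<otimes>\<^sub>t c)) = rmul (T2 \<delta> (a \<otimes>\<^sub>t p)) (mtens 1 (mult_of c))"
  by (rule iffD1[OF mult_of_inject[OF nd2]])
    (simp add: multiplier_mult_of[OF nd2, symmetric] mult_of_T1_tens mult_of_T2_tens mult.assoc)

text \<open>The commutation axiom evaluated at (a \<otimes> b) \<otimes> c. It expresses (a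
  \<otimes> 1 \<otimes> 1) (\<delta> \<otimes> id)(\<delta>(b) (1 \<otimes> c)) = (id \<otimes>
  \<delta>)((a \<otimes> 1) \<delta>(b)) (1 \<otimes> 1 \<otimes> c).\<close>

lemma coassociativity:
  "tensor_assoc (tensor_map (T2 \<delta>) id (inv_into UNIV tensor_assoc (a \<otimes>\<^sub>t T1 \<delta> (b \<otimes>\<^sub>t c)))) =
    tensor_map id (T1 \<delta>) (tensor_assoc (T2 \<delta> (a \<otimes>\<^sub>t b) \<otimes>\<^sub>t c))"
proof -
  have "(tensor_map (T2 \<delta>) id \<circ> (inv_into UNIV tensor_assoc \<circ> tensor_map id (T1 \<delta>) \<circ> tensor_assoc))
      ((a \<otimes>\<^sub>t b) \<otimes>\<^sub>t c) =
    ((inv_into UNIV tensor_assoc \<circ> tensor_map id (T1 \<delta>) \<circ> tensor_assoc) \<circ> tensor_map (T2 \<delta>) id)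
      ((a \<otimes>\<^sub>t b) \<otimes>\<^sub>t c)"
    using Hopf unfolding multiplier_Hopf_algebra_def Let_def by metis
  then show ?thesis
    by (simp add: tensor_assoc_tens T1_linear T2_linear id_clinear inv_tensor_assoc)
qed

text \<open>\<open>(a \<otimes> 1 \<otimes> 1) (\<delta> \<otimes> id)(\<delta> x) (s \<otimes> t \<otimes> q) = (a \<otimes> 1 \<otimes> 1) (id \<otimes> \<delta>)(\<delta> x) (s \<otimes> t \<otimes> q)\<close>.
  The axiom, applied to \<open>a \<otimes> x b \<otimes> c\<close>, gives this up to factors which are removed by the
  surjectivity of \<open>T\<^sub>1\<close>.\<close>

lemma coassociativity_multiplier:
  assumes x: "\<delta>M x = (\<Sum>i\<in>I. mtens (m i) (n i))"
  shows "(\<Sum>i\<in>I. tensor_assoc (lmul (mtens (mult_of a) 1) (lmul (\<delta>M (m i)) (s \<otimes>\<^sub>t t)) \<otimes>\<^sub>t lmul (n i) q)) =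
    (\<Sum>i\<in>I. (a * lmul (m i) s) \<otimes>\<^sub>t lmul (\<delta>M (n i)) (t \<otimes>\<^sub>t q))"
proof -
  \<comment> \<open>\<Lambda> is the left side of the axiom, (a \<otimes> 1 \<otimes> 1) (\<delta>
    \<otimes> id)(u), and R the right side, (id \<otimes> \<delta>)(z) (1 \<otimes> 1 \<otimes> c),
    both grouped to the right.\<close>
  define \<Lambda> where "\<Lambda> a u = tensor_assoc (tensor_map (T2 \<delta>) id (inv_into UNIV tensor_assoc (a \<otimes>\<^sub>t u)))"
    for a :: 'a and u :: "'a \<otimes>\<^sub>t 'a"
  define R where "R c z = tensor_map id (T1 \<delta>) (tensor_assoc (z \<otimes>\<^sub>t c))"
    for c :: 'a and z :: "'a \<otimes>\<^sub>t 'a"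
  have \<Lambda>_linear: "clinear (\<Lambda> a)" for a
    unfolding \<Lambda>_def by (intro mult_clinear_intros clinear_compose[OF _ clinear_inv_assoc] T2_linear)
  have R_linear: "clinear (R c)" for c
    unfolding R_def by (intro mult_clinear_intros T1_linear)
  have \<Lambda>_tens: "\<Lambda> a (p \<otimes>\<^sub>t q) = tensor_assoc (T2 \<delta> (a \<otimes>\<^sub>t p) \<otimes>\<^sub>t q)" for a p q
    by (simp add: \<Lambda>_def inv_assoc_tens T2_linear id_clinear)
  have \<Lambda>_R: "\<Lambda> a (T1 \<delta> (b \<otimes>\<^sub>t c)) = R c (T2 \<delta> (a \<otimes>\<^sub>t b))" for a b c
    unfolding \<Lambda>_def R_def by (rule coassociativity)
  have R_lmul: "R c (lmul (mtens 1 n) z) = lmul (mtens 1 (\<delta>M n)) (R c z)" for c n z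
  proof (rule clinear_eq_tensI[of "\<lambda>z. R c (lmul (mtens 1 n) z)" "\<lambda>z. lmul (mtens 1 (\<delta>M n)) (R c z)"])
    show "R c (lmul (mtens 1 n) (p \<otimes>\<^sub>t q)) = lmul (mtens 1 (\<delta>M n)) (R c (p \<otimes>\<^sub>t q))" for p q
      by (simp add: R_def tensor_assoc_tens T1_linear id_clinear T1_lmul)
  qed (intro clinear_compose[OF _ R_linear] clinear_compose[OF R_linear] mult_clinear_intros R_linear)+
  \<comment> \<open>The axiom is used for x b and again for b; surjectivity of T1 then lets T1(b
    \<otimes> c) be an arbitrary u.\<close>
  have step1: "(\<Sum>i\<in>I. \<Lambda> a (lmul (mtens (m i) (n i)) u)) =
      (\<Sum>i\<in>I. lmul (mtens 1 (\<delta>M (n i))) (\<Lambda> (rmul a (m i)) u))" for a u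
  proof (rule T1_eqI[of "\<lambda>u. (\<Sum>i\<in>I. \<Lambda> a (lmul (mtens (m i) (n i)) u))"
        "\<lambda>u. (\<Sum>i\<in>I. lmul (mtens 1 (\<delta>M (n i))) (\<Lambda> (rmul a (m i)) u))"])
    fix b c
    have "(\<Sum>i\<in>I. \<Lambda> a (lmul (mtens (m i) (n i)) (T1 \<delta> (b \<otimes>\<^sub>t c)))) = \<Lambda> a (lmul (\<delta>M x) (T1 \<delta> (b \<otimes>\<^sub>t c)))"
      by (simp add: x clinear_sum[OF \<Lambda>_linear] clinear_sum[OF clinear_lmul_arg[OF clinear_ident]])
    also have "\<dots> = R c (T2 \<delta> (a \<otimes>\<^sub>t lmul x b))"
      by (simp add: T1_lmul[symmetric] \<Lambda>_R)
    also have "\<dots> = (\<Sum>i\<in>I. lmul (mtens 1 (\<delta>M (n i))) (\<Lambda> (rmul a (m i)) (T1 \<delta> (b \<otimes>\<^sub>t c))))"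
      by (simp add: T2_lmul[OF x] clinear_sum[OF R_linear] R_lmul \<Lambda>_R)
    finally show "(\<Sum>i\<in>I. \<Lambda> a (lmul (mtens (m i) (n i)) (T1 \<delta> (b \<otimes>\<^sub>t c)))) =
      (\<Sum>i\<in>I. lmul (mtens 1 (\<delta>M (n i))) (\<Lambda> (rmul a (m i)) (T1 \<delta> (b \<otimes>\<^sub>t c))))" .
  qed (intro clinear_setsum clinear_lmul \<Lambda>_linear clinear_compose[OF lmul_linear \<Lambda>_linear])+
  have rmul_assoc: "rmul (tensor_assoc (z \<otimes>\<^sub>t q)) (mtens 1 (mtens k 1)) = tensor_assoc (rmul z (mtens 1 k) \<otimes>\<^sub>t q)"
    for z :: "'a \<otimes>\<^sub>t 'a" and q :: 'a and k
    by (rule clinear_eq_tensI[of "\<lambda>z. rmul (tensor_assoc (z \<otimes>\<^sub>t q)) (mtens 1 (mtens k 1))"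
          "\<lambda>z. tensor_assoc (rmul z (mtens 1 k) \<otimes>\<^sub>t q)"])
      ((intro mult_clinear_intros)+, simp add: tensor_assoc_tens)
  have \<Lambda>_rmul: "rmul (\<Lambda> a (p \<otimes>\<^sub>t q)) (mtens 1 (mtens (mult_of c) 1)) =
      tensor_assoc (lmul (mtens (mult_of a) 1) (T1 \<delta> (p \<otimes>\<^sub>t c)) \<otimes>\<^sub>t q)" for a p q c
    by (simp add: \<Lambda>_tens rmul_assoc T1_T2)
  \<comment> \<open>Multiplying the first identity, at u = p \<otimes> q, from the right by 1
    \<otimes> c \<otimes> 1 turns T2(a \<otimes> p) into (a \<otimes> 1) T1(p \<otimes> c). A second
    use of surjectivity frees T1(p \<otimes> c) to be any z.\<close>
  have step2: "(\<Sum>i\<in>I. tensor_assoc (lmul (mtens (mult_of a) 1) (lmul (\<delta>M (m i)) z) \<otimes>\<^sub>t lmul (n i) q)) =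
      (\<Sum>i\<in>I. lmul (mtens 1 (\<delta>M (n i))) (tensor_assoc (lmul (mtens (mult_of (rmul a (m i))) 1) z \<otimes>\<^sub>t q)))"
    for z
  proof (rule T1_eqI[of "\<lambda>z. (\<Sum>i\<in>I. tensor_assoc (lmul (mtens (mult_of a) 1) (lmul (\<delta>M (m i)) z) \<otimes>\<^sub>t lmul (n i) q))"
        "\<lambda>z. (\<Sum>i\<in>I. lmul (mtens 1 (\<delta>M (n i))) (tensor_assoc (lmul (mtens (mult_of (rmul a (m i))) 1) z \<otimes>\<^sub>t q)))"])
    fix p c
    show "(\<Sum>i\<in>I. tensor_assoc (lmul (mtens (mult_of a) 1) (lmul (\<delta>M (m i)) (T1 \<delta> (p \<otimes>\<^sub>t c))) \<otimes>\<^sub>t lmul (n i) q)) =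
      (\<Sum>i\<in>I. lmul (mtens 1 (\<delta>M (n i)))
        (tensor_assoc (lmul (mtens (mult_of (rmul a (m i))) 1) (T1 \<delta> (p \<otimes>\<^sub>t c)) \<otimes>\<^sub>t q)))"
      using arg_cong[OF step1[of a "p \<otimes>\<^sub>t q"], of "\<lambda>y. rmul y (mtens 1 (mtens (mult_of c) 1))"]
      by (simp add: clinear_sum[OF rmul_linear] \<Lambda>_rmul rmul_lmul_commute[OF nd3] T1_lmul)
  qed (intro mult_clinear_intros)+
  have "lmul (mtens 1 (\<delta>M (n i))) (tensor_assoc (lmul (mtens (mult_of (rmul a (m i))) 1) (s \<otimes>\<^sub>t t) \<otimes>\<^sub>t q)) =
      (a * lmul (m i) s) \<otimes>\<^sub>t lmul (\<delta>M (n i)) (t \<otimes>\<^sub>t q)" for i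
    by (simp add: tensor_assoc_tens rmul_lmul)
  then show ?thesis by (simp add: step2)
qed

section \<open>Slices of \<delta> x and the comultiplication on AP\<close>

lemma AP_subspace: "cvec.subspace AP"
proof -
  have "cvec.subspace (range (mult_tensor :: 'a multiplier \<otimes>\<^sub>t 'a multiplier \<Rightarrow> _))"
    by (rule module_hom.subspace_image[OF Vector_Spaces.linear.axioms(3)[OF clinear_mult_tensor]])
      (rule cvec.subspace_UNIV)
  then show ?thesis
    unfolding almost_periodic_def
    by (auto simp: cvec.subspace_def clinear_add[OF \<delta>M_linear] clinear_scaleC[OF \<delta>M_linear]
        clinear_zero[OF \<delta>M_linear])
qed

lemma functional_lmul_linear: "clinear f \<Longrightarrow> clinear (\<lambda>m. f (r * lmul m q))"
  for f :: "'a \<Rightarrow> complex"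
  by (rule clinear_compose[of "\<lambda>m. r * lmul m q" f]) (intro mult_clinear_intros)

lemma functional_times_linear: "clinear f \<Longrightarrow> clinear (\<lambda>y. f (r * y))"
  for f :: "'a \<Rightarrow> complex"
  by (rule clinear_compose[OF clinear_mult_left])

text \<open>Slicing the third leg of coassociativity writes \<delta> of the slice M as the sum of
  the m_i \<otimes> S(\<delta> n_i), where S slices the second leg of a multiplier of A \<otimes> A.
  This exhibits a preimage under \<open>mult_tensor\<close>.\<close>

lemma slice_r_almost_periodic:
  assumes w: "mult_tensor w = \<delta>M x" and f: "clinear f"
  shows "slice_r (\<lambda>n. f (r * lmul n q)) w \<in> AP"
proof -
  obtain k m n where w': "w = (\<Sum>i<k::nat. m i \<otimes>\<^sub>t n i)"
    by (rule tensor_set_sumE[OF tensor_set_UNIV[of w] cvec.subspace_UNIV])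
  have x: "\<delta>M x = (\<Sum>i<k. mtens (m i) (n i))"
    by (simp add: w[symmetric] w' clinear_sum[OF clinear_mult_tensor] mult_tensor_tens)
  have "\<exists>S. \<forall>a. lmul S a = slice_r (\<lambda>y. f (r * y)) (lmul X (a \<otimes>\<^sub>t q))" for X :: "('a \<otimes>\<^sub>t 'a) multiplier"
    by (rule slice_multiplier_exists_r[OF f]) blast
  then have "\<forall>X :: ('a \<otimes>\<^sub>t 'a) multiplier. \<exists>S. \<forall>a. lmul S a = slice_r (\<lambda>y. f (r * y)) (lmul X (a \<otimes>\<^sub>t q))"
    by blast
  from choice[OF this] obtain S where
    S: "\<And>X :: ('a \<otimes>\<^sub>t 'a) multiplier. \<And>a. lmul (S X) a = slice_r (\<lambda>y. f (r * y)) (lmul X (a \<otimes>\<^sub>t q))"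
    by blast
  note fr = functional_times_linear[OF f, of r]
  \<comment> \<open>Consumes the third leg by f (r y). The element q is already present, as the
    third leg of the test vector s \<otimes> t \<otimes> q.\<close>
  define \<Psi> :: "'a \<otimes>\<^sub>t ('a \<otimes>\<^sub>t 'a) \<Rightarrow> 'a \<otimes>\<^sub>t 'a" where "\<Psi> = tensor_map id (slice_r (\<lambda>y. f (r * y)))"
  have \<Psi>_linear: "clinear \<Psi>"
    unfolding \<Psi>_def by (intro clinear_tensor_map id_clinear clinear_slice_r fr)
  have \<Psi>_assoc: "\<Psi> (tensor_assoc (z \<otimes>\<^sub>t c)) = f (r * c) *\<^sub>C z" for z c
    by (rule clinear_eq_tensI[of "\<lambda>z. \<Psi> (tensor_assoc (z \<otimes>\<^sub>t c))" "\<lambda>z. f (r * c) *\<^sub>C z"])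
      ((intro clinear_compose[OF _ \<Psi>_linear] clinear_intros)+,
        simp add: tensor_assoc_tens \<Psi>_def id_clinear clinear_slice_r fr tens_scaleC_right)
  have \<Psi>_tens: "\<Psi> (a \<otimes>\<^sub>t y) = a \<otimes>\<^sub>t slice_r (\<lambda>y. f (r * y)) y" for a y
    by (simp add: \<Psi>_def id_clinear clinear_slice_r fr)
  define M where "M = (\<Sum>i<k. f (r * lmul (n i) q) *\<^sub>C m i)"
  have "\<delta>M M = mult_tensor (\<Sum>i<k. m i \<otimes>\<^sub>t S (\<delta>M (n i)))"
  proof (rule multiplier_eq_lmulI[OF nd2], rule clinear_eq_tensI[OF lmul_linear lmul_linear],
      rule tensor_cancel_first_leg[OF nd])
    fix s t a :: 'a
    show "lmul (mtens (mult_of a) 1) (lmul (\<delta>M M) (s \<otimes>\<^sub>t t)) =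
      lmul (mtens (mult_of a) 1) (lmul (mult_tensor (\<Sum>i<k. m i \<otimes>\<^sub>t S (\<delta>M (n i)))) (s \<otimes>\<^sub>t t))"
      using arg_cong[OF coassociativity_multiplier[OF x, of a s t q], of \<Psi>]
      by (simp add: clinear_sum[OF \<Psi>_linear] \<Psi>_assoc \<Psi>_tens S[symmetric] M_def
          clinear_sum[OF \<delta>M_linear] clinear_scaleC[OF \<delta>M_linear] clinear_sum[OF clinear_mult_tensor]
          mult_tensor_tens clinear_sum[OF lmul_linear] clinear_scaleC[OF lmul_linear]
          clinear_sum[OF clinear_lmul_arg[OF clinear_ident]])
  qed
  moreover have "slice_r (\<lambda>n. f (r * lmul n q)) w = M"
    by (simp add: w' M_def functional_lmul_linear f clinear_sum[OF clinear_slice_r])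
  ultimately show ?thesis by (simp add: almost_periodic_def)
qed

lemma slice_l_almost_periodic:
  assumes w: "mult_tensor w = \<delta>M x" and f: "clinear f"
  shows "slice_l (\<lambda>n. f (r * lmul n q)) w \<in> AP"
proof -
  obtain k m n where w': "w = (\<Sum>i<k::nat. m i \<otimes>\<^sub>t n i)"
    by (rule tensor_set_sumE[OF tensor_set_UNIV[of w] cvec.subspace_UNIV])
  have x: "\<delta>M x = (\<Sum>i<k. mtens (m i) (n i))"
    by (simp add: w[symmetric] w' clinear_sum[OF clinear_mult_tensor] mult_tensor_tens)
  have "\<exists>S. \<forall>a. lmul S a = slice_l (\<lambda>y. f (r * y)) (lmul X (q \<otimes>\<^sub>t a))" for X :: "('a \<otimes>\<^sub>t 'a) multiplier"
    by (rule slice_multiplier_exists_l[OF f]) blast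
  then have "\<forall>X :: ('a \<otimes>\<^sub>t 'a) multiplier. \<exists>S. \<forall>a. lmul S a = slice_l (\<lambda>y. f (r * y)) (lmul X (q \<otimes>\<^sub>t a))"
    by blast
  from choice[OF this] obtain S where
    S: "\<And>X :: ('a \<otimes>\<^sub>t 'a) multiplier. \<And>a. lmul (S X) a = slice_l (\<lambda>y. f (r * y)) (lmul X (q \<otimes>\<^sub>t a))"
    by blast
  note fr = functional_times_linear[OF f, of r]
  have slice_assoc: "slice_l f (tensor_assoc (lmul (mtens (mult_of r) 1) z \<otimes>\<^sub>t c)) =
      slice_l (\<lambda>y. f (r * y)) z \<otimes>\<^sub>t c" for z :: "'a \<otimes>\<^sub>t 'a" and c :: 'a
    by (rule clinear_eq_tensI[of "\<lambda>z. slice_l f (tensor_assoc (lmul (mtens (mult_of r) 1) z \<otimes>\<^sub>t c))"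
        "\<lambda>z. slice_l (\<lambda>y. f (r * y)) z \<otimes>\<^sub>t c"])
      ((intro clinear_compose[OF _ clinear_slice_l] clinear_slice_l fr f mult_clinear_intros)+,
        simp add: tensor_assoc_tens fr f tens_scaleC_left)
  define M where "M = (\<Sum>i<k. f (r * lmul (m i) q) *\<^sub>C n i)"
  have "\<delta>M M = mult_tensor (\<Sum>i<k. S (\<delta>M (m i)) \<otimes>\<^sub>t n i)"
  proof (rule multiplier_eq_lmulI[OF nd2], rule clinear_eq_tensI[OF lmul_linear lmul_linear])
    fix s t :: 'a
    show "lmul (\<delta>M M) (s \<otimes>\<^sub>t t) = lmul (mult_tensor (\<Sum>i<k. S (\<delta>M (m i)) \<otimes>\<^sub>t n i)) (s \<otimes>\<^sub>t t)"
      \<comment> \<open>On this side the free factor a and the first test element s of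
        coassociativity take the roles of r and q, so no factor remains to be cancelled.\<close>
      using arg_cong[OF coassociativity_multiplier[OF x, of r q s t], of "slice_l f"]
      by (simp add: clinear_sum[OF clinear_slice_l[OF f]] slice_assoc f S[symmetric] M_def
          clinear_sum[OF \<delta>M_linear] clinear_scaleC[OF \<delta>M_linear] clinear_sum[OF clinear_mult_tensor]
          mult_tensor_tens clinear_sum[OF clinear_lmul_arg[OF clinear_ident]])
  qed
  moreover have "slice_l (\<lambda>n. f (r * lmul n q)) w = M"
    by (simp add: w' M_def functional_lmul_linear f clinear_sum[OF clinear_slice_l])
  ultimately show ?thesis by (simp add: almost_periodic_def)
qed

text \<open>As f is arbitrary, r m q = 0 in A for all r and q; nondegeneracy removes r and then
  q.\<close>

lemma multiplier_functionals_separate: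
  assumes "\<And>f r q. clinear f \<Longrightarrow> (f :: 'a \<Rightarrow> complex) (r * lmul m q) = 0"
  shows "m = 0"
proof (rule multiplier_lmul_zeroD[OF nd], rule nondegenerate_eqI(2)[OF nd])
  fix q r :: 'a
  have "r * lmul m q = 0" by (rule functionals_separate) (rule assms)
  then show "r * lmul m q = r * 0" by simp
qed

text \<open>The slice criterion is used twice. The right slices put the left legs in AP, with right
  legs still unrestricted. After a flip those legs are on the right and are kept there by the
  criterion, while the left slices of w treat the other side.\<close>

lemma comultiplication_AP:
  assumes w: "mult_tensor w = \<delta>M x"
  shows "w \<in> tensor_set AP AP"
proof -
  define \<Phi> where "\<Phi> = {\<lambda>m. f (r * lmul m q) | (f :: 'a \<Rightarrow> complex) r q. clinear f}"
  have \<Phi>: "clinear \<phi>" if "\<phi> \<in> \<Phi>" for \<phi>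
    using that functional_lmul_linear unfolding \<Phi>_def by blast
  have sep: "m = 0" if "\<And>\<phi>. \<phi> \<in> \<Phi> \<Longrightarrow> \<phi> m = 0" for m
    by (rule multiplier_functionals_separate, rule that) (auto simp: \<Phi>_def)
  have w1: "w \<in> tensor_set AP UNIV"
  proof (rule tensor_set_if_slices[where \<Phi> = \<Phi>])
    show "slice_r \<phi> w \<in> AP" if "\<phi> \<in> \<Phi>" for \<phi>
      using that slice_r_almost_periodic[OF w] by (auto simp: \<Phi>_def)
  qed (fact tensor_set_UNIV AP_subspace cvec.subspace_UNIV \<Phi> sep)+
  have "tensor_flip w \<in> tensor_set AP AP"
  proof (rule tensor_set_if_slices[where \<Phi> = \<Phi>])
    show "tensor_flip w \<in> tensor_set UNIV AP" by (rule flip_tensor_set[OF w1])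
    show "slice_r \<phi> (tensor_flip w) \<in> AP" if "\<phi> \<in> \<Phi>" for \<phi>
      using that slice_l_almost_periodic[OF w] by (auto simp: \<Phi>_def slice_r_flip functional_lmul_linear)
  qed (fact AP_subspace \<Phi> sep)+
  from flip_tensor_set[OF this] show ?thesis by simp
qed

text \<open>The preimages of \<delta> x are prescribed on a basis of AP only and extended linearly
  to M(A). The result is linear on a whole type, as lifts require; outside AP its values carry no
  information.\<close>

lemma comultiplication_exists:
  obtains D :: "'a multiplier \<Rightarrow> 'a multiplier \<otimes>\<^sub>t 'a multiplier"
  where "clinear D" "\<And>x. x \<in> AP \<Longrightarrow> mult_tensor (D x) = \<delta>M x"
proof -
  obtain B where B: "B \<subseteq> AP" "cvec.independent B" "AP \<subseteq> cvec.span B"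
    by (rule cvec.maximal_independent_subset)
  obtain D :: "'a multiplier \<Rightarrow> 'a multiplier \<otimes>\<^sub>t 'a multiplier"
    where D: "clinear D" "\<forall>x\<in>B. D x = inv_into UNIV mult_tensor (\<delta>M x)"
    using clinear_independent_extend[OF B(2), of "\<lambda>x. inv_into UNIV mult_tensor (\<delta>M x)"] by blast
  have "mult_tensor (D x) = \<delta>M x" if "x \<in> AP" for x
  proof (rule vector_space_pair.linear_eq_on[OF vector_space_pair_scaleC, of "\<lambda>x. mult_tensor (D x)" \<delta>M x B])
    show "clinear (\<lambda>x. mult_tensor (D x))" by (intro mult_clinear_intros D(1))
    show "x \<in> cvec.span B" using that B(3) by blast
    show "mult_tensor (D b) = \<delta>M b" if "b \<in> B" for b
      using that B(1) D(2) by (auto simp: almost_periodic_def intro!: f_inv_into_f)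
  qed (rule \<delta>M_linear)
  then show ?thesis by (rule that[OF D(1)])
qed

text \<open>The difference of both sides is tested with m \<mapsto> a m s on the first leg and w
  \<mapsto> w (t \<otimes> q) on the other two. These maps separate points, and each test is an
  instance of \<open>coassociativity_multiplier\<close>.\<close>

lemma comultiplication_coassociative:
  assumes D: "clinear D" "\<And>x. x \<in> AP \<Longrightarrow> mult_tensor (D x) = \<delta>M x" and x: "x \<in> AP"
  shows "tensor_assoc (tensor_map D id (D x)) = tensor_map id D (D x)"
proof -
  obtain k m n where mn: "\<And>i. i < k \<Longrightarrow> m i \<in> AP" "\<And>i. i < k \<Longrightarrow> n i \<in> AP"
    and Dx: "D x = (\<Sum>i<k::nat. m i \<otimes>\<^sub>t n i)"
    using tensor_set_sumE[OF comultiplication_AP[OF D(2)[OF x]] AP_subspace] by blast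
  have \<delta>x: "\<delta>M x = (\<Sum>i<k. mtens (m i) (n i))"
    by (simp add: D(2)[OF x, symmetric] Dx clinear_sum[OF clinear_mult_tensor] mult_tensor_tens)
  have "tensor_assoc (tensor_map D id (D x)) - tensor_map id D (D x) = 0"
  proof (rule tensor_map_separating[of "range (\<lambda>(a, s) m. a * lmul m s)"
        "range (\<lambda>(t, q) w. lmul (mult_tensor w) (t \<otimes>\<^sub>t q))"])
    show "m = 0" if "\<And>f. f \<in> range (\<lambda>(a, s) m. a * lmul m s) \<Longrightarrow> f m = 0" for m :: "'a multiplier"
    proof (rule multiplier_functionals_separate)
      fix f :: "'a \<Rightarrow> complex" and r q assume "clinear f"
      moreover have "r * lmul m q = 0" by (rule that) auto
      ultimately show "f (r * lmul m q) = 0" by (simp add: clinear_zero)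
    qed
    show "w = 0" if *: "\<And>g. g \<in> range (\<lambda>(t, q) w. lmul (mult_tensor w) (t \<otimes>\<^sub>t q)) \<Longrightarrow> g w = 0"
      for w :: "'a multiplier \<otimes>\<^sub>t 'a multiplier"
    proof (rule mult_tensor_eq_0D[OF nd nd], rule multiplier_lmul_zeroD[OF nd2])
      have "lmul (mult_tensor w) (t \<otimes>\<^sub>t q) = 0" for t q by (rule *) auto
      then show "lmul (mult_tensor w) z = 0" for z
        by (induction z rule: tens_induct) (simp_all add: clinear_add[OF lmul_linear])
    qed
    show "clinear f" if "f \<in> range (\<lambda>(a, s) (m :: 'a multiplier). a * lmul m s)" for f
      using that by (auto intro!: clinear_times_left clinear_lmul_arg clinear_ident)
    show "clinear g" if "g \<in> range (\<lambda>(t, q) w. lmul (mult_tensor w) (t \<otimes>\<^sub>t (q :: 'a) :: 'a \<otimes>\<^sub>t 'a))" for g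
      using that by (auto intro!: clinear_lmul_arg clinear_mult_tensor)
    fix f g assume "f \<in> range (\<lambda>(a, s) (m :: 'a multiplier). a * lmul m s)"
      and "g \<in> range (\<lambda>(t, q) w. lmul (mult_tensor w) (t \<otimes>\<^sub>t (q :: 'a) :: 'a \<otimes>\<^sub>t 'a))"
    then obtain a s t q where fg: "f = (\<lambda>m. a * lmul m s)" "g = (\<lambda>w. lmul (mult_tensor w) (t \<otimes>\<^sub>t q))"
      by auto
    have lin: "clinear f" "clinear g"
      unfolding fg by (intro mult_clinear_intros)+
    have assoc: "tensor_map f g (tensor_assoc (u \<otimes>\<^sub>t y)) =
        tensor_assoc (lmul (mtens (mult_of a) 1) (lmul (mult_tensor u) (s \<otimes>\<^sub>t t)) \<otimes>\<^sub>t lmul y q)" for u y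
      by (rule clinear_eq_tensI[of "\<lambda>u. tensor_map f g (tensor_assoc (u \<otimes>\<^sub>t y))"
          "\<lambda>u. tensor_assoc (lmul (mtens (mult_of a) 1) (lmul (mult_tensor u) (s \<otimes>\<^sub>t t)) \<otimes>\<^sub>t lmul y q)"])
        ((intro mult_clinear_intros lin)+, simp add: tensor_assoc_tens lin, simp add: fg mult_tensor_tens tensor_assoc_tens)
    have "tensor_map f g (tensor_assoc (tensor_map D id (D x))) = tensor_map f g (tensor_map id D (D x))"
      using coassociativity_multiplier[OF \<delta>x, of a s t q] mn
      by (simp add: Dx clinear_sum[OF clinear_tensor_map] lin D id_clinear clinear_sum[OF clinear_assoc] assoc,
          simp add: fg D(2))
    then show "tensor_map f g (tensor_assoc (tensor_map D id (D x)) - tensor_map id D (D x)) = 0"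
      by (simp add: clinear_diff[OF clinear_tensor_map[OF lin]])
  qed
  then show ?thesis by simp
qed

end

section \<open>Convolution\<close>

text \<open>Moves products and homomorphisms in and out of the sums over the legs of a
  coproduct.\<close>

lemma clinear_tensor_lift_out:
  assumes "clinear F" "cbilinear \<beta>"
  shows "F (tensor_lift \<beta> z) = tensor_lift (\<lambda>a b. F (\<beta> a b)) z"
proof -
  have b: "cbilinear (\<lambda>a b. F (\<beta> a b))"
    unfolding cbilinear_iff_clinear
    by (intro conjI allI clinear_compose[OF _ assms(1)]
        assms(2)[unfolded cbilinear_iff_clinear, THEN conjunct1, THEN spec]
        assms(2)[unfolded cbilinear_iff_clinear, THEN conjunct2, THEN spec])
  show ?thesis
    by (rule clinear_eq_tensI[of "\<lambda>z. F (tensor_lift \<beta> z)"])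
      (simp_all add: b assms clinear_tensor_lift clinear_compose[OF clinear_tensor_lift])
qed

text \<open>\<open>tensor_lift \<beta> (D x)\<close> plays the part of the Sweedler sum of
  \<beta>(x1, x2). The map D is linear everywhere, but its coalgebra properties are confined to
  P.\<close>

locale coassociative_on =
  fixes D :: "'v::complex_vector \<Rightarrow> 'v \<otimes>\<^sub>t 'v" and P :: "'v set"
  assumes P: "cvec.subspace P" and D_linear: "clinear D"
    and D_in: "x \<in> P \<Longrightarrow> D x \<in> tensor_set P P"
    and D_coassoc: "x \<in> P \<Longrightarrow> tensor_assoc (tensor_map D id (D x)) = tensor_map id D (D x)"
begin

text \<open>Both legs of D x can be taken in P, so identities valid on P only may be used under the
  Sweedler sum.\<close>

lemma tensor_lift_D_cong:
  assumes x: "x \<in> P" and "cbilinear \<beta>" "cbilinear \<beta>'" "\<And>a b. a \<in> P \<Longrightarrow> b \<in> P \<Longrightarrow> \<beta> a b = \<beta>' a b"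
  shows "tensor_lift \<beta> (D x) = tensor_lift \<beta>' (D x)"
proof -
  obtain k m n where "\<And>i. i < k \<Longrightarrow> m i \<in> P" "\<And>i. i < k \<Longrightarrow> n i \<in> P" "D x = (\<Sum>i<k::nat. m i \<otimes>\<^sub>t n i)"
    using tensor_set_sumE[OF D_in[OF x] P] by blast
  then show ?thesis by (simp add: assms clinear_sum[OF clinear_tensor_lift])
qed

text \<open>The two bracketings of the Sweedler sum of t(x1, x2, x3). The arguments a, c, b of t are
  in the order of the legs.\<close>

lemma coassociative_trilinear:
  assumes x: "x \<in> P" and t: "\<And>a c. clinear (\<lambda>b. t a c b)" "\<And>a b. clinear (\<lambda>c. t a c b)"
    "\<And>c b. clinear (\<lambda>a. t a c b)"
  shows "tensor_lift (\<lambda>a y. tensor_lift (\<lambda>c b. t a c b) (D y)) (D x) =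
    tensor_lift (\<lambda>y b. tensor_lift (\<lambda>a c. t a c b) (D y)) (D x)"
proof -
  have b1: "cbilinear (\<lambda>c b. t a c b)" and b2: "cbilinear (\<lambda>a c. t a c b)" for a b
    unfolding cbilinear_iff_clinear by (simp_all add: t)
  have b3: "cbilinear (\<lambda>a v. tensor_lift (\<lambda>c b. t a c b) v)"
    unfolding cbilinear_iff_clinear
    by (intro conjI allI clinear_tensor_lift_param clinear_tensor_lift b1 t)
  have b4: "cbilinear (\<lambda>a y. tensor_lift (\<lambda>c b. t a c b) (D y))"
    by (subst cbilinear_iff_clinear)
      (intro conjI allI clinear_tensor_lift_param clinear_tensor_lift_arg b1 t D_linear)
  have b5: "cbilinear (\<lambda>y b. tensor_lift (\<lambda>a c. t a c b) (D y))"
    by (subst cbilinear_iff_clinear)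
      (intro conjI allI clinear_tensor_lift_param clinear_tensor_lift_arg b2 t D_linear)
  define T where "T = tensor_lift (\<lambda>a v. tensor_lift (\<lambda>c b. t a c b) v)"
  have T_linear: "clinear T" unfolding T_def by (rule clinear_tensor_lift[OF b3])
  have l: "T (tensor_map id D w) = tensor_lift (\<lambda>a y. tensor_lift (\<lambda>c b. t a c b) (D y)) w" for w
    by (rule clinear_eq_tensI[OF clinear_compose[OF clinear_tensor_map[OF id_clinear D_linear] T_linear]
          clinear_tensor_lift[OF b4]])
      (simp add: T_def id_clinear D_linear b3 b4)
  have T_assoc: "T (tensor_assoc (u \<otimes>\<^sub>t b)) = tensor_lift (\<lambda>a c. t a c b) u" for u b
    by (rule clinear_eq_tensI[of "\<lambda>u. T (tensor_assoc (u \<otimes>\<^sub>t b))"])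
      ((intro clinear_compose[OF _ T_linear] clinear_tensor_lift b2 clinear_intros)+,
        simp add: tensor_assoc_tens T_def b1 b2 b3)
  have r: "T (tensor_assoc (tensor_map D id w)) = tensor_lift (\<lambda>y b. tensor_lift (\<lambda>a c. t a c b) (D y)) w" for w
    by (rule clinear_eq_tensI[of "\<lambda>w. T (tensor_assoc (tensor_map D id w))"])
      ((intro clinear_compose[OF _ T_linear] clinear_tensor_lift b5 clinear_intros D_linear)+,
        simp add: id_clinear D_linear b5 T_assoc)
  show ?thesis using D_coassoc[OF x] by (metis l r)
qed

text \<open>The usual f = f * (g * h) = (f * g) * h = h in the convolution algebra. Allowing two
  units e and e', each with the one counit law that its end of the chain uses, avoids proving them
  equal.\<close>

lemma convolution_inverse_unique:
  fixes f g h :: "'v \<Rightarrow> 'b::{complex_algebra, monoid_mult}"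
  assumes lin: "clinear f" "clinear g" "clinear h" "clinear e" "clinear e'"
    and fg: "\<And>x. x \<in> P \<Longrightarrow> tensor_lift (\<lambda>a b. f a * g b) (D x) = e x *\<^sub>C 1"
    and gh: "\<And>x. x \<in> P \<Longrightarrow> tensor_lift (\<lambda>a b. g a * h b) (D x) = e' x *\<^sub>C 1"
    and e: "\<And>x. x \<in> P \<Longrightarrow> tensor_lift (\<lambda>a b. e a *\<^sub>C b) (D x) = x"
    and e': "\<And>x. x \<in> P \<Longrightarrow> tensor_lift (\<lambda>a b. e' b *\<^sub>C a) (D x) = x"
    and x: "x \<in> P"
  shows "f x = h x"
proof -
  note rules = clinear_scale clinear_scale_vec clinear_times_left clinear_times_right lin
    clinear_ident clinear_compose[OF _ lin(1)] clinear_compose[OF _ lin(2)] clinear_compose[OF _ lin(3)]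
  have b: "cbilinear (\<lambda>a b. f a * g b)" "cbilinear (\<lambda>a b. g a * h b)" "cbilinear (\<lambda>a y. e' y *\<^sub>C f a)"
    "cbilinear (\<lambda>y b. e y *\<^sub>C h b)" "cbilinear (\<lambda>a b. e a *\<^sub>C b)" "cbilinear (\<lambda>a b. e' b *\<^sub>C a)"
    "\<And>c. cbilinear (\<lambda>a b. f a * g b * c)" "\<And>c. cbilinear (\<lambda>a b. c * (g a * h b))"
    unfolding cbilinear_iff_clinear by (intro conjI allI rules)+
  have b1: "cbilinear (\<lambda>a y. f a * tensor_lift (\<lambda>c b. g c * h b) (D y))"
    by (subst cbilinear_iff_clinear)
      (intro conjI allI clinear_times_left clinear_times_right lin clinear_tensor_lift_arg D_linear b)
  have b2: "cbilinear (\<lambda>y b. tensor_lift (\<lambda>a c. f a * g c) (D y) * h b)"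
    by (subst cbilinear_iff_clinear)
      (intro conjI allI clinear_times_left clinear_times_right lin clinear_tensor_lift_arg D_linear b)
  have "f x = tensor_lift (\<lambda>a y. e' y *\<^sub>C f a) (D x)"
    using arg_cong[OF e'[OF x], of f] by (simp add: clinear_tensor_lift_out lin b clinear_scaleC)
  also have "\<dots> = tensor_lift (\<lambda>a y. f a * tensor_lift (\<lambda>c b. g c * h b) (D y)) (D x)"
    by (rule tensor_lift_D_cong[OF x b(3) b1]) (simp add: gh mult_scaleC_right)
  also have "\<dots> = tensor_lift (\<lambda>a y. tensor_lift (\<lambda>c b. f a * (g c * h b)) (D y)) (D x)"
    by (simp add: clinear_tensor_lift_out[OF clinear_mult_left b(2)])
  also have "\<dots> = tensor_lift (\<lambda>y b. tensor_lift (\<lambda>a c. f a * (g c * h b)) (D y)) (D x)"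
    by (rule coassociative_trilinear[OF x]) (intro rules)+
  also have "\<dots> = tensor_lift (\<lambda>y b. tensor_lift (\<lambda>a c. f a * g c) (D y) * h b) (D x)"
    by (simp add: clinear_tensor_lift_out[OF clinear_mult_right b(1)] mult.assoc)
  also have "\<dots> = tensor_lift (\<lambda>y b. e y *\<^sub>C h b) (D x)"
    by (rule tensor_lift_D_cong[OF x b2 b(4)]) (simp add: fg mult_scaleC_left)
  also have "\<dots> = h x"
    using arg_cong[OF e[OF x], of h] by (simp add: clinear_tensor_lift_out lin b clinear_scaleC)
  finally show ?thesis .
qed

end

section \<open>Counit and coinverse on almost periodic elements\<close>

locale multiplier_Hopf_star_extension = multiplier_Hopf_extension \<delta> \<delta>M
  for \<delta> :: "'a::complex_star_algebra \<Rightarrow> ('a \<otimes>\<^sub>t 'a) multiplier" and \<delta>M +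
  fixes \<epsilon> :: "'a \<Rightarrow> complex" and \<kappa> :: "'a \<Rightarrow> 'a multiplier" and \<kappa>M :: "'a multiplier \<Rightarrow> 'a multiplier"
  assumes \<delta>_star: "\<delta> (star a) = star (\<delta> a)"
    and counit: "counit \<delta> \<epsilon>" and coinverse: "coinverse \<delta> \<epsilon> \<kappa>" and \<kappa>_ext: "antihom_extension \<kappa> \<kappa>M"
begin

section \<open>Counit and coinverse identities on A\<close>

lemma \<epsilon>_linear: "clinear \<epsilon>" and \<epsilon>_times: "\<epsilon> (a * b) = \<epsilon> a * \<epsilon> b"
  using counit by (auto simp: counit_def alg_hom_def)

lemma slice_r_T2: "slice_r \<epsilon> (T2 \<delta> (a \<otimes>\<^sub>t b)) = a * b"
  and slice_l_T1: "slice_l \<epsilon> (T1 \<delta> (a \<otimes>\<^sub>t b)) = a * b"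
  using counit by (auto simp: counit_def slice_r_def slice_l_def)

lemma \<kappa>_linear: "clinear \<kappa>"
  using coinverse by (auto simp: coinverse_def alg_antihom_def)

lemma \<kappa>M_linear: "clinear \<kappa>M" and \<kappa>M_times: "\<kappa>M (x * y) = \<kappa>M y * \<kappa>M x"
  and \<kappa>M_one: "\<kappa>M 1 = 1" and \<kappa>M_mult_of: "\<kappa>M (mult_of a) = \<kappa> a"
  using \<kappa>_ext by (auto simp: antihom_extension_def alg_antihom_def)

lemma \<kappa>_lmul: "\<kappa> (lmul x a) = \<kappa> a * \<kappa>M x" and \<kappa>_rmul: "\<kappa> (rmul a x) = \<kappa>M x * \<kappa> a"
  by (simp_all add: \<kappa>M_mult_of[symmetric] multiplier_mult_of[OF nd, symmetric] \<kappa>M_times)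

lemma bilinear_id_\<kappa>: "cbilinear (\<lambda>p q. mult_of p * \<kappa> q)"
  and bilinear_\<kappa>_id: "cbilinear (\<lambda>p q. \<kappa> p * mult_of q)"
  and bilinear_id_\<kappa>M: "cbilinear (\<lambda>m n. m * \<kappa>M n)"
  and bilinear_\<kappa>M_id: "cbilinear (\<lambda>m n. \<kappa>M m * n)"
  and bilinear_times: "cbilinear ((*) :: 'a multiplier \<Rightarrow> _)"
  unfolding cbilinear_iff_clinear
  by (intro conjI allI mult_clinear_intros \<kappa>_linear \<kappa>M_linear clinear_mult_of)+

definition id_\<kappa> :: "'a \<otimes>\<^sub>t 'a \<Rightarrow> 'a multiplier" where "id_\<kappa> = tensor_lift (\<lambda>p q. mult_of p * \<kappa> q)"
definition \<kappa>_id :: "'a \<otimes>\<^sub>t 'a \<Rightarrow> 'a multiplier" where "\<kappa>_id = tensor_lift (\<lambda>p q. \<kappa> p * mult_of q)"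

lemma id_\<kappa>_linear: "clinear id_\<kappa>" and id_\<kappa>_tens: "id_\<kappa> (p \<otimes>\<^sub>t q) = mult_of p * \<kappa> q"
  by (simp_all add: id_\<kappa>_def bilinear_id_\<kappa> clinear_tensor_lift)

lemma \<kappa>_id_linear: "clinear \<kappa>_id" and \<kappa>_id_tens: "\<kappa>_id (p \<otimes>\<^sub>t q) = \<kappa> p * mult_of q"
  by (simp_all add: \<kappa>_id_def bilinear_\<kappa>_id clinear_tensor_lift)

text \<open>The coinverse axiom carries an extra right factor c because \<kappa> has values in M(A);
  nondegeneracy cancels it.\<close>

lemma id_\<kappa>_T2: "id_\<kappa> (T2 \<delta> (a \<otimes>\<^sub>t b)) = \<epsilon> b *\<^sub>C mult_of a"
proof (rule multiplier_cancel_right[OF nd])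
  fix c
  have eq: "tensor_lift (*) (tensor_map mult_of \<kappa> z * (1 \<otimes>\<^sub>t mult_of c)) = id_\<kappa> z * mult_of c" for z
    by (rule clinear_eq_tensI[of "\<lambda>z. tensor_lift (*) (tensor_map mult_of \<kappa> z * (1 \<otimes>\<^sub>t mult_of c))"])
      ((intro mult_clinear_intros bilinear_times clinear_mult_of \<kappa>_linear id_\<kappa>_linear)+,
        simp add: clinear_mult_of \<kappa>_linear tens_times_tens bilinear_times id_\<kappa>_tens mult.assoc)
  have "tensor_lift (*) (tensor_map mult_of \<kappa> (T2 \<delta> (a \<otimes>\<^sub>t b)) * (1 \<otimes>\<^sub>t mult_of c)) = mult_of (\<epsilon> b *\<^sub>C (a * c))"
    using coinverse unfolding coinverse_def by blast
  then show "id_\<kappa> (T2 \<delta> (a \<otimes>\<^sub>t b)) * mult_of c = \<epsilon> b *\<^sub>C mult_of a * mult_of c"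
    by (simp add: eq mult_of_times mult_scaleC_left)
qed

lemma \<kappa>_id_T1: "\<kappa>_id (T1 \<delta> (b \<otimes>\<^sub>t c)) = \<epsilon> b *\<^sub>C mult_of c"
proof (rule multiplier_cancel_left[OF nd])
  fix a
  have eq: "tensor_lift (*) ((mult_of a \<otimes>\<^sub>t 1) * tensor_map \<kappa> mult_of z) = mult_of a * \<kappa>_id z" for z
    by (rule clinear_eq_tensI[of "\<lambda>z. tensor_lift (*) ((mult_of a \<otimes>\<^sub>t 1) * tensor_map \<kappa> mult_of z)"])
      ((intro mult_clinear_intros bilinear_times clinear_mult_of \<kappa>_linear \<kappa>_id_linear)+,
        simp add: clinear_mult_of \<kappa>_linear tens_times_tens bilinear_times \<kappa>_id_tens mult.assoc)
  have "tensor_lift (*) ((mult_of a \<otimes>\<^sub>t 1) * tensor_map \<kappa> mult_of (T1 \<delta> (b \<otimes>\<^sub>t c))) = mult_of (\<epsilon> b *\<^sub>C (a * c))"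
    using coinverse unfolding coinverse_def by blast
  then show "mult_of a * \<kappa>_id (T1 \<delta> (b \<otimes>\<^sub>t c)) = mult_of a * (\<epsilon> b *\<^sub>C mult_of c)"
    by (simp add: eq mult_of_times mult_scaleC_right)
qed

text \<open>If some \<epsilon>(b) is nonzero, it is divided out and c is cancelled. The remaining
  case is \<epsilon> = 0, where the counit law makes all products in A vanish and every multiplier
  is then 0.\<close>

lemma counit_cancel:
  fixes Y :: "'a multiplier"
  shows "(\<And>b c. \<epsilon> b *\<^sub>C (Y * mult_of c) = 0) \<Longrightarrow> Y = 0"
    and "(\<And>b c. \<epsilon> b *\<^sub>C (mult_of c * Y) = 0) \<Longrightarrow> Y = 0"
proof -
  have "Y = 0" if "\<And>b. \<epsilon> b = 0"
  proof -
    have slice: "slice_l \<epsilon> z = 0" for z :: "'a \<otimes>\<^sub>t 'a"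
      by (rule clinear_eq_tensI[of "slice_l \<epsilon>" "\<lambda>_. 0"])
        (simp_all add: clinear_slice_l \<epsilon>_linear that clinear_const_zero)
    have zero: "a * b = 0" for a b :: 'a
      unfolding slice_l_T1[symmetric] by (rule slice)
    have "lmul Y a = 0" for a
      by (rule nondegenerate_eqI(1)[OF nd]) (simp add: zero)
    then show ?thesis by (rule multiplier_lmul_zeroD[OF nd])
  qed
  then show "Y = 0" if "\<And>b c. \<epsilon> b *\<^sub>C (Y * mult_of c) = 0"
    using that multiplier_cancel_right[OF nd, of Y 0] by (auto simp: cvec.scale_eq_0_iff)
  show "Y = 0" if "\<And>b c. \<epsilon> b *\<^sub>C (mult_of c * Y) = 0"
    using that \<open>(\<And>b. \<epsilon> b = 0) \<Longrightarrow> Y = 0\<close> multiplier_cancel_left[OF nd, of Y 0]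
    by (auto simp: cvec.scale_eq_0_iff)
qed

text \<open>The extension is e(x) = \<epsilon>(x b) / \<epsilon>(b) for any b with \<epsilon>(b)
  \<noteq> 0; if \<epsilon> = 0, the zero functional will do.\<close>

lemma counit_extension_exists:
  obtains e :: "'a multiplier \<Rightarrow> complex"
  where "clinear e" "\<And>x a. \<epsilon> (lmul x a) = e x * \<epsilon> a" "\<And>x a. \<epsilon> (rmul a x) = e x * \<epsilon> a"
proof (cases "\<forall>b. \<epsilon> b = 0")
  case True
  show ?thesis by (rule that[of "\<lambda>_. 0"]) (simp_all add: True clinearI)
next
  case False
  then obtain b where b: "\<epsilon> b \<noteq> 0" by blast
  \<comment> \<open>Multiplicativity applied to (c x) a = c (x a). It shows that the quotient does
    not depend on b and serves the left and the right action alike.\<close>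
  have eq: "\<epsilon> (rmul c x) * \<epsilon> a = \<epsilon> c * \<epsilon> (lmul x a)" for a c x
    by (simp add: \<epsilon>_times[symmetric] rmul_lmul)
  have b_eq: "\<epsilon> (rmul b x) = \<epsilon> (lmul x b)" for x
    using eq[of b x b] b by simp
  show ?thesis
  proof (rule that[of "\<lambda>x. \<epsilon> (lmul x b) / \<epsilon> b"])
    show "clinear (\<lambda>x. \<epsilon> (lmul x b) / \<epsilon> b)"
      by (rule clinearI)
        (simp_all add: clinear_add[OF \<epsilon>_linear] clinear_scaleC[OF \<epsilon>_linear] add_divide_distrib scaleC_complex_def)
    show "\<epsilon> (lmul x a) = \<epsilon> (lmul x b) / \<epsilon> b * \<epsilon> a" for x a
      using eq[of b x a] b by (simp add: b_eq field_simps)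
    show "\<epsilon> (rmul a x) = \<epsilon> (lmul x b) / \<epsilon> b * \<epsilon> a" for x a
      using eq[of a x b] b by (simp add: field_simps)
  qed
qed

context
  fixes e :: "'a multiplier \<Rightarrow> complex" and x :: "'a multiplier" and w
  assumes e_linear: "clinear e" and e_lmul: "\<And>x a. \<epsilon> (lmul x a) = e x * \<epsilon> a"
    and e_rmul: "\<And>x a. \<epsilon> (rmul a x) = e x * \<epsilon> a"
    and w: "mult_tensor w = \<delta>M x"
begin

text \<open>Write y for the left side. Applying \<open>id_\<kappa>\<close> to (p \<otimes> q)
  \<delta>(x) gives p y \<kappa>(q) by antimultiplicativity, and e(x) p \<kappa>(q) by surjectivity
  of T2. It remains to cancel p and \<kappa>(q).\<close>

lemma antipode_right: "tensor_lift (\<lambda>m n. m * \<kappa>M n) w = e x *\<^sub>C 1"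
proof -
  let ?y = "tensor_lift (\<lambda>m n. m * \<kappa>M n) w"
  have 1: "id_\<kappa> (rmul (p \<otimes>\<^sub>t q) (mult_tensor w)) = mult_of p * tensor_lift (\<lambda>m n. m * \<kappa>M n) w * \<kappa> q" for p q w
    by (rule clinear_eq_tensI[of "\<lambda>w. id_\<kappa> (rmul (p \<otimes>\<^sub>t q) (mult_tensor w))"])
      ((intro clinear_compose[OF _ id_\<kappa>_linear] mult_clinear_intros bilinear_id_\<kappa>M)+,
        simp add: mult_tensor_tens id_\<kappa>_tens \<kappa>_rmul bilinear_id_\<kappa>M multiplier_mult_of(2)[OF nd, symmetric] mult.assoc)
  have 2: "id_\<kappa> (rmul z (\<delta>M x)) = e x *\<^sub>C id_\<kappa> z" for z
    by (rule T2_eqI[of "\<lambda>z. id_\<kappa> (rmul z (\<delta>M x))"])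
      ((intro clinear_compose[OF _ id_\<kappa>_linear] id_\<kappa>_linear mult_clinear_intros)+,
        simp add: T2_rmul[symmetric] id_\<kappa>_T2 e_rmul scaleC_scaleC)
  have "?y * \<kappa> q = e x *\<^sub>C \<kappa> q" for q
    by (rule multiplier_cancel_left[OF nd])
      (use 1[of _ q w] 2[of "_ \<otimes>\<^sub>t q"] in \<open>simp add: w id_\<kappa>_tens mult.assoc mult_scaleC_right\<close>)
  then have "(?y - e x *\<^sub>C 1) * \<kappa> q = 0" for q
    by (simp add: left_diff_distrib mult_scaleC_left)
  \<comment> \<open>The elements \<kappa>(q) are not known to have the cancellation property by
    themselves. The other coinverse identity helps: suitable sums of \<kappa>(p) q are \<epsilon>(b)
    c.\<close>
  then have "(?y - e x *\<^sub>C 1) * \<kappa>_id (p \<otimes>\<^sub>t q) = 0" for p q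
    by (simp add: \<kappa>_id_tens mult.assoc[symmetric])
  then have "(?y - e x *\<^sub>C 1) * \<kappa>_id z = 0" for z
    using clinear_eq_tensI[of "\<lambda>z. (?y - e x *\<^sub>C 1) * \<kappa>_id z" "\<lambda>_. 0" z, OF clinear_times_left[OF \<kappa>_id_linear] clinear_const_zero]
    by blast
  from this[of "T1 \<delta> (_ \<otimes>\<^sub>t _)"] have "\<epsilon> b *\<^sub>C ((?y - e x *\<^sub>C 1) * mult_of c) = 0" for b c
    by (simp add: \<kappa>_id_T1 mult_scaleC_right)
  then have "?y - e x *\<^sub>C 1 = 0" by (rule counit_cancel(1))
  then show ?thesis by simp
qed

text \<open>The mirror argument: T1 supplies the computation and the coinverse identity for T2
  supplies the cancellation of \<kappa>(p).\<close>

lemma antipode_left: "tensor_lift (\<lambda>m n. \<kappa>M m * n) w = e x *\<^sub>C 1"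
proof -
  let ?y = "tensor_lift (\<lambda>m n. \<kappa>M m * n) w"
  have 1: "\<kappa>_id (lmul (mult_tensor w) (p \<otimes>\<^sub>t q)) = \<kappa> p * tensor_lift (\<lambda>m n. \<kappa>M m * n) w * mult_of q" for p q w
    by (rule clinear_eq_tensI[of "\<lambda>w. \<kappa>_id (lmul (mult_tensor w) (p \<otimes>\<^sub>t q))"])
      ((intro clinear_compose[OF _ \<kappa>_id_linear] mult_clinear_intros bilinear_\<kappa>M_id)+,
        simp add: mult_tensor_tens \<kappa>_id_tens \<kappa>_lmul bilinear_\<kappa>M_id multiplier_mult_of(1)[OF nd, symmetric] mult.assoc)
  have 2: "\<kappa>_id (lmul (\<delta>M x) z) = e x *\<^sub>C \<kappa>_id z" for z
    by (rule T1_eqI[of "\<lambda>z. \<kappa>_id (lmul (\<delta>M x) z)"])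
      ((intro clinear_compose[OF _ \<kappa>_id_linear] \<kappa>_id_linear mult_clinear_intros)+,
        simp add: T1_lmul[symmetric] \<kappa>_id_T1 e_lmul scaleC_scaleC)
  have "\<kappa> p * ?y = e x *\<^sub>C \<kappa> p" for p
    by (rule multiplier_cancel_right[OF nd])
      (use 1[of w p] 2[of "p \<otimes>\<^sub>t _"] in \<open>simp add: w \<kappa>_id_tens mult.assoc mult_scaleC_left\<close>)
  then have "\<kappa> p * (?y - e x *\<^sub>C 1) = 0" for p
    by (simp add: right_diff_distrib mult_scaleC_right)
  then have "id_\<kappa> (p \<otimes>\<^sub>t q) * (?y - e x *\<^sub>C 1) = 0" for p q
    by (simp add: id_\<kappa>_tens mult.assoc)
  then have "id_\<kappa> z * (?y - e x *\<^sub>C 1) = 0" for z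
    using clinear_eq_tensI[of "\<lambda>z. id_\<kappa> z * (?y - e x *\<^sub>C 1)" "\<lambda>_. 0" z, OF clinear_times_right[OF id_\<kappa>_linear] clinear_const_zero]
    by blast
  from this[of "T2 \<delta> (_ \<otimes>\<^sub>t _)"] have "\<epsilon> b *\<^sub>C (mult_of c * (?y - e x *\<^sub>C 1)) = 0" for b c
    by (simp add: id_\<kappa>_T2 mult_scaleC_left)
  then have "?y - e x *\<^sub>C 1 = 0" by (rule counit_cancel(2))
  then show ?thesis by simp
qed

text \<open>Slicing \<delta>(x) T1(a \<otimes> b) = T1(x a \<otimes> b) by \<epsilon> in the first
  leg gives the sum of e(m) n applied to a b on one side and (x a) b on the other.\<close>

lemma counit_left: "tensor_lift (\<lambda>m n. e m *\<^sub>C n) w = x"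
proof -
  have b: "cbilinear (\<lambda>m (n :: 'a multiplier). e m *\<^sub>C n)" by (rule slice_bilinear(2)[OF e_linear])
  have 0: "slice_l \<epsilon> (lmul (mult_tensor w) (p \<otimes>\<^sub>t q)) = \<epsilon> p *\<^sub>C lmul (tensor_lift (\<lambda>m n. e m *\<^sub>C n) w) q"
    for p q :: 'a and w
    by (rule clinear_eq_tensI[of "\<lambda>w. slice_l \<epsilon> (lmul (mult_tensor w) (p \<otimes>\<^sub>t q))"])
      ((intro clinear_compose[OF _ clinear_slice_l] \<epsilon>_linear mult_clinear_intros b)+,
        simp add: mult_tensor_tens b \<epsilon>_linear e_lmul scaleC_scaleC mult.commute)
  have 1: "slice_l \<epsilon> (lmul (mult_tensor w) z) = lmul (tensor_lift (\<lambda>m n. e m *\<^sub>C n) w) (slice_l \<epsilon> z)"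
    for z :: "'a \<otimes>\<^sub>t 'a" and w
    by (rule clinear_eq_tensI[of "\<lambda>z. slice_l \<epsilon> (lmul (mult_tensor w) z)"])
      ((intro clinear_compose[OF _ clinear_slice_l] \<epsilon>_linear mult_clinear_intros clinear_slice_l)+,
        simp add: 0 \<epsilon>_linear clinear_scaleC[OF lmul_linear])
  show ?thesis
  proof (rule multiplier_eq_lmulI[OF nd], rule nondegenerate_eqI(1)[OF nd])
    fix a b
    show "lmul (tensor_lift (\<lambda>m n. e m *\<^sub>C n) w) a * b = lmul x a * b"
      using 1[of w "T1 \<delta> (a \<otimes>\<^sub>t b)"] by (simp add: w T1_lmul[symmetric] slice_l_T1 lmul_times[OF nd])
  qed
qed

lemma counit_right: "tensor_lift (\<lambda>m n. e n *\<^sub>C m) w = x"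
proof -
  have b: "cbilinear (\<lambda>(m :: 'a multiplier) n. e n *\<^sub>C m)" by (rule slice_bilinear(1)[OF e_linear])
  have 0: "slice_r \<epsilon> (rmul (p \<otimes>\<^sub>t q) (mult_tensor w)) = \<epsilon> q *\<^sub>C rmul p (tensor_lift (\<lambda>m n. e n *\<^sub>C m) w)"
    for p q :: 'a and w
    by (rule clinear_eq_tensI[of "\<lambda>w. slice_r \<epsilon> (rmul (p \<otimes>\<^sub>t q) (mult_tensor w))"])
      ((intro clinear_compose[OF _ clinear_slice_r] \<epsilon>_linear mult_clinear_intros b)+,
        simp add: mult_tensor_tens b \<epsilon>_linear e_rmul scaleC_scaleC mult.commute)
  have 1: "slice_r \<epsilon> (rmul z (mult_tensor w)) = rmul (slice_r \<epsilon> z) (tensor_lift (\<lambda>m n. e n *\<^sub>C m) w)"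
    for z :: "'a \<otimes>\<^sub>t 'a" and w
    by (rule clinear_eq_tensI[of "\<lambda>z. slice_r \<epsilon> (rmul z (mult_tensor w))"])
      ((intro clinear_compose[OF _ clinear_slice_r] \<epsilon>_linear mult_clinear_intros clinear_slice_r)+,
        simp add: 0 \<epsilon>_linear clinear_scaleC[OF rmul_linear])
  \<comment> \<open>T2 tests multipliers through their right action, so equality is reached by
    cancelling an element of A on the left.\<close>
  have rmul_eq: "rmul b (tensor_lift (\<lambda>m n. e n *\<^sub>C m) w) = rmul b x" for b
  proof (rule nondegenerate_eqI(2)[OF nd])
    fix a
    show "a * rmul b (tensor_lift (\<lambda>m n. e n *\<^sub>C m) w) = a * rmul b x"
      using 1[of "T2 \<delta> (a \<otimes>\<^sub>t b)" w] by (simp add: w T2_rmul[symmetric] slice_r_T2 rmul_times[OF nd])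
  qed
  show ?thesis
    by (rule multiplier_cancel_left[OF nd]) (simp add: multiplier_mult_of[OF nd] rmul_eq)
qed

end

text \<open>The extension is only given as a unital homomorphism. Its compatibility with the star is
  seen on products with \<delta>(b), which lead back to \<delta> on A, and the elements \<delta>(b)
  (1 \<otimes> c) span A \<otimes> A.\<close>

lemma \<delta>M_star: "\<delta>M (star x) = star (\<delta>M x)"
proof (rule multiplier_eq_lmulI[OF nd2], rule T1_eqI[OF lmul_linear lmul_linear])
  fix b c
  have "star (\<delta>M x) * \<delta> b = star (\<delta> (star b) * \<delta>M x)"
    by (simp add: star_mult \<delta>_star star_star)
  also have "\<dots> = \<delta>M (star x) * \<delta> b"
    by (simp add: \<delta>_rmul[symmetric] \<delta>_star[symmetric] star_simps(1)[symmetric] \<delta>_lmul)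
  finally have "mult_of (lmul (\<delta>M (star x)) (T1 \<delta> (b \<otimes>\<^sub>t c))) = mult_of (lmul (star (\<delta>M x)) (T1 \<delta> (b \<otimes>\<^sub>t c)))"
    by (simp add: multiplier_mult_of(1)[OF nd2, symmetric] mult_of_T1_tens mult.assoc[symmetric])
  then show "lmul (\<delta>M (star x)) (T1 \<delta> (b \<otimes>\<^sub>t c)) = lmul (star (\<delta>M x)) (T1 \<delta> (b \<otimes>\<^sub>t c))"
    by (simp only: mult_of_inject[OF nd2])
qed

section \<open>Stability of AP under star, product and coinverse\<close>

lemma AP_star: "x \<in> AP \<Longrightarrow> star x \<in> AP"
  by (auto simp: almost_periodic_def \<delta>M_star star_mult_tensor)

lemma AP_unital_star_subalgebra: "unital_star_subalgebra AP"
  unfolding unital_star_subalgebra_def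
proof (intro conjI ballI)
  show "1 \<in> AP" by (simp add: almost_periodic_def \<delta>M_one one_in_range_mult_tensor)
  show "x * y \<in> AP" if "x \<in> AP" "y \<in> AP" for x y
    using that by (auto simp: almost_periodic_def \<delta>M_times mult_tensor_times[symmetric])
qed (auto intro: AP_subspace AP_star)

lemma \<kappa>M_AP: "\<kappa>M ` AP = AP"
proof -
  obtain D where D: "clinear D" "\<And>x. x \<in> AP \<Longrightarrow> mult_tensor (D x) = \<delta>M x"
    using comultiplication_exists by blast
  interpret coassociative_on D AP
  proof (rule coassociative_on.intro)
    show "D x \<in> tensor_set AP AP" if "x \<in> AP" for x
      by (rule comultiplication_AP[OF D(2)[OF that]])
    show "tensor_assoc (tensor_map D id (D x)) = tensor_map id D (D x)" if "x \<in> AP" for x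
      by (rule comultiplication_coassociative[OF D that])
  qed (fact AP_subspace D(1))+
  obtain e where e: "clinear e" "\<And>x a. \<epsilon> (lmul x a) = e x * \<epsilon> a" "\<And>x a. \<epsilon> (rmul a x) = e x * \<epsilon> a"
    using counit_extension_exists by blast
  note Hopf_on_AP = antipode_right[OF e D(2)] antipode_left[OF e D(2)] counit_left[OF e D(2)] counit_right[OF e D(2)]
  \<comment> \<open>The flip composed with \<kappa> \<otimes> \<kappa>, read in M(A \<otimes> A),
    where the convolution products are formed.\<close>
  define K where "K = tensor_lift (\<lambda>a b. mtens (\<kappa>M b) (\<kappa>M a))"
  have bK: "cbilinear (\<lambda>a b. mtens (\<kappa>M b) (\<kappa>M a))"
    unfolding cbilinear_iff_clinear by (intro conjI allI mult_clinear_intros \<kappa>M_linear)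
  have K_linear: "clinear K" unfolding K_def by (rule clinear_tensor_lift[OF bK])
  have K_range: "K z \<in> range mult_tensor" for z
  proof (induction z rule: tens_induct)
    case (tens a b)
    have "K (a \<otimes>\<^sub>t b) = mult_tensor (\<kappa>M b \<otimes>\<^sub>t \<kappa>M a)"
      by (simp add: K_def bK mult_tensor_tens)
    then show ?case by simp
  next
    case (add u v)
    then obtain u' v' where "K u = mult_tensor u'" "K v = mult_tensor v'" by blast
    then have "K (u + v) = mult_tensor (u' + v')"
      by (simp only: clinear_add[OF K_linear] clinear_add[OF clinear_mult_tensor])
    then show ?case by simp
  qed
  \<comment> \<open>Both sides are convolution inverses of \<open>\<delta>M\<close>, one from the
    left and one from the right. On the left this is the antipode identity under the homomorphism
    \<open>\<delta>M\<close>; on the right it is a computation with four legs.\<close>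
  have \<delta>\<kappa>: "\<delta>M (\<kappa>M x) = K (D x)" if "x \<in> AP" for x
  proof (rule convolution_inverse_unique[of "\<lambda>x. \<delta>M (\<kappa>M x)" \<delta>M "\<lambda>x. K (D x)" e e])
    show "clinear (\<lambda>x. \<delta>M (\<kappa>M x))" "clinear (\<lambda>x. K (D x))"
      by (intro clinear_compose[OF \<kappa>M_linear \<delta>M_linear] clinear_compose[OF D(1) K_linear])+
    fix x assume x: "x \<in> AP"
    show "tensor_lift (\<lambda>a b. \<delta>M (\<kappa>M a) * \<delta>M b) (D x) = e x *\<^sub>C 1"
      using arg_cong[OF Hopf_on_AP(2)[OF x], of \<delta>M]
      by (simp add: clinear_tensor_lift_out[OF \<delta>M_linear bilinear_\<kappa>M_id] \<delta>M_times clinear_scaleC[OF \<delta>M_linear] \<delta>M_one)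
    have bKD: "cbilinear (\<lambda>c b. mtens a c * K (D b))" for a
      unfolding cbilinear_iff_clinear
      by (intro conjI allI mult_clinear_intros clinear_compose[OF D(1) K_linear])
    have bKD': "cbilinear (\<lambda>a c. mtens a c * K (D b))" for b
      unfolding cbilinear_iff_clinear by (intro conjI allI mult_clinear_intros)
    have b1: "cbilinear (\<lambda>a b. \<delta>M a * K (D b))" "cbilinear (\<lambda>y b. mult_tensor (D y) * K (D b))"
      unfolding cbilinear_iff_clinear
      by (intro conjI allI mult_clinear_intros \<delta>M_linear clinear_compose[OF D(1) K_linear] D(1))+
    have b2: "cbilinear (\<lambda>a y. tensor_lift (\<lambda>c b. mtens a c * K (D b)) (D y))"
      by (subst cbilinear_iff_clinear)
        (intro conjI allI clinear_tensor_lift_param clinear_tensor_lift_arg bKD D(1) mult_clinear_intros)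
    have b3: "cbilinear (\<lambda>a y. mtens (a * \<kappa>M y) 1)"
      unfolding cbilinear_iff_clinear by (intro conjI allI mult_clinear_intros \<kappa>M_linear)
    have b4: "cbilinear (\<lambda>b b'. mtens (a * \<kappa>M b') (c * \<kappa>M b))" for a c
      unfolding cbilinear_iff_clinear by (intro conjI allI mult_clinear_intros \<kappa>M_linear)
    have b4': "cbilinear (\<lambda>c b. mtens (a * \<kappa>M b') (c * \<kappa>M b))" for a b'
      unfolding cbilinear_iff_clinear by (intro conjI allI mult_clinear_intros \<kappa>M_linear)
    have b5: "cbilinear (\<lambda>y b'. tensor_lift (\<lambda>c b. mtens (a * \<kappa>M b') (c * \<kappa>M b)) (D y))" for a
      by (subst cbilinear_iff_clinear)
        (intro conjI allI clinear_tensor_lift_param clinear_tensor_lift_arg b4' D(1) mult_clinear_intros \<kappa>M_linear)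
    have b6: "cbilinear (\<lambda>y b'. e y *\<^sub>C mtens (a * \<kappa>M b') 1)" for a
      unfolding cbilinear_iff_clinear by (intro conjI allI mult_clinear_intros \<kappa>M_linear e(1))
    have b7: "cbilinear (\<lambda>y (b' :: 'a multiplier). e y *\<^sub>C b')"
      by (rule slice_bilinear(2)[OF e(1)])
    have mtens_K: "mtens a c * K u = tensor_lift (\<lambda>b b'. mtens (a * \<kappa>M b') (c * \<kappa>M b)) u" for a c u
      unfolding K_def by (simp add: clinear_tensor_lift_out[OF clinear_mult_left bK] mtens_times)
    \<comment> \<open>The first leg a is held fixed. The Sweedler sum of a \<kappa>(y3) \<otimes> y1
      \<kappa>(y2) collapses by the antipode law in its second factor, and then by the left counit
      law to a \<kappa>(y) \<otimes> 1.\<close>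
    have inner: "tensor_lift (\<lambda>c b. mtens a c * K (D b)) (D y) = mtens (a * \<kappa>M y) 1" if y: "y \<in> AP" for a y
    proof -
      have "tensor_lift (\<lambda>c b. mtens a c * K (D b)) (D y) =
          tensor_lift (\<lambda>c y. tensor_lift (\<lambda>b b'. mtens (a * \<kappa>M b') (c * \<kappa>M b)) (D y)) (D y)"
        by (simp add: mtens_K)
      also have "\<dots> = tensor_lift (\<lambda>y b'. tensor_lift (\<lambda>c b. mtens (a * \<kappa>M b') (c * \<kappa>M b)) (D y)) (D y)"
        by (rule coassociative_trilinear[OF y]) (intro mult_clinear_intros \<kappa>M_linear)+
      also have "\<dots> = tensor_lift (\<lambda>y b'. e y *\<^sub>C mtens (a * \<kappa>M b') 1) (D y)"
      proof (rule tensor_lift_D_cong[OF y b5 b6])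
        fix y b' assume "y \<in> AP"
        have "tensor_lift (\<lambda>c b. mtens (a * \<kappa>M b') (c * \<kappa>M b)) (D y) =
            mtens (a * \<kappa>M b') (tensor_lift (\<lambda>c b. c * \<kappa>M b) (D y))"
          by (rule clinear_tensor_lift_out[symmetric]) (intro mult_clinear_intros bilinear_id_\<kappa>M)+
        also have "\<dots> = e y *\<^sub>C mtens (a * \<kappa>M b') 1"
          by (simp add: Hopf_on_AP(1)[OF \<open>y \<in> AP\<close>] clinear_scaleC[OF clinear_mtens_right[OF clinear_ident]])
        finally show "tensor_lift (\<lambda>c b. mtens (a * \<kappa>M b') (c * \<kappa>M b)) (D y) = e y *\<^sub>C mtens (a * \<kappa>M b') 1" .
      qed
      also have "\<dots> = mtens (a * \<kappa>M (tensor_lift (\<lambda>y b'. e y *\<^sub>C b') (D y))) 1"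
      proof -
        have lin: "clinear (\<lambda>z. mtens (a * \<kappa>M z) 1)" by (intro mult_clinear_intros \<kappa>M_linear)
        show ?thesis
          by (simp add: clinear_tensor_lift_out[OF lin b7] clinear_scaleC[OF lin])
      qed
      also have "\<dots> = mtens (a * \<kappa>M y) 1" by (simp add: Hopf_on_AP(3)[OF y])
      finally show ?thesis .
    qed
    have "tensor_lift (\<lambda>a b. \<delta>M a * K (D b)) (D x) = tensor_lift (\<lambda>y b. mult_tensor (D y) * K (D b)) (D x)"
      by (rule tensor_lift_D_cong[OF x b1]) (simp add: D(2))
    also have "\<dots> = tensor_lift (\<lambda>y b. tensor_lift (\<lambda>a c. mtens a c * K (D b)) (D y)) (D x)"
      unfolding mult_tensor_def by (simp add: clinear_tensor_lift_out[OF clinear_mult_right cbilinear_mtens])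
    also have "\<dots> = tensor_lift (\<lambda>a y. tensor_lift (\<lambda>c b. mtens a c * K (D b)) (D y)) (D x)"
      by (rule coassociative_trilinear[OF x, symmetric])
        (intro mult_clinear_intros clinear_compose[OF D(1) K_linear])+
    also have "\<dots> = tensor_lift (\<lambda>a y. mtens (a * \<kappa>M y) 1) (D x)"
      by (rule tensor_lift_D_cong[OF x b2 b3]) (rule inner)
    also have "\<dots> = mtens (tensor_lift (\<lambda>a y. a * \<kappa>M y) (D x)) 1"
      by (rule clinear_tensor_lift_out[symmetric]) (intro mult_clinear_intros bilinear_id_\<kappa>M)+
    also have "\<dots> = e x *\<^sub>C 1"
      by (simp add: Hopf_on_AP(1)[OF x] clinear_scaleC[OF clinear_mtens_left[OF clinear_ident]])
    finally show "tensor_lift (\<lambda>a b. \<delta>M a * K (D b)) (D x) = e x *\<^sub>C 1" .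
  qed (fact that e(1) \<delta>M_linear | erule Hopf_on_AP)+
  have \<kappa>M_in: "\<kappa>M x \<in> AP" if "x \<in> AP" for x
    using \<delta>\<kappa>[OF that] K_range by (simp add: almost_periodic_def)
  \<comment> \<open>The star is conjugate linear and cannot be moved through a complex linear lift
    alone; taken once inside and once outside it gives a linear map.\<close>
  have star_lift: "star (tensor_lift \<beta> (star z)) = tensor_lift (\<lambda>a b. star (\<beta> (star a) (star b))) z"
    if \<beta>: "cbilinear \<beta>" for \<beta> :: "'a multiplier \<Rightarrow> 'a multiplier \<Rightarrow> 'a multiplier" and z
  proof -
    have lin: "clinear (\<lambda>b. \<beta> a b)" "clinear (\<lambda>a. \<beta> a b)" for a b
      using \<beta> by (simp_all add: cbilinear_iff_clinear)
    have b: "cbilinear (\<lambda>a b. star (\<beta> (star a) (star b)))"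
      by (rule cbilinearI) (simp_all add: star_add star_scaleC clinear_add[OF lin(1)] clinear_add[OF lin(2)]
          clinear_scaleC[OF lin(1)] clinear_scaleC[OF lin(2)])
    have "clinear (\<lambda>z. star (tensor_lift \<beta> (star z)))"
      by (rule clinearI) (simp_all add: star_add star_scaleC \<beta>)
    then show ?thesis
      by (rule clinear_eq_tensI[OF _ clinear_tensor_lift[OF b]]) (simp add: \<beta> b star_tensor_aux(2))
  qed
  have D_star: "D (star x) = star (D x)" if "x \<in> AP" for x
    by (rule iffD1[OF mult_tensor_inject[OF nd nd]])
      (simp add: D(2) AP_star that \<delta>M_star star_mult_tensor[symmetric])
  have star_\<kappa>_linear: "clinear (\<lambda>x. \<kappa>M (star (\<kappa>M (star x))))"
    by (rule clinearI) (simp_all add: star_add star_scaleC clinear_add[OF \<kappa>M_linear] clinear_scaleC[OF \<kappa>M_linear])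
  have e_star_linear: "clinear (\<lambda>x. cnj (e (star x)))"
    by (rule clinearI) (simp_all add: star_add star_scaleC clinear_add[OF e(1)] clinear_scaleC[OF e(1)] scaleC_complex_def)
  \<comment> \<open>The identity is a left and \<kappa> \<circ> star \<circ> \<kappa> \<circ> star a
    right convolution inverse of \<kappa>. The latter holds since \<kappa>(a) \<kappa>(star
    (\<kappa>(star b))) = \<kappa>(star (star a \<kappa>(star b))), so the star of an antipode
    identity applies and the second unit becomes x \<mapsto> cnj (e (star x)).\<close>
  have \<kappa>_star: "x = \<kappa>M (star (\<kappa>M (star x)))" if "x \<in> AP" for x
  proof (rule convolution_inverse_unique[of "\<lambda>x. x" \<kappa>M "\<lambda>x. \<kappa>M (star (\<kappa>M (star x)))" e "\<lambda>x. cnj (e (star x))"])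
    fix x assume x: "x \<in> AP"
    have "tensor_lift (\<lambda>a b. \<kappa>M a * \<kappa>M (star (\<kappa>M (star b)))) (D x) =
        \<kappa>M (tensor_lift (\<lambda>a b. star (star a * \<kappa>M (star b))) (D x))"
    proof -
      have b: "cbilinear (\<lambda>a b. star (star a * \<kappa>M (star b)))"
        by (rule cbilinearI) (simp_all add: star_add star_scaleC clinear_add[OF \<kappa>M_linear]
            clinear_scaleC[OF \<kappa>M_linear] distrib_left distrib_right mult_scaleC_left mult_scaleC_right)
      show ?thesis
        by (subst clinear_tensor_lift_out[OF \<kappa>M_linear b]) (simp add: star_mult star_star \<kappa>M_times)
    qed
    also have "\<dots> = \<kappa>M (star (tensor_lift (\<lambda>a b. a * \<kappa>M b) (D (star x))))"
      by (simp add: D_star[OF x] star_lift[OF bilinear_id_\<kappa>M])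
    also have "\<dots> = cnj (e (star x)) *\<^sub>C 1"
      by (simp add: Hopf_on_AP(1)[OF AP_star[OF x]] star_scaleC star_one \<kappa>M_one clinear_scaleC[OF \<kappa>M_linear])
    finally show "tensor_lift (\<lambda>a b. \<kappa>M a * \<kappa>M (star (\<kappa>M (star b)))) (D x) = cnj (e (star x)) *\<^sub>C 1" .
    have "tensor_lift (\<lambda>a b. cnj (e (star b)) *\<^sub>C a) (D x) = star (tensor_lift (\<lambda>a b. e b *\<^sub>C a) (D (star x)))"
      by (simp add: D_star[OF x] star_lift[OF slice_bilinear(1)[OF e(1)]] star_scaleC star_star)
    also have "\<dots> = x" by (simp add: Hopf_on_AP(4)[OF AP_star[OF x]] star_star)
    finally show "tensor_lift (\<lambda>a b. cnj (e (star b)) *\<^sub>C a) (D x) = x" .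
  qed (fact that e(1) \<kappa>M_linear clinear_ident star_\<kappa>_linear e_star_linear | erule Hopf_on_AP)+
  show ?thesis
  proof
    show "\<kappa>M ` AP \<subseteq> AP" using \<kappa>M_in by blast
    show "AP \<subseteq> \<kappa>M ` AP"
    proof
      fix x assume x: "x \<in> AP"
      \<comment> \<open>This element is the preimage of x under \<kappa> that the star identity
        provides.\<close>
      have "star (\<kappa>M (star x)) \<in> AP" by (intro AP_star \<kappa>M_in x)
      then show "x \<in> \<kappa>M ` AP" by (rule rev_image_eqI) (rule \<kappa>_star[OF x])
    qed
  qed
qed

end

theorem theorem4p3:
  fixes \<delta> :: "'a::complex_star_algebra \<Rightarrow> ('a \<otimes>\<^sub>t 'a) multiplier"
    and \<epsilon> :: "'a \<Rightarrow> complex"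
    and \<kappa> :: "'a \<Rightarrow> 'a multiplier"
    and \<delta>M :: "'a multiplier \<Rightarrow> ('a \<otimes>\<^sub>t 'a) multiplier"
    and \<kappa>M :: "'a multiplier \<Rightarrow> 'a multiplier"
  assumes "discrete_quantum_group \<delta>"
    and "counit \<delta> \<epsilon>" and "coinverse \<delta> \<epsilon> \<kappa>"
    and "hom_extension \<delta> \<delta>M" and "antihom_extension \<kappa> \<kappa>M"
  shows "unital_star_subalgebra (almost_periodic \<delta>M) \<and>
    \<delta>M ` almost_periodic \<delta>M
      \<subseteq> mult_tensor ` tensor_set (almost_periodic \<delta>M) (almost_periodic \<delta>M) \<and>
    \<kappa>M ` almost_periodic \<delta>M = almost_periodic \<delta>M"
proof -
  interpret multiplier_Hopf_star_extension \<delta> \<delta>M \<epsilon> \<kappa> \<kappa>M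
    by unfold_locales
      (use assms in \<open>auto simp: discrete_quantum_group_def multiplier_Hopf_star_algebra_def\<close>)
  have "\<delta>M x \<in> mult_tensor ` tensor_set AP AP" if x: "x \<in> AP" for x
  proof -
    obtain w where w: "\<delta>M x = mult_tensor w"
      using x unfolding almost_periodic_def by blast
    show ?thesis
      unfolding w by (rule imageI) (rule comultiplication_AP[OF w[symmetric]])
  qed
  then show ?thesis using AP_unital_star_subalgebra \<kappa>M_AP by blast
qed

end
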